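(* Let $\ell_{\{p_n\}}$ be a Nakano sequence space with $p_n\ge1$ and $\liminf_{n\to\infty}p_n=p>1$. Then: (a) There is an equivalent Fréchet differentiable norm in $\ell_{\{p_n\}}$ and, therefore, $\ell_{\{p_n\}}$ is an Asplund space. (b) If moreover $\limsup_{n\to\infty}p_n<+\infty$ and $p<2$, then for any $\varepsilon>0$ there is no nontrivial Fréchet differentiable bump function $b:\ell_{\{p_n\}}\to\mathbb{R}$ with the estimate $$b(x+h)=b(x)+b'(x)(h)+O(\|h\|^{p+\varepsilon})\quad (h\to0)$$ at every $x\in\ell_{\{p_n\}}$.
   Context: The Nakano sequence space $\ell_{\{p_n\}}$ is the space of real sequences $x$ with $\sum_{n=1}^\infty|\lambda x_n|^{p_n}<\infty$ for some $\lambda>0$, with the Luxemburg norm $\|x\|=\inf\{r>0:\sum_{n}|x_n/r|^{p_n}\le1\}$ (i.e. the Musielak--Orlicz sequence space generated by $\Phi_n(t)=|t|^{p_n}$). A norm is Fréchet differentiable if it is Fréchet differentiable at every point of its unit sphere. A bump function is a real function, not identically zero, with bounded support.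
   Formalization: Part (a) fails for the full space when limsup p_n = ∞ (it then contains ℓ_∞ and is not Asplund), so it is stated for the full space only if limsup p_n < ∞, and without restriction for the subspace of x with Σ|λx_n|^{p_n} < ∞ for every λ > 0. *)

theory Defs
  imports "HOL-Analysis.Analysis" "HOL-Library.Function_Algebras"
begin

text \<open>Sequences form a real vector space under pointwise operations.\<close>

instantiation "fun" :: (type, real_vector) real_vector
begin

definition scaleR_fun :: "real \<Rightarrow> ('a \<Rightarrow> 'b) \<Rightarrow> 'a \<Rightarrow> 'b"
  where "scaleR_fun c f = (\<lambda>i. c *\<^sub>R f i)"

instance
  by standard (auto simp: scaleR_fun_def fun_eq_iff scaleR_add_right scaleR_add_left)

end

lemma scaleR_fun_apply [simp]: "(c *\<^sub>R f) i = c *\<^sub>R f i"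
  by (simp add: scaleR_fun_def)

text \<open>
  The norm of a Nakano space depends on the exponents, so it cannot come from a type class.
  A normed space is therefore a linear subspace \<open>S\<close> of an ambient real vector space together
  with a function \<open>N\<close>, of which only the values on \<open>S\<close> matter. The constants \<open>open\<close>, \<open>dist\<close>,
  \<open>bounded\<close>, etc. on \<open>nat \<Rightarrow> real\<close> belong to the product topology and are not used.
\<close>

definition normed_on :: "'v::real_vector set \<Rightarrow> ('v \<Rightarrow> real) \<Rightarrow> bool" where
  "normed_on S N \<longleftrightarrow> subspace S
     \<and> (\<forall>x\<in>S. 0 \<le> N x)
     \<and> (\<forall>x\<in>S. N x = 0 \<longleftrightarrow> x = 0)
     \<and> (\<forall>c. \<forall>x\<in>S. N (c *\<^sub>R x) = \<bar>c\<bar> * N x)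
     \<and> (\<forall>x\<in>S. \<forall>y\<in>S. N (x + y) \<le> N x + N y)"

text \<open>\<open>Metric_space\<close> demands symmetry and nonnegativity outside the carrier too.\<close>

definition norm_dist :: "'v::real_vector set \<Rightarrow> ('v \<Rightarrow> real) \<Rightarrow> 'v \<Rightarrow> 'v \<Rightarrow> real" where
  "norm_dist S N x y = (if x \<in> S \<and> y \<in> S then N (x - y) else 0)"

lemma Metric_space_norm_dist:
  assumes "normed_on S N"
  shows "Metric_space S (norm_dist S N)"
proof
  have sub: "subspace S" and nn: "\<And>x. x \<in> S \<Longrightarrow> 0 \<le> N x"
    and z: "\<And>x. x \<in> S \<Longrightarrow> N x = 0 \<longleftrightarrow> x = 0"
    and hom: "\<And>c x. x \<in> S \<Longrightarrow> N (c *\<^sub>R x) = \<bar>c\<bar> * N x"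
    and tri: "\<And>x y. x \<in> S \<Longrightarrow> y \<in> S \<Longrightarrow> N (x + y) \<le> N x + N y"
    using assms by (auto simp: normed_on_def)
  note diff = subspace_diff[OF sub]
  show "0 \<le> norm_dist S N x y" for x y
    using nn diff by (simp add: norm_dist_def)
  show "norm_dist S N x y = norm_dist S N y x" for x y
    using hom[of "x - y" "-1"] diff by (simp add: norm_dist_def)
  show "norm_dist S N x y = 0 \<longleftrightarrow> x = y" if "x \<in> S" "y \<in> S" for x y
    using that z diff by (simp add: norm_dist_def)
  show "norm_dist S N x w \<le> norm_dist S N x y + norm_dist S N y w"
    if "x \<in> S" "y \<in> S" "w \<in> S" for x y w
    using that tri[of "x - y" "y - w"] diff by (simp add: norm_dist_def)
qed

definition norm_topology :: "'v::real_vector set \<Rightarrow> ('v \<Rightarrow> real) \<Rightarrow> 'v topology" where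
  "norm_topology S N = Metric_space.mtopology S (norm_dist S N)"

definition banach_on :: "'v::real_vector set \<Rightarrow> ('v \<Rightarrow> real) \<Rightarrow> bool" where
  "banach_on S N \<longleftrightarrow> normed_on S N \<and> Metric_space.mcomplete S (norm_dist S N)"

definition bounded_functional_on ::
    "'v::real_vector set \<Rightarrow> ('v \<Rightarrow> real) \<Rightarrow> ('v \<Rightarrow> real) \<Rightarrow> bool" where
  "bounded_functional_on S N D \<longleftrightarrow>
     (\<forall>x\<in>S. \<forall>y\<in>S. D (x + y) = D x + D y)
     \<and> (\<forall>c. \<forall>x\<in>S. D (c *\<^sub>R x) = c * D x)
     \<and> (\<exists>K. \<forall>x\<in>S. \<bar>D x\<bar> \<le> K * N x)"

text \<open>
  \<open>f\<close> needs to be meaningful only near \<open>x\<close>, so this also applies to functions on an open subset.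
\<close>

definition frechet_deriv_on ::
    "'v::real_vector set \<Rightarrow> ('v \<Rightarrow> real) \<Rightarrow> ('v \<Rightarrow> real) \<Rightarrow> ('v \<Rightarrow> real) \<Rightarrow> 'v \<Rightarrow> bool" where
  "frechet_deriv_on S N f D x \<longleftrightarrow> bounded_functional_on S N D
     \<and> (\<forall>e>0. \<exists>d>0. \<forall>h\<in>S. N h < d \<longrightarrow> \<bar>f (x + h) - f x - D h\<bar> \<le> e * N h)"

definition equivalent_norm_on ::
    "'v::real_vector set \<Rightarrow> ('v \<Rightarrow> real) \<Rightarrow> ('v \<Rightarrow> real) \<Rightarrow> bool" where
  "equivalent_norm_on S N M \<longleftrightarrow> normed_on S M
     \<and> (\<exists>c>0. \<exists>C>0. \<forall>x\<in>S. c * N x \<le> M x \<and> M x \<le> C * N x)"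

definition frechet_norm_on :: "'v::real_vector set \<Rightarrow> ('v \<Rightarrow> real) \<Rightarrow> bool" where
  "frechet_norm_on S M \<longleftrightarrow> normed_on S M
     \<and> (\<forall>x\<in>S. M x = 1 \<longrightarrow> (\<exists>D. frechet_deriv_on S M M D x))"

definition asplund_on :: "'v::real_vector set \<Rightarrow> ('v \<Rightarrow> real) \<Rightarrow> bool" where
  "asplund_on S N \<longleftrightarrow> banach_on S N
     \<and> (\<forall>U f. openin (norm_topology S N) U \<and> U \<noteq> {} \<and> convex_on U f
          \<and> continuous_map (subtopology (norm_topology S N) U) euclideanreal f
        \<longrightarrow> (\<exists>G. gdelta_in (subtopology (norm_topology S N) U) G
               \<and> U \<subseteq> norm_topology S N closure_of G
               \<and> (\<forall>x\<in>G. \<exists>D. frechet_deriv_on S N f D x)))"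

definition bump_on :: "'v::real_vector set \<Rightarrow> ('v \<Rightarrow> real) \<Rightarrow> ('v \<Rightarrow> real) \<Rightarrow> bool" where
  "bump_on S N b \<longleftrightarrow> (\<exists>x\<in>S. b x \<noteq> 0) \<and> (\<exists>R. \<forall>x\<in>S. b x \<noteq> 0 \<longrightarrow> N x \<le> R)"

definition nakano :: "(nat \<Rightarrow> real) \<Rightarrow> (nat \<Rightarrow> real) set" where
  "nakano q = {x. \<exists>l>0. summable (\<lambda>n. \<bar>l * x n\<bar> powr q n)}"

text \<open>
  The subspace of those \<open>x\<close> for which the modular of \<open>l * x\<close> is finite for every \<open>l\<close>.
\<close>

definition nakano_heart :: "(nat \<Rightarrow> real) \<Rightarrow> (nat \<Rightarrow> real) set" where
  "nakano_heart q = {x. \<forall>l>0. summable (\<lambda>n. \<bar>l * x n\<bar> powr q n)}"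

definition luxemburg :: "(nat \<Rightarrow> real) \<Rightarrow> (nat \<Rightarrow> real) \<Rightarrow> real" where
  "luxemburg q x = Inf {r. r > 0 \<and> summable (\<lambda>n. \<bar>x n / r\<bar> powr q n)
                             \<and> (\<Sum>n. \<bar>x n / r\<bar> powr q n) \<le> 1}"

lemma nakano_heart_subset: "nakano_heart q \<subseteq> nakano q"
  unfolding nakano_def nakano_heart_def using zero_less_one by blast

lemma nakano_heart_eq:
  assumes "\<And>n. q n \<ge> 1" and "limsup (\<lambda>n. ereal (q n)) < \<infinity>"
  shows "nakano_heart q = nakano q"
proof
  show "nakano q \<subseteq> nakano_heart q"
  proof
    fix x assume "x \<in> nakano q"
    then obtain l where l: "l > 0" "summable (\<lambda>n. \<bar>l * x n\<bar> powr q n)"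
      by (auto simp: nakano_def)
    obtain c where "limsup (\<lambda>n. ereal (q n)) < c" "c < \<infinity>"
      using assms(2) dense by blast
    then obtain B where c: "limsup (\<lambda>n. ereal (q n)) < ereal B"
      by (cases c) auto
    have ev: "\<forall>\<^sub>F n in sequentially. q n < B"
      using Limsup_lessD[OF c] by simp
    have "summable (\<lambda>n. \<bar>m * x n\<bar> powr q n)" if "m > 0" for m
    proof (rule summable_comparison_test_ev)
      define a where "a = max 1 (m / l)"
      have a: "a \<ge> 1" "m \<le> a * l"
        using l(1) by (auto simp: a_def max_def field_simps)
      show "summable (\<lambda>n. a powr B * \<bar>l * x n\<bar> powr q n)"
        by (rule summable_mult[OF l(2)])
      show "\<forall>\<^sub>F n in sequentially. norm (\<bar>m * x n\<bar> powr q n) \<le> a powr B * \<bar>l * x n\<bar> powr q n"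
        using ev
      proof eventually_elim
        case (elim n)
        have "\<bar>m * x n\<bar> \<le> a * \<bar>l * x n\<bar>"
          using a that l(1) mult_right_mono[OF a(2), of "\<bar>x n\<bar>"] by (simp add: abs_mult mult.assoc)
        then have "\<bar>m * x n\<bar> powr q n \<le> (a * \<bar>l * x n\<bar>) powr q n"
          using assms(1)[of n] by (intro powr_mono2) auto
        also have "\<dots> = a powr q n * \<bar>l * x n\<bar> powr q n"
          using a by (simp add: powr_mult)
        also have "\<dots> \<le> a powr B * \<bar>l * x n\<bar> powr q n"
          using a elim by (intro mult_right_mono powr_mono) auto
        finally show ?case by simp
      qed
    qed
    then show "x \<in> nakano_heart q"
      by (simp add: nakano_heart_def)
  qed
qed (rule nakano_heart_subset)

text \<open>
  With unbounded exponents \<open>nakano q\<close> contains an isomorphic copy of the bounded sequences, so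
  it is not an Asplund space, whatever the lower limit of the exponents is. Below, an upper limit
  along a subsequence of coordinates is a continuous convex function without any point of
  differentiability. The renorming and Asplund properties are therefore meant for
  \<open>nakano_heart q\<close>, which is the whole space exactly in the case of bounded exponents.
\<close>

lemma not_asplund_nakano_unbounded:
  assumes q1: "\<And>n. q n \<ge> 1" and "limsup (\<lambda>n. ereal (q n)) = \<infinity>"
  shows "\<not> asplund_on (nakano q) (luxemburg q)"
proof
  let ?S = "nakano q" and ?N = "luxemburg q"
  let ?T = "norm_topology ?S ?N"
  assume asp: "asplund_on ?S ?N"
  then have nrm: "normed_on ?S ?N"
    by (simp add: asplund_on_def banach_on_def)
  then have sub: "subspace ?S"
    and hom: "\<And>c x. x \<in> ?S \<Longrightarrow> ?N (c *\<^sub>R x) = \<bar>c\<bar> * ?N x"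
    by (auto simp: normed_on_def)
  interpret MS: Metric_space ?S "norm_dist ?S ?N"
    by (rule Metric_space_norm_dist[OF nrm])
  have T: "?T = MS.mtopology"
    by (simp add: norm_topology_def)

  have freq: "\<exists>n>m. q n \<ge> real k" for m k :: nat
  proof (rule ccontr)
    assume "\<not> ?thesis"
    then have "\<forall>\<^sub>F n in sequentially. ereal (q n) \<le> ereal (real k)"
      unfolding eventually_sequentially
      by (intro exI[of _ "Suc m"]) (auto simp: Suc_le_eq not_le intro: less_imp_le)
    then have "limsup (\<lambda>n. ereal (q n)) \<le> ereal (real k)"
      by (rule Limsup_bounded)
    then show False
      using assms(2) by simp
  qed
  have "\<exists>s. \<forall>k. q (s k) \<ge> real (Suc k) \<and> s k < s (Suc k)"
  proof (rule dependent_nat_choice)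
    show "\<exists>y. real (Suc 0) \<le> q y" using freq[of 0 "Suc 0"] by blast
    show "\<exists>y. real (Suc (Suc k)) \<le> q y \<and> x < y" for x k
      using freq[of x "Suc (Suc k)"] by blast
  qed
  then obtain s where s: "\<And>k. q (s k) \<ge> real (Suc k)" "strict_mono s"
    by (auto simp: strict_mono_Suc_iff)

  have below: "\<bar>x n\<bar> \<le> ?N x" if xS: "x \<in> ?S" for x n
  proof -
    let ?A = "{r. r > 0 \<and> summable (\<lambda>n. \<bar>x n / r\<bar> powr q n) \<and> (\<Sum>n. \<bar>x n / r\<bar> powr q n) \<le> 1}"
    have "?A \<noteq> {}"
    proof -
      obtain l where l: "l > 0" "summable (\<lambda>n. \<bar>l * x n\<bar> powr q n)"
        using xS by (auto simp: nakano_def)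
      define c where "c = 1 / (1 + (\<Sum>n. \<bar>l * x n\<bar> powr q n))"
      have nn: "0 \<le> (\<Sum>n. \<bar>l * x n\<bar> powr q n)"
        by (rule suminf_nonneg[OF l(2)]) simp
      have c: "0 < c" "c \<le> 1" "c * (\<Sum>n. \<bar>l * x n\<bar> powr q n) \<le> 1"
        using nn by (auto simp: c_def field_simps)
      define r where "r = 1 / (c * l)"
      have le: "\<bar>x n / r\<bar> powr q n \<le> c * \<bar>l * x n\<bar> powr q n" for n
      proof -
        have "\<bar>x n / r\<bar> powr q n = c powr q n * \<bar>l * x n\<bar> powr q n"
          using c l by (simp add: r_def abs_mult powr_mult mult_ac)
        also have "c powr q n \<le> c powr 1"
          using c q1 by (intro powr_mono') auto
        finally show ?thesis
          using c by (simp add: mult_right_mono)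
      qed
      have sc: "summable (\<lambda>n. c * \<bar>l * x n\<bar> powr q n)"
        by (rule summable_mult[OF l(2)])
      have sr: "summable (\<lambda>n. \<bar>x n / r\<bar> powr q n)"
        by (rule summable_comparison_test'[OF sc, of 0]) (use le in simp)
      have "(\<Sum>n. \<bar>x n / r\<bar> powr q n) \<le> 1"
        using suminf_le[OF le sr sc] suminf_mult[OF l(2), of c] c by simp
      moreover have "r > 0"
        using c l by (simp add: r_def)
      ultimately have "r \<in> ?A"
        using sr by blast
      then show ?thesis by blast
    qed
    moreover have "\<bar>x n\<bar> \<le> r" if r: "r \<in> ?A" for r
    proof -
      have "\<bar>x n / r\<bar> powr q n \<le> (\<Sum>n. \<bar>x n / r\<bar> powr q n)"
        using sum_le_suminf[of "\<lambda>n. \<bar>x n / r\<bar> powr q n" "{n}"] r by (simp del: abs_divide)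
      also have "\<dots> \<le> 1" using r by blast
      finally have "\<not> \<bar>x n / r\<bar> > 1"
        using q1[of n] gr_one_powr[of "\<bar>x n / r\<bar>" "q n"] by linarith
      then show ?thesis using r by (simp add: abs_divide field_simps)
    qed
    ultimately show ?thesis
      unfolding luxemburg_def by (intro cInf_greatest) auto
  qed

  have ind: "indicat_real (s ` A) \<in> ?S \<and> ?N (indicat_real (s ` A)) \<le> 2" for A
  proof -
    let ?h = "indicat_real (s ` A)"
    let ?g = "\<lambda>n. \<bar>?h n / 2\<bar> powr q n"
    have g0: "?g n = 0" if "n \<notin> range s" for n
      using that by (auto simp: indicator_def)
    have gs: "(?g \<circ> s) k \<le> (1/2) ^ Suc k" for k
    proof -
      have "(?g \<circ> s) k \<le> (1/2) powr q (s k)"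
        by (auto simp: indicator_def)
      also have "\<dots> \<le> (1/2) powr real (Suc k)"
        by (intro powr_mono' s) auto
      finally show ?thesis by (simp only: powr_realpow)
    qed
    have geo: "(\<lambda>k. (1/2::real) ^ Suc k) sums 1"
      by (rule power_half_series)
    have sgs: "summable (?g \<circ> s)"
      by (rule summable_comparison_test'[OF sums_summable[OF geo], of 0]) (use gs in simp)
    have sg: "summable ?g"
      using summable_mono_reindex[OF s(2), of ?g] g0 sgs by (simp add: o_def)
    have "suminf ?g = suminf (?g \<circ> s)"
      using suminf_mono_reindex[OF s(2), of ?g] g0 by (simp add: o_def)
    also have "\<dots> \<le> 1"
      using suminf_le[OF gs sgs sums_summable[OF geo]] sums_unique[OF geo] by simp
    finally have le1: "suminf ?g \<le> 1" .
    have "?h \<in> ?S"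
      unfolding nakano_def using sg by (intro CollectI exI[of _ "1/2"]) simp
    moreover have "?N ?h \<le> 2"
      unfolding luxemburg_def
      by (rule cInf_lower) (use sg le1 in \<open>auto intro!: bdd_belowI[of _ 0]\<close>)
    ultimately show ?thesis by blast
  qed

  define F where "F x = limsup (\<lambda>k. ereal (x (s k)))" for x :: "nat \<Rightarrow> real"
  define f where "f x = real_of_ereal (F x)" for x :: "nat \<Rightarrow> real"
  have F_le: "F x \<le> ereal (?N x)" if "x \<in> ?S" for x
    unfolding F_def using below[OF that] by (intro Limsup_bounded) (auto simp: abs_le_iff)
  have F_ge: "F x \<ge> ereal (- ?N x)" if "x \<in> ?S" for x
  proof -
    have "ereal (- ?N x) \<le> liminf (\<lambda>k. ereal (x (s k)))"
    proof (intro Liminf_bounded always_eventually allI)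
      show "ereal (- ?N x) \<le> ereal (x (s k))" for k
        using below[OF that, of "s k"] by simp
    qed
    also have "\<dots> \<le> F x" unfolding F_def by (rule Liminf_le_Limsup) simp
    finally show ?thesis .
  qed
  have Ff: "F x = ereal (f x)" if "x \<in> ?S" for x
    using F_le[OF that] F_ge[OF that] unfolding f_def by (cases "F x") auto
  have f_le: "f x \<le> ?N x" if "x \<in> ?S" for x
    using F_le[OF that] Ff[OF that] by simp
  have f_add: "f (x + y) \<le> f x + f y" if "x \<in> ?S" "y \<in> ?S" for x y
    using ereal_limsup_add_mono[of "\<lambda>k. ereal (x (s k))" "\<lambda>k. ereal (y (s k))"]
      Ff[OF that(1)] Ff[OF that(2)] Ff[OF subspace_add[OF sub that]]
    by (simp add: F_def)
  have f_scale: "f (c *\<^sub>R x) = c * f x" if "x \<in> ?S" "c \<ge> 0" for x c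
    using limsup_ereal_mult_left[of c "\<lambda>k. ereal (x (s k))"]
      Ff[OF that(1)] Ff[OF subspace_scale[OF sub that(1), of c]] that(2)
    by (simp add: F_def)
  have conv: "convex_on ?S f"
  proof (rule convex_onI)
    show "convex ?S" by (rule subspace_imp_convex[OF sub])
    fix t :: real and x y assume "0 < t" "t < 1" and xy: "x \<in> ?S" "y \<in> ?S"
    then show "f ((1 - t) *\<^sub>R x + t *\<^sub>R y) \<le> (1 - t) * f x + t * f y"
      using f_add[OF subspace_scale[OF sub xy(1)] subspace_scale[OF sub xy(2)], of "1 - t" t]
        f_scale[OF xy(1), of "1 - t"] f_scale[OF xy(2), of t] by simp
  qed
  have lip: "f x - f y \<le> norm_dist ?S ?N x y" if "x \<in> ?S" "y \<in> ?S" for x y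
    using f_add[OF that(2) subspace_diff[OF sub that]] f_le[OF subspace_diff[OF sub that]] that
    by (simp add: norm_dist_def)
  have cont: "continuous_map (subtopology ?T ?S) euclideanreal f"
  proof -
    have "continuous_map MS.mtopology Met_TC.mtopology f"
      unfolding MS.metric_continuous_map[OF Met_TC.Metric_space_axioms]
    proof (intro conjI ballI allI impI)
      fix a and e :: real assume a: "a \<in> ?S" and e: "0 < e"
      show "\<exists>d>0. \<forall>x. x \<in> ?S \<and> norm_dist ?S ?N a x < d \<longrightarrow> dist (f a) (f x) < e"
      proof (intro exI[of _ e] conjI allI impI)
        fix x assume x: "x \<in> ?S \<and> norm_dist ?S ?N a x < e"
        then show "dist (f a) (f x) < e"
          using lip[of a x] lip[of x a] a MS.commute[of a x] by (simp add: dist_real_def abs_less_iff)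
      qed (use e in simp)
    qed simp
    then show ?thesis
      by (simp add: T)
  qed
  have "openin ?T ?S" "?S \<noteq> {}"
    using subspace_0[OF sub] by (auto simp: T)
  then obtain G where G: "?S \<subseteq> ?T closure_of G" "\<forall>x\<in>G. \<exists>D. frechet_deriv_on ?S ?N f D x"
      "gdelta_in (subtopology ?T ?S) G"
    using asp conv cont unfolding asplund_on_def by blast
  have "G \<noteq> {}"
    using G(1) \<open>?S \<noteq> {}\<close> by auto
  moreover have "G \<subseteq> ?S"
    using gdelta_in_subset[OF G(3)] by (simp add: T)
  ultimately obtain x D where x: "x \<in> ?S" and D: "frechet_deriv_on ?S ?N f D x"
    using G(2) by blast

  obtain r where r: "strict_mono r" "(\<lambda>k. ereal (x (s (r k)))) \<longlonglongrightarrow> ereal (f x)"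
    using limsup_subseq_lim[of "\<lambda>k. ereal (x (s k))"] Ff[OF x] by (auto simp: F_def o_def)
  then have r': "(\<lambda>k. x (s (r k))) \<longlonglongrightarrow> f x" by simp
  define h where "h = indicat_real (s ` range (\<lambda>k. r (2 * k)))"
  have h: "h \<in> ?S" "?N h \<le> 2"
    using ind unfolding h_def by blast+
  have inj: "inj s" "inj r"
    using s(2) r(1) strict_mono_imp_inj_on by blast+
  have h1: "h (s (r (2 * k))) = 1" for k
    by (auto simp: h_def indicator_def)
  have h0: "h (s (r (2 * k + 1))) = 0" for k
  proof -
    have "s (r (2 * k + 1)) \<notin> s ` range (\<lambda>k. r (2 * k))"
    proof
      assume "s (r (2 * k + 1)) \<in> s ` range (\<lambda>k. r (2 * k))"
      then obtain j where "s (r (2 * k + 1)) = s (r (2 * j))" by auto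
      then have "2 * k + 1 = 2 * j" using inj by (meson injD)
      then show False by presburger
    qed
    then show ?thesis by (simp add: h_def)
  qed
  have key: "f (x + t *\<^sub>R h) \<ge> v"
    if v: "(\<lambda>k. x (s (u k)) + t * h (s (u k))) \<longlonglongrightarrow> v" and u: "strict_mono u" for t v u
  proof -
    let ?X = "\<lambda>k. ereal ((x + t *\<^sub>R h) (s k))"
    have "(?X \<circ> u) \<longlonglongrightarrow> ereal v" using v by (simp add: o_def)
    then have "limsup (?X \<circ> u) = ereal v" by (rule lim_imp_Limsup[rotated]) simp
    then have "ereal v \<le> F (x + t *\<^sub>R h)"
      using limsup_subseq_mono[OF u, of ?X] by (simp add: F_def)
    then show ?thesis
      using Ff[of "x + t *\<^sub>R h"] x h(1) sub by (simp add: subspace_add subspace_scale)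
  qed
  have even: "strict_mono (\<lambda>k. r (2 * k))" and odd: "strict_mono (\<lambda>k. r (2 * k + 1))"
    using r(1) by (auto simp: strict_mono_def)
  have lo1: "f (x + t *\<^sub>R h) \<ge> f x + t" for t
  proof (rule key[OF _ even])
    have "(\<lambda>k. x (s (r (2 * k)))) \<longlonglongrightarrow> f x"
      using LIMSEQ_subseq_LIMSEQ[OF r', of "\<lambda>k. 2 * k"] by (simp add: o_def strict_mono_def)
    then show "(\<lambda>k. x (s (r (2 * k))) + t * h (s (r (2 * k)))) \<longlonglongrightarrow> f x + t"
      unfolding h1 by (intro tendsto_intros) simp_all
  qed
  have lo0: "f (x + t *\<^sub>R h) \<ge> f x" for t
  proof (rule key[OF _ odd])
    have "(\<lambda>k. x (s (r (2 * k + 1)))) \<longlonglongrightarrow> f x"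
      using LIMSEQ_subseq_LIMSEQ[OF r', of "\<lambda>k. 2 * k + 1"] by (simp add: o_def strict_mono_def)
    then show "(\<lambda>k. x (s (r (2 * k + 1))) + t * h (s (r (2 * k + 1)))) \<longlonglongrightarrow> f x"
      unfolding h0 by simp
  qed
  have Dlin: "D (t *\<^sub>R h) = t * D h" for t
    using D h(1) by (auto simp: frechet_deriv_on_def bounded_functional_on_def)
  obtain d where d: "d > 0"
    "\<And>g. g \<in> ?S \<Longrightarrow> ?N g < d \<Longrightarrow> \<bar>f (x + g) - f x - D g\<bar> \<le> (1/8) * ?N g"
    using D unfolding frechet_deriv_on_def by (metis zero_less_divide_1_iff zero_less_numeral)
  define t where "t = d / 4"
  have t: "t > 0" "2 * t < d" using d(1) by (auto simp: t_def)
  have est: "\<bar>f (x + c *\<^sub>R h) - f x - c * D h\<bar> \<le> t / 4" if "\<bar>c\<bar> = t" for c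
  proof -
    have "?N (c *\<^sub>R h) \<le> 2 * t"
      using hom[OF h(1), of c] that h(2) t by simp
    then show ?thesis
      using d(2)[of "c *\<^sub>R h"] t subspace_scale[OF sub h(1), of c] Dlin[of c] by simp
  qed
  have "t * D h \<ge> 3 / 4 * t" "t * D h \<le> t / 4"
    using est[of t] est[of "-t"] lo1[of t] lo0[of "-t"] t unfolding abs_le_iff by linarith+
  then show False using t by simp
qed

end

theory Submission
  imports Defs
begin

text \<open>
  Raising the finitely many small exponents to some \<open>s\<close> with \<open>1 < s < p\<close> gives an equivalent Luxemburg norm
  whose modular is Frechet differentiable on the heart, also when the exponents are unbounded.
  As the gauge of the unit ball of the modular, the norm is differentiable as well.
  That a Frechet norm makes the space Asplund follows from Ekeland's principle, applied to a multiple
  of its square minus a convex function, together with Baire's theorem.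

  For a bump \<open>b\<close>, Ekeland's principle is applied to \<open>1 / b\<close> minus a multiple of the modular. Its
  error term would be of order 1 for the norm metric, which is too coarse. Instead it is taken with respect to a
  metric whose cost for a step in an almost vanishing coordinate is half of what the modular gains.
\<close>

section \<open>Ekeland's variational principle\<close>

text \<open>Derivatives cancel in symmetric second differences. So in direction \<open>h\<close> of
  size \<open>t\<close> the second difference of \<open>1 / b\<close> is \<open>O(t powr s)\<close>,
  while that of the modular is at least of order \<open>t powr r\<close> along a coordinate
  \<open>m\<close> with \<open>q m < r < s\<close> and \<open>x m\<close> negligible. Such
  \<open>m\<close> exist for every \<open>t\<close>, because the lower limit of the exponents lies
  below \<open>r\<close> and \<open>x m\<close> tends to 0. Minimality is needed up to an error
  below \<open>t powr q m\<close>; an error linear in \<open>t\<close> would drown the gain, since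
  \<open>q m > 1\<close> for large \<open>m\<close>. This dictates the distance: a step must cost
  about as much as the modular sees of it, and the distance must still be complete, which bounded
  exponents yield by comparison with the norm. For differentiability with unbounded exponents, no
  second-order Taylor bound is uniform over the coordinates. What is used instead holds for all
  exponents alike: the remainder of a convex function at a tangent is nonnegative and convex in the
  increment. Convexity along rays also drives the Asplund part: an upper estimate on one sphere
  passes to the ball inside.\<close>

text \<open>Successive points realise at least half of the decrease that is still possible within
  \<open>S x\<close>, the points whose gain pays for their distance from \<open>x\<close>; their
  limit cannot be improved. The distance is an arbitrary function on \<open>C\<close>, so that both
  the norm distance and \<open>detour_dist\<close> fit, and completeness is stated jointly with
  convergence of the values of \<open>g\<close>, so that no topology on \<open>C\<close>
  enters.\<close>

lemma ekeland_variational_principle: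
  fixes C :: "'a set" and d :: "'a \<Rightarrow> 'a \<Rightarrow> real" and g :: "'a \<Rightarrow> real"
  assumes nonneg: "\<And>x y. x \<in> C \<Longrightarrow> y \<in> C \<Longrightarrow> 0 \<le> d x y"
    and refl: "\<And>x. x \<in> C \<Longrightarrow> d x x = 0"
    and tri: "\<And>x y z. x \<in> C \<Longrightarrow> y \<in> C \<Longrightarrow> z \<in> C \<Longrightarrow> d x z \<le> d x y + d y z"
    and sym: "\<And>x y. x \<in> C \<Longrightarrow> y \<in> C \<Longrightarrow> d x y = d y x"
    and complete: "\<And>\<sigma>. (\<And>k::nat. \<sigma> k \<in> C) \<Longrightarrow>
        (\<And>e. e > 0 \<Longrightarrow> \<exists>k0. \<forall>j\<ge>k0. \<forall>k\<ge>k0. d (\<sigma> j) (\<sigma> k) < e) \<Longrightarrow>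
        \<exists>l\<in>C. (\<lambda>k. d (\<sigma> k) l) \<longlonglongrightarrow> 0 \<and> (\<lambda>k. g (\<sigma> k)) \<longlonglongrightarrow> g l"
    and below: "\<And>x. x \<in> C \<Longrightarrow> B \<le> g x"
    and x0: "x0 \<in> C" and \<epsilon>: "\<epsilon> > 0"
  shows "\<exists>x\<in>C. g x \<le> g x0 \<and> (\<forall>y\<in>C. g x - \<epsilon> * d x y \<le> g y)"
proof -
  define S where "S x = {y \<in> C. g y + \<epsilon> * d x y \<le> g x}" for x
  have S_refl: "x \<in> S x" if "x \<in> C" for x
    using that refl by (simp add: S_def)
  have S_trans: "z \<in> S x" if "y \<in> S x" "z \<in> S y" "x \<in> C" for x y z
  proof -
    have "\<epsilon> * d x z \<le> \<epsilon> * d x y + \<epsilon> * d y z"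
      using tri[of x y z] that \<epsilon> by (simp add: S_def flip: distrib_left)
    then show ?thesis using that by (auto simp: S_def)
  qed
  have bdd: "bdd_below (g ` S x)" for x
    by (rule bdd_belowI[of _ B]) (auto simp: S_def below)
  \<comment> \<open>A point strictly below the midpoint exists unless \<open>g x\<close> already is
    the infimum over \<open>S x\<close>; in that case \<open>x\<close> itself serves.\<close>
  have step: "\<exists>y. y \<in> S x \<and> g y \<le> (g x + Inf (g ` S x)) / 2" if "x \<in> C" for x
  proof (cases "Inf (g ` S x) < g x")
    case True
    then have "Inf (g ` S x) < (g x + Inf (g ` S x)) / 2" by simp
    moreover have "g ` S x \<noteq> {}"
      using S_refl[OF that] by blast
    ultimately show ?thesis
      using cInf_lessD[of "g ` S x"] less_imp_le by blast
  next
    case False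
    then show ?thesis
      using S_refl[OF that] by (intro exI[of _ x]) auto
  qed
  define nxt where "nxt x = (SOME y. y \<in> S x \<and> g y \<le> (g x + Inf (g ` S x)) / 2)" for x
  have nxt: "nxt x \<in> S x" "g (nxt x) \<le> (g x + Inf (g ` S x)) / 2" if "x \<in> C" for x
    using someI_ex[OF step[OF that]] by (auto simp: nxt_def)
  define \<sigma> where "\<sigma> k = (nxt ^^ k) x0" for k
  have \<sigma>C: "\<sigma> k \<in> C" for k
    by (induction k) (use x0 nxt(1) in \<open>auto simp: \<sigma>_def S_def\<close>)
  have \<sigma>_Suc: "\<sigma> (Suc k) = nxt (\<sigma> k)" for k
    by (simp add: \<sigma>_def)
  have \<sigma>S: "\<sigma> k \<in> S (\<sigma> j)" if "j \<le> k" for j k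
    using that
  proof (induction k rule: dec_induct)
    case base then show ?case using S_refl[OF \<sigma>C] .
  next
    case (step k) then show ?case
      using S_trans[OF step.IH _ \<sigma>C] nxt(1)[OF \<sigma>C, of k] \<sigma>_Suc[of k] by simp
  qed
  have dec: "g (\<sigma> k) \<le> g (\<sigma> j)" and dist: "\<epsilon> * d (\<sigma> j) (\<sigma> k) \<le> g (\<sigma> j) - g (\<sigma> k)" if "j \<le> k" for j k
  proof -
    have "g (\<sigma> k) + \<epsilon> * d (\<sigma> j) (\<sigma> k) \<le> g (\<sigma> j)"
      using \<sigma>S[OF that] by (simp add: S_def)
    moreover have "0 \<le> \<epsilon> * d (\<sigma> j) (\<sigma> k)"
      using nonneg[OF \<sigma>C \<sigma>C] \<epsilon> by simp
    ultimately show "g (\<sigma> k) \<le> g (\<sigma> j)" "\<epsilon> * d (\<sigma> j) (\<sigma> k) \<le> g (\<sigma> j) - g (\<sigma> k)"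
      by linarith+
  qed
  obtain \<gamma> where \<gamma>: "(\<lambda>k. g (\<sigma> k)) \<longlonglongrightarrow> \<gamma>" and \<gamma>_le: "\<And>k. \<gamma> \<le> g (\<sigma> k)"
    using decseq_convergent[of "\<lambda>k. g (\<sigma> k)" B] dec below[OF \<sigma>C] by (metis decseq_def)
  have cauchy: "\<exists>k0. \<forall>j\<ge>k0. \<forall>k\<ge>k0. d (\<sigma> j) (\<sigma> k) < e" if "e > 0" for e
  proof -
    have "\<forall>\<^sub>F k in sequentially. g (\<sigma> k) < \<gamma> + \<epsilon> * e"
      using order_tendstoD(2)[OF \<gamma>, of "\<gamma> + \<epsilon> * e"] that \<epsilon> by simp
    then obtain k0 where k0: "\<And>k. k \<ge> k0 \<Longrightarrow> g (\<sigma> k) < \<gamma> + \<epsilon> * e"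
      by (auto simp: eventually_sequentially)
    have "d (\<sigma> j) (\<sigma> k) < e" if "k0 \<le> j" "j \<le> k" for j k
    proof -
      have "\<epsilon> * d (\<sigma> j) (\<sigma> k) < \<epsilon> * e"
        using dist[OF that(2)] k0[OF that(1)] \<gamma>_le[of k] by linarith
      then show ?thesis using \<epsilon> by simp
    qed
    then show ?thesis
      using sym[OF \<sigma>C \<sigma>C] by (metis linorder_le_cases)
  qed
  obtain l where l: "l \<in> C" "(\<lambda>k. d (\<sigma> k) l) \<longlonglongrightarrow> 0" "(\<lambda>k. g (\<sigma> k)) \<longlonglongrightarrow> g l"
    using complete[of \<sigma>, OF \<sigma>C cauchy] by blast
  have gl: "g l = \<gamma>"
    using LIMSEQ_unique[OF l(3) \<gamma>] .
  have lS: "l \<in> S (\<sigma> k)" for k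
  proof -
    have "(\<lambda>m. (g (\<sigma> k) - g (\<sigma> m)) + \<epsilon> * d (\<sigma> m) l) \<longlonglongrightarrow> (g (\<sigma> k) - g l) + \<epsilon> * 0"
      by (intro tendsto_intros l)
    moreover have "\<epsilon> * d (\<sigma> k) l \<le> (g (\<sigma> k) - g (\<sigma> m)) + \<epsilon> * d (\<sigma> m) l" if "m \<ge> k" for m
    proof -
      have "\<epsilon> * d (\<sigma> k) l \<le> \<epsilon> * d (\<sigma> k) (\<sigma> m) + \<epsilon> * d (\<sigma> m) l"
        using tri[OF \<sigma>C \<sigma>C l(1)] \<epsilon> by (simp flip: distrib_left)
      then show ?thesis using dist[OF that] by simp
    qed
    ultimately have "\<epsilon> * d (\<sigma> k) l \<le> g (\<sigma> k) - g l"
      using LIMSEQ_le_const[of _ "g (\<sigma> k) - g l" "\<epsilon> * d (\<sigma> k) l"] by auto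
    then show ?thesis using l(1) by (simp add: S_def)
  qed
  have "g l - \<epsilon> * d l y \<le> g y" if y: "y \<in> C" for y
  proof (rule ccontr)
    assume "\<not> ?thesis"
    then have less: "g y < g l - \<epsilon> * d l y" by simp
    \<comment> \<open>A better \<open>y\<close> would lie in every \<open>S (\<sigma> k)\<close>, so
      each step would cover at least half of the way down to \<open>g y\<close>. In the limit
      \<open>g l\<close> would be at most \<open>g y\<close>.\<close>
    have half: "g (\<sigma> (Suc k)) \<le> (g (\<sigma> k) + g y) / 2" for k
    proof -
      have "y \<in> S (\<sigma> k)"
        using S_trans[OF lS _ \<sigma>C] less y by (simp add: S_def)
      then have "Inf (g ` S (\<sigma> k)) \<le> g y"
        using bdd by (intro cInf_lower) auto
      then show ?thesis using nxt(2)[OF \<sigma>C, of k] by (simp add: \<sigma>_Suc)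
    qed
    have "(\<lambda>k. g (\<sigma> (Suc k))) \<longlonglongrightarrow> g l" "(\<lambda>k. (g (\<sigma> k) + g y) / 2) \<longlonglongrightarrow> (g l + g y) / 2"
      using l(3) by (auto intro!: tendsto_intros LIMSEQ_Suc)
    then have "g l \<le> (g l + g y) / 2"
      using half by (intro LIMSEQ_le) auto
    then have "g l \<le> g y" by (simp add: field_simps)
    then show False
      using less mult_nonneg_nonneg[OF less_imp_le[OF \<epsilon>] nonneg[OF l(1) y]] by linarith
  qed
  moreover have "g l \<le> g x0"
    using \<gamma>_le[of 0] gl by (simp add: \<sigma>_def)
  ultimately show ?thesis using l(1) by blast
qed

section \<open>Spaces with an equivalent Frechet norm\<close>

locale normed_subspace =
  fixes S :: "'v::real_vector set" and N :: "'v \<Rightarrow> real"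
  assumes normed: "normed_on S N"
begin

lemma subspace: "subspace S"
  using normed by (simp add: normed_on_def)

lemmas zero_mem [simp] = subspace_0[OF subspace]
  and add_mem [simp] = subspace_add[OF subspace]
  and diff_mem [simp] = subspace_diff[OF subspace]
  and scale_mem [simp] = subspace_scale[OF subspace]
  and minus_mem [simp] = subspace_neg[OF subspace]

lemma norm_nonneg [simp]: "x \<in> S \<Longrightarrow> 0 \<le> N x"
  and norm_eq_0: "x \<in> S \<Longrightarrow> N x = 0 \<longleftrightarrow> x = 0"
  and norm_scale: "x \<in> S \<Longrightarrow> N (c *\<^sub>R x) = \<bar>c\<bar> * N x"
  and norm_triangle: "x \<in> S \<Longrightarrow> y \<in> S \<Longrightarrow> N (x + y) \<le> N x + N y"
  using normed by (auto simp: normed_on_def)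

lemma norm_0 [simp]: "N 0 = 0"
  using norm_eq_0[of 0] by simp

lemma norm_minus [simp]: "x \<in> S \<Longrightarrow> N (- x) = N x"
  using norm_scale[of x "-1"] by simp

lemma norm_minus_commute: "x \<in> S \<Longrightarrow> y \<in> S \<Longrightarrow> N (x - y) = N (y - x)"
  using norm_minus[of "x - y"] by simp

lemma norm_triangle_diff: "x \<in> S \<Longrightarrow> y \<in> S \<Longrightarrow> z \<in> S \<Longrightarrow> N (x - z) \<le> N (x - y) + N (y - z)"
  using norm_triangle[of "x - y" "y - z"] by simp

lemma norm_diff_le: "x \<in> S \<Longrightarrow> y \<in> S \<Longrightarrow> N (x - y) \<le> N x + N y"
  using norm_triangle[of x "- y"] by simp

lemma norm_diff_ge: "x \<in> S \<Longrightarrow> y \<in> S \<Longrightarrow> N x - N y \<le> N (x - y)"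
  using norm_triangle[of "x - y" y] by simp

sublocale MS: Metric_space S "norm_dist S N"
  by (rule Metric_space_norm_dist[OF normed])

lemma mtopology: "MS.mtopology = norm_topology S N"
  by (simp add: norm_topology_def)

lemma topspace [simp]: "topspace (norm_topology S N) = S"
  by (simp flip: mtopology)

lemma norm_dist: "x \<in> S \<Longrightarrow> y \<in> S \<Longrightarrow> norm_dist S N x y = N (x - y)"
  by (simp add: norm_dist_def)

lemma openin_iff:
  "openin (norm_topology S N) U \<longleftrightarrow>
     U \<subseteq> S \<and> (\<forall>x\<in>U. \<exists>r>0. \<forall>y\<in>S. N (y - x) < r \<longrightarrow> y \<in> U)" (is "_ \<longleftrightarrow> ?r")
proof -
  have "MS.mball x r \<subseteq> U \<longleftrightarrow> (\<forall>y\<in>S. N (y - x) < r \<longrightarrow> y \<in> U)" if "x \<in> S" for x r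
    using that norm_minus_commute[of x] by (auto simp: MS.in_mball norm_dist subset_iff)
  then show ?thesis
    unfolding mtopology[symmetric] MS.openin_mtopology by (meson subsetD)
qed

lemma in_closure_of_iff:
  assumes "G \<subseteq> S"
  shows "x \<in> norm_topology S N closure_of G \<longleftrightarrow> x \<in> S \<and> (\<forall>r>0. \<exists>y\<in>G. N (y - x) < r)"
proof (cases "x \<in> S")
  case True
  then have "(\<exists>y\<in>G. y \<in> MS.mball x r) \<longleftrightarrow> (\<exists>y\<in>G. N (y - x) < r)" for r
    using assms norm_minus_commute[of x] by (fastforce simp: MS.in_mball norm_dist subset_iff)
  then show ?thesis
    using True by (simp add: MS.metric_closure_of flip: mtopology)
qed (use closure_of_subset_topspace[of "norm_topology S N" G] in auto)

lemma continuous_at_point: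
  assumes "continuous_map (subtopology (norm_topology S N) U) euclideanreal f"
    and U: "openin (norm_topology S N) U" and x: "x \<in> U" and e: "e > 0"
  shows "\<exists>r>0. \<forall>y\<in>S. N (y - x) < r \<longrightarrow> y \<in> U \<and> \<bar>f y - f x\<bar> < e"
proof -
  have "openin (subtopology (norm_topology S N) U)
      {y \<in> topspace (subtopology (norm_topology S N) U). f y \<in> {f x - e<..<f x + e}}"
    using assms(1) by (rule openin_continuous_map_preimage) simp
  then have "openin (norm_topology S N) {y \<in> U. \<bar>f y - f x\<bar> < e}"
    using U openin_subset[OF U]
    by (elim openin_trans_full[THEN back_subst[of "openin _"]]) (auto simp: abs_less_iff)
  then show ?thesis
    unfolding openin_iff using x e by fastforce
qed

end

lemma (in normed_subspace) complete_sequence: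
  assumes "MS.mcomplete" and "\<And>k::nat. \<sigma> k \<in> S"
    and "\<And>e. e > 0 \<Longrightarrow> \<exists>k0. \<forall>j\<ge>k0. \<forall>k\<ge>k0. N (\<sigma> j - \<sigma> k) < e"
  shows "\<exists>l\<in>S. (\<lambda>k. N (\<sigma> k - l)) \<longlonglongrightarrow> 0"
proof -
  have "MS.MCauchy \<sigma>"
    using assms(2,3) unfolding MS.MCauchy_def by (fastforce simp: norm_dist)
  then obtain l where "limitin MS.mtopology \<sigma> l sequentially"
    using assms(1) by (auto simp: MS.mcomplete_def)
  then have "l \<in> S" "((\<lambda>k. norm_dist S N (\<sigma> k) l) \<longlongrightarrow> 0) sequentially"
    by (auto simp: MS.limitin_metric_dist_null)
  then show ?thesis
    using assms(2) by (auto simp: norm_dist)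
qed

lemma (in normed_subspace) bounded_functional_cmult:
  "bounded_functional_on S N D \<Longrightarrow> bounded_functional_on S N (\<lambda>h. c * D h)"
  unfolding bounded_functional_on_def
proof safe
  fix K assume "\<forall>x\<in>S. \<bar>D x\<bar> \<le> K * N x"
  then have "\<forall>x\<in>S. \<bar>c * D x\<bar> \<le> (\<bar>c\<bar> * K) * N x"
    by (auto simp: abs_mult mult.assoc intro!: mult_left_mono)
  then show "\<exists>K. \<forall>x\<in>S. \<bar>c * D x\<bar> \<le> K * N x" by blast
qed (auto simp: algebra_simps)

text \<open>Both sides are homogeneous, so \<open>h\<close> can be shrunk into the ball. It serves
  to compare two approximate derivatives, whose difference is controlled only near 0.\<close>

lemma (in normed_subspace) abs_functional_le_if_near_0:
  assumes D: "\<And>c x. x \<in> S \<Longrightarrow> D (c *\<^sub>R x) = c * D x"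
    and d: "d > 0" "\<And>h. h \<in> S \<Longrightarrow> N h < d \<Longrightarrow> \<bar>D h\<bar> \<le> K * N h" and h: "h \<in> S"
  shows "\<bar>D h\<bar> \<le> K * N h"
proof (cases "N h = 0")
  case True
  then show ?thesis using d(2)[OF h] d(1) by simp
next
  case False
  then have pos: "N h > 0" using norm_nonneg[OF h] by linarith
  define t where "t = d / (2 * N h)"
  have t: "t > 0" "t * N h < d" using pos d(1) by (auto simp: t_def)
  have "\<bar>D (t *\<^sub>R h)\<bar> \<le> K * N (t *\<^sub>R h)"
    using t h by (intro d(2)) (auto simp: norm_scale)
  then have "t * \<bar>D h\<bar> \<le> t * (K * N h)"
    using t h by (simp add: norm_scale D abs_mult algebra_simps)
  then show ?thesis using t by simp
qed

text \<open>
  A convex function is automatically close to \<open>f x + D h\<close> from below once it is so from above,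
  so only the upper estimate is recorded.
\<close>

definition (in normed_subspace) almost_frechet_points ::
    "'v set \<Rightarrow> ('v \<Rightarrow> real) \<Rightarrow> real \<Rightarrow> 'v set" where
  "almost_frechet_points U f e = {x \<in> U. \<exists>D. bounded_functional_on S N D
     \<and> (\<exists>d>0. \<forall>h\<in>S. N h < d \<longrightarrow> f (x + h) \<le> f x + D h + e * N h)}"

section \<open>Continuous convex functions on open sets\<close>

lemma convex_on_midpoint:
  assumes "convex_on U f" "x + h \<in> U" "x - h \<in> U"
  shows "2 * f x \<le> f (x + h) + f (x - h)"
proof -
  have "(1/2) *\<^sub>R (x + h) + (1/2) *\<^sub>R (x - h) = x"
    by (simp add: scaleR_add_right scaleR_diff_right flip: scaleR_add_left)
  then show ?thesis
    using convex_onD[OF assms(1), of "1/2" "x + h" "x - h"] assms(2,3) by simp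
qed

text \<open>The means of carrying an estimate at one fixed distance inwards to all shorter
  steps.\<close>

lemma convex_on_ray:
  assumes "convex_on U f" "x \<in> U" "x + h \<in> U" "0 \<le> t" "t \<le> 1"
  shows "f (x + t *\<^sub>R h) - f x \<le> t * (f (x + h) - f x)"
proof -
  have "(1 - t) *\<^sub>R x + t *\<^sub>R (x + h) = x + t *\<^sub>R h"
    by (simp add: algebra_simps)
  then show ?thesis
    using convex_onD[OF assms(1) assms(4,5,2,3)] by (simp add: algebra_simps)
qed

locale convex_on_open = normed_subspace +
  fixes U :: "'a set" and f :: "'a \<Rightarrow> real"
  assumes openU: "openin (norm_topology S N) U"
    and convex: "convex_on U f"
    and cont: "continuous_map (subtopology (norm_topology S N) U) euclideanreal f"
begin

lemma U_subset: "U \<subseteq> S"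
  using openin_subset[OF openU] by simp

text \<open>The segment from \<open>z\<close> through \<open>y\<close> is prolonged beyond
  \<open>y\<close> by the length \<open>r\<close> to a point \<open>w\<close>. It stays in the ball
  of radius \<open>R = 2 * r\<close>, where \<open>f\<close> varies by less than 2, so convexity
  bounds the slope from \<open>z\<close> to \<open>y\<close> by \<open>2 / r\<close>.\<close>

lemma locally_lipschitz:
  assumes x: "x \<in> U"
  obtains r L where "r > 0" "L \<ge> 0" "\<And>y. y \<in> S \<Longrightarrow> N (y - x) < r \<Longrightarrow> y \<in> U"
    "\<And>y z. y \<in> S \<Longrightarrow> z \<in> S \<Longrightarrow> N (y - x) < r \<Longrightarrow> N (z - x) < r \<Longrightarrow> \<bar>f y - f z\<bar> \<le> L * N (y - z)"
proof -
  obtain R where R: "R > 0" "\<And>y. y \<in> S \<Longrightarrow> N (y - x) < R \<Longrightarrow> y \<in> U \<and> \<bar>f y - f x\<bar> < 1"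
    using continuous_at_point[OF cont openU x, of 1] by auto
  define r where "r = R / 2"
  have r: "r > 0" "r < R" using R by (auto simp: r_def)
  have xS: "x \<in> S" using x U_subset by blast
  have one: "f y - f z \<le> (2 / r) * N (y - z)"
    if yz: "y \<in> S" "z \<in> S" "N (y - x) < r" "N (z - x) < r" for y z
  proof (cases "N (y - z) = 0")
    case True
    then show ?thesis using norm_eq_0[of "y - z"] yz by simp
  next
    case False
    define t where "t = N (y - z)"
    have t: "t > 0" using False norm_nonneg[of "y - z"] yz unfolding t_def by (simp add: less_le)
    define w where "w = y + (r / t) *\<^sub>R (y - z)"
    have wS: "w \<in> S" using yz by (simp add: w_def)
    have "N (w - x) \<le> N (y - x) + N ((r / t) *\<^sub>R (y - z))"
      using norm_triangle[of "y - x" "(r / t) *\<^sub>R (y - z)"] yz xS by (simp add: w_def algebra_simps)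
    also have "N ((r / t) *\<^sub>R (y - z)) = r"
      using t r yz by (simp add: norm_scale flip: t_def)
    finally have "N (w - x) < R" using yz(3) by (simp add: r_def)
    then have w: "w \<in> U" "\<bar>f w - f x\<bar> < 1" using R(2)[OF wS] by auto
    have z: "z \<in> U" "\<bar>f z - f x\<bar> < 1" using R(2)[of z] yz r by auto
    define l where "l = t / (t + r)"
    have l: "0 \<le> l" "l \<le> 1" "l \<le> t / r" using t r by (auto simp: l_def field_simps)
    have "1 + r / t = (t + r) / t" using t by (simp add: field_simps)
    then have lr: "l * (1 + r / t) = 1" using t r by (simp add: l_def)
    have "z + l *\<^sub>R (w - z) = z + (l * (1 + r / t)) *\<^sub>R (y - z)"
      by (simp add: w_def algebra_simps)
    then have "z + l *\<^sub>R (w - z) = y" by (simp add: lr)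
    then have "f y - f z \<le> l * (f w - f z)"
      using convex_on_ray[OF convex z(1), of "w - z" l] w l by simp
    also have "\<dots> \<le> l * 2" using w z l by (intro mult_left_mono) auto
    also have "\<dots> \<le> (2 / r) * t" using l by simp
    finally show ?thesis by (simp add: t_def)
  qed
  have lip: "\<bar>f y - f z\<bar> \<le> (2 / r) * N (y - z)"
    if "y \<in> S" "z \<in> S" "N (y - x) < r" "N (z - x) < r" for y z
    using one[OF that] one[OF that(2,1,4,3)] norm_minus_commute[OF that(1,2)] by simp
  have mem: "y \<in> U" if "y \<in> S" "N (y - x) < r" for y
    using R(2)[of y] that r by auto
  show thesis
    by (rule that[of r "2 / r", OF r(1) _ mem lip]) (use r in auto)
qed

text \<open>The functional \<open>D\<close> found at \<open>x\<close> serves for all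
  \<open>y\<close> close to \<open>x\<close>. On the sphere of radius \<open>s\<close>, replacing
  \<open>x\<close> by \<open>y\<close> changes the estimate by at most
  \<open>2 * L * \<rho>\<close>, hence by at most \<open>2 * e * s\<close>, and convexity carries
  the result inwards. This is what gives the approximate points an open neighbourhood of points of
  the same kind.\<close>

lemma almost_frechet_neighbourhood:
  assumes x: "x \<in> almost_frechet_points U f e" and e: "e > 0"
  shows "\<exists>r>0. \<forall>y\<in>S. N (y - x) < r \<longrightarrow> y \<in> almost_frechet_points U f (3 * e)"
proof -
  obtain D d where D: "bounded_functional_on S N D" "d > 0"
    "\<And>h. h \<in> S \<Longrightarrow> N h < d \<Longrightarrow> f (x + h) \<le> f x + D h + e * N h" and xU: "x \<in> U"
    using x unfolding almost_frechet_points_def by blast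
  have xS: "x \<in> S" using xU U_subset by blast
  obtain r L where r: "r > 0" "L \<ge> 0" "\<And>y. y \<in> S \<Longrightarrow> N (y - x) < r \<Longrightarrow> y \<in> U"
    "\<And>y z. y \<in> S \<Longrightarrow> z \<in> S \<Longrightarrow> N (y - x) < r \<Longrightarrow> N (z - x) < r \<Longrightarrow> \<bar>f y - f z\<bar> \<le> L * N (y - z)"
    using locally_lipschitz[OF xU] by blast
  define s where "s = min d r / 3"
  define \<rho> where "\<rho> = min s (e * s / (L + 1))"
  have s: "s > 0" "s < d" "2 * s < r" using D(2) r(1) by (auto simp: s_def)
  have \<rho>: "\<rho> > 0" "\<rho> \<le> s" "L * \<rho> \<le> e * s"
  proof -
    show "\<rho> > 0" "\<rho> \<le> s" using s e r by (auto simp: \<rho>_def)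
    have "L * \<rho> \<le> L * (e * s / (L + 1))" using r by (intro mult_left_mono) (auto simp: \<rho>_def)
    also have "\<dots> = (L / (L + 1)) * (e * s)" by simp
    also have "\<dots> \<le> 1 * (e * s)" using r e s by (intro mult_right_mono) auto
    finally show "L * \<rho> \<le> e * s" by simp
  qed
  have "y \<in> almost_frechet_points U f (3 * e)" if y: "y \<in> S" "N (y - x) < \<rho>" for y
  proof -
    have yU: "y \<in> U" using r(3)[of y] y \<rho> s by auto
    have "f (y + k) \<le> f y + D k + (3 * e) * N k" if k: "k \<in> S" "N k < s" for k
    proof (cases "N k = 0")
      case True
      then have "k = 0" using norm_eq_0 k by simp
      moreover have "D (0 *\<^sub>R 0) = 0 * D 0"
        using D(1) zero_mem unfolding bounded_functional_on_def by blast
      ultimately show ?thesis by simp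
    next
      case False
      define t where "t = N k / s"
      define h where "h = (1 / t) *\<^sub>R k"
      have t: "0 < t" "t \<le> 1" using False norm_nonneg[OF k(1)] k s by (auto simp: t_def less_le)
      have hS: "h \<in> S" using k by (simp add: h_def)
      have Nh: "N h = s" using k t s False by (simp add: h_def norm_scale) (simp add: t_def)
      have kh: "k = t *\<^sub>R h" using t by (simp add: h_def)
      have "N (y + h - x) \<le> N (y - x) + N h"
        using norm_triangle[of "y - x" h] y xS hS by (simp add: algebra_simps)
      then have yh: "N (y + h - x) < r" using y \<rho> s Nh by linarith
      have xh: "N (x + h - x) < r" using Nh s by simp
      have "f (y + h) - f (x + h) \<le> L * N (y - x)"
        using r(4)[of "y + h" "x + h"] yh xh y xS hS by (simp add: abs_le_iff)
      moreover have "f x - f y \<le> L * N (y - x)"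
        using r(4)[of y x] y \<rho> s r xS by (simp add: abs_le_iff)
      moreover have "L * N (y - x) \<le> e * s"
        using mult_left_mono[of "N (y - x)" \<rho> L] y \<rho> r by linarith
      moreover have "f (x + h) \<le> f x + D h + e * s"
        using D(3)[OF hS] Nh s by simp
      ultimately have "f (y + h) - f y \<le> D h + 3 * (e * s)" by linarith
      then have "t * (f (y + h) - f y) \<le> t * (D h + 3 * (e * s))"
        using t by (intro mult_left_mono) auto
      moreover have "f (y + k) - f y \<le> t * (f (y + h) - f y)"
        using convex_on_ray[OF convex yU, of h t] r(3)[OF _ yh] y hS t kh by simp
      moreover have "t * D h = D k"
        using D(1) hS kh by (simp add: bounded_functional_on_def)
      moreover have "t * s = N k" using s by (simp add: t_def)
      then have "t * (3 * (e * s)) = 3 * e * N k" by (metis mult.assoc mult.left_commute)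
      ultimately show ?thesis by (simp add: distrib_left)
    qed
    then show ?thesis
      unfolding almost_frechet_points_def using yU D(1) s(1) by blast
  qed
  then show ?thesis using \<rho>(1) by blast
qed

text \<open>Two functionals that approximate \<open>f\<close> near \<open>x\<close> with tolerances
  \<open>e n\<close> and \<open>e m\<close> differ by at most \<open>e n + e m\<close> in norm.
  Hence the \<open>D n\<close> converge, and their limit approximates with every tolerance.\<close>

lemma frechet_if_almost_frechet:
  assumes x: "\<And>n. x \<in> almost_frechet_points U f (inverse (real (Suc n)))"
  shows "\<exists>D. frechet_deriv_on S N f D x"
proof -
  define e where "e n = inverse (real (Suc n))" for n
  have e0: "e \<longlonglongrightarrow> 0" unfolding e_def by (rule LIMSEQ_inverse_real_of_nat)
  have "\<forall>n. \<exists>D d. bounded_functional_on S N D \<and> d > 0 \<and>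
      (\<forall>h\<in>S. N h < d \<longrightarrow> f (x + h) \<le> f x + D h + e n * N h)"
    using x unfolding almost_frechet_points_def e_def by blast
  then obtain D d where D: "\<And>n. bounded_functional_on S N (D n)" and d: "\<And>n. d n > 0"
    "\<And>n h. h \<in> S \<Longrightarrow> N h < d n \<Longrightarrow> f (x + h) \<le> f x + D n h + e n * N h"
    by metis
  have add: "D n (h + k) = D n h + D n k" and scale: "D n (c *\<^sub>R h) = c * D n h"
    if "h \<in> S" "k \<in> S" for n c h k
    using D[of n] that by (auto simp: bounded_functional_on_def)
  have xU: "x \<in> U" using x by (auto simp: almost_frechet_points_def)
  then have xS: "x \<in> S" using U_subset by blast
  obtain r where r: "r > 0" "\<And>y. y \<in> S \<Longrightarrow> N (y - x) < r \<Longrightarrow> y \<in> U"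
    using openU xU unfolding openin_iff by metis
  have both: "\<bar>f (x + h) - f x - D n h\<bar> \<le> e n * N h" if h: "h \<in> S" "N h < min r (d n)" for n h
  proof -
    have "f (x - h) \<le> f x - D n h + e n * N h"
      using d(2)[of "- h" n] h scale[OF h(1) h(1), of n "-1"] by simp
    moreover have "x + h \<in> U" "x - h \<in> U" using r(2) h xS by auto
    ultimately show ?thesis
      using convex_on_midpoint[OF convex] d(2)[of h n] h by (fastforce simp: abs_le_iff)
  qed
  have close: "\<bar>D n h - D m h\<bar> \<le> (e n + e m) * N h" if "h \<in> S" for n m h
  proof (rule abs_functional_le_if_near_0[of "\<lambda>h. D n h - D m h" "Min {r, d n, d m}"])
    fix h assume "h \<in> S" "N h < Min {r, d n, d m}"
    then show "\<bar>D n h - D m h\<bar> \<le> (e n + e m) * N h"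
      using both[of h n] both[of h m] by (simp add: distrib_right)
  qed (use that r d scale in \<open>auto simp: right_diff_distrib\<close>)
  have conv: "convergent (\<lambda>n. D n h)" if h: "h \<in> S" for h
  proof -
    have lim: "(\<lambda>n. e n * N h) \<longlonglongrightarrow> 0"
      using tendsto_mult_right[OF e0] by simp
    have "Cauchy (\<lambda>n. D n h)"
    proof (rule CauchyI)
      fix \<eta> :: real assume "\<eta> > 0"
      then obtain n0 where n0: "\<And>n. n \<ge> n0 \<Longrightarrow> e n * N h < \<eta> / 2"
        using order_tendstoD(2)[OF lim, of "\<eta> / 2"] by (auto simp: eventually_sequentially)
      show "\<exists>n0. \<forall>m\<ge>n0. \<forall>n\<ge>n0. norm (D m h - D n h) < \<eta>"
      proof (intro exI allI impI)
        fix m n assume "m \<ge> n0" "n \<ge> n0"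
        then show "norm (D m h - D n h) < \<eta>"
          using close[OF h, of m n] n0[of m] n0[of n] by (simp add: distrib_right)
      qed
    qed
    then show ?thesis by (rule Cauchy_convergent)
  qed
  define E where "E h = lim (\<lambda>n. D n h)" for h
  have E: "(\<lambda>n. D n h) \<longlonglongrightarrow> E h" if "h \<in> S" for h
    using conv[OF that] by (simp add: E_def convergent_LIMSEQ_iff)
  have DE: "\<bar>D n h - E h\<bar> \<le> e n * N h" if h: "h \<in> S" for n h
  proof (rule LIMSEQ_le)
    show "(\<lambda>m. \<bar>D n h - D m h\<bar>) \<longlonglongrightarrow> \<bar>D n h - E h\<bar>"
      by (intro tendsto_intros E h)
    show "(\<lambda>m. (e n + e m) * N h) \<longlonglongrightarrow> e n * N h"
      using tendsto_mult_right[OF tendsto_add[OF tendsto_const e0]] by fastforce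
  qed (use close[OF h] in auto)
  have "bounded_functional_on S N E"
    unfolding bounded_functional_on_def
  proof (intro conjI ballI allI)
    fix h k assume h: "h \<in> S" and k: "k \<in> S"
    have "(\<lambda>n. D n (h + k)) \<longlonglongrightarrow> E h + E k"
      using tendsto_add[OF E[OF h] E[OF k]] by (simp add: add h k)
    then show "E (h + k) = E h + E k"
      using LIMSEQ_unique[OF E] h k by simp
  next
    fix c h assume h: "h \<in> S"
    have "(\<lambda>n. D n (c *\<^sub>R h)) \<longlonglongrightarrow> c * E h"
      using tendsto_mult_left[OF E[OF h], of c] by (simp add: scale[OF h h])
    then show "E (c *\<^sub>R h) = c * E h"
      using LIMSEQ_unique[OF E] h by simp
  next
    obtain K where "\<forall>h\<in>S. \<bar>D 0 h\<bar> \<le> K * N h"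
      using D[of 0] by (auto simp: bounded_functional_on_def)
    then have "\<forall>h\<in>S. \<bar>E h\<bar> \<le> (K + e 0) * N h"
      using DE[of _ 0] by (fastforce simp: distrib_right)
    then show "\<exists>K. \<forall>h\<in>S. \<bar>E h\<bar> \<le> K * N h" by blast
  qed
  moreover have "\<exists>\<delta>>0. \<forall>h\<in>S. N h < \<delta> \<longrightarrow> \<bar>f (x + h) - f x - E h\<bar> \<le> \<eta> * N h" if "\<eta> > 0" for \<eta>
  proof -
    obtain n where n: "e n < \<eta> / 2"
      using eventually_happens[OF order_tendstoD(2)[OF e0, of "\<eta> / 2"]] \<open>\<eta> > 0\<close> by auto
    have "\<bar>f (x + h) - f x - E h\<bar> \<le> \<eta> * N h" if h: "h \<in> S" "N h < min r (d n)" for h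
    proof -
      have "\<bar>f (x + h) - f x - E h\<bar> \<le> 2 * e n * N h"
        using both[OF h] DE[OF h(1), of n] by linarith
      also have "\<dots> \<le> \<eta> * N h" using n h by (intro mult_right_mono) auto
      finally show ?thesis .
    qed
    then show ?thesis using r(1) d(1) by (intro exI[of _ "min r (d n)"]) auto
  qed
  ultimately show ?thesis unfolding frechet_deriv_on_def by blast
qed

end


section \<open>From a Frechet norm to the Asplund property\<close>

text \<open>The derivative of a norm is constant along rays, so the one at the normalised point
  \<open>u\<close> serves at \<open>x\<close> as well.\<close>

lemma (in normed_subspace) frechet_norm_at_point:
  assumes M: "frechet_norm_on S M" and x: "x \<in> S" "x \<noteq> 0"
  obtains D where "frechet_deriv_on S M M D x"
proof -
  interpret M: normed_subspace S M
    using M by unfold_locales (simp add: frechet_norm_on_def)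
  define \<mu> where "\<mu> = M x"
  have \<mu>: "\<mu> > 0" using M.norm_eq_0[OF x(1)] M.norm_nonneg[OF x(1)] x(2) by (simp add: \<mu>_def less_le)
  define u where "u = (1 / \<mu>) *\<^sub>R x"
  have u: "u \<in> S" "M u = 1" "x = \<mu> *\<^sub>R u"
    using x \<mu> by (auto simp: u_def M.norm_scale \<mu>_def[symmetric])
  obtain D where D: "frechet_deriv_on S M M D u"
    using M u by (auto simp: frechet_norm_on_def)
  have scale: "D (c *\<^sub>R h) = c * D h" if "h \<in> S" for c h
    using D that by (simp add: frechet_deriv_on_def bounded_functional_on_def)
  have "frechet_deriv_on S M M D x"
    unfolding frechet_deriv_on_def
  proof (intro conjI allI impI)
    show "bounded_functional_on S M D" using D by (simp add: frechet_deriv_on_def)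
    fix e :: real assume "e > 0"
    then obtain d where d: "d > 0" "\<And>h. h \<in> S \<Longrightarrow> M h < d \<Longrightarrow> \<bar>M (u + h) - M u - D h\<bar> \<le> e * M h"
      using D unfolding frechet_deriv_on_def by metis
    have "\<bar>M (x + h) - M x - D h\<bar> \<le> e * M h" if h: "h \<in> S" "M h < \<mu> * d" for h
    proof -
      define k where "k = (1 / \<mu>) *\<^sub>R h"
      have k: "k \<in> S" "h = \<mu> *\<^sub>R k" using h \<mu> by (auto simp: k_def)
      then have Mh: "M h = \<mu> * M k" "D h = \<mu> * D k" using \<mu> by (auto simp: M.norm_scale scale)
      have "x + h = \<mu> *\<^sub>R (u + k)" by (simp add: k(2) u(3) scaleR_add_right)
      then have "M (x + h) = \<mu> * M (u + k)" using k u \<mu> M.norm_scale[of "u + k" \<mu>] by simp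
      then have "M (x + h) - M x - D h = \<mu> * (M (u + k) - M u - D k)"
        using Mh u(2) by (simp add: \<mu>_def right_diff_distrib)
      moreover have "M k < d" using h(2) \<mu> Mh by simp
      ultimately show ?thesis
        using d(2)[OF k(1)] \<mu> by (simp add: abs_mult Mh)
    qed
    then show "\<exists>d>0. \<forall>h\<in>S. M h < d \<longrightarrow> \<bar>M (x + h) - M x - D h\<bar> \<le> e * M h"
      using \<mu> d(1) by (intro exI[of _ "\<mu> * d"]) auto
  qed
  then show thesis by (rule that)
qed

text \<open>Squaring removes the corner of the norm at 0. The estimate is later applied at
  \<open>x - x0\<close> for an Ekeland point \<open>x\<close>, which may coincide with
  \<open>x0\<close>.\<close>

lemma (in normed_subspace) frechet_norm_square_upper:
  assumes M: "frechet_norm_on S M" and x: "x \<in> S" and e: "e > 0"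
  shows "\<exists>D d. bounded_functional_on S M D \<and> d > 0 \<and>
    (\<forall>h\<in>S. M h < d \<longrightarrow> (M (x + h))\<^sup>2 \<le> (M x)\<^sup>2 + D h + e * M h)"
proof (cases "x = 0")
  case True
  interpret M: normed_subspace S M
    using M by unfold_locales (simp add: frechet_norm_on_def)
  have "(M h)\<^sup>2 \<le> e * M h" if "h \<in> S" "M h < e" for h
    using that unfolding power2_eq_square by (intro mult_right_mono) auto
  moreover have "bounded_functional_on S M (\<lambda>h. 0)"
    by (auto simp: bounded_functional_on_def intro!: exI[of _ 0])
  ultimately show ?thesis using True e by (intro exI[of _ "\<lambda>h. 0"] exI[of _ e]) auto
next
  case False
  interpret M: normed_subspace S M
    using M by unfold_locales (simp add: frechet_norm_on_def)
  define \<mu> where "\<mu> = M x"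
  have \<mu>: "\<mu> > 0" using M.norm_eq_0[OF x] M.norm_nonneg[OF x] False by (simp add: \<mu>_def less_le)
  obtain D where D: "frechet_deriv_on S M M D x"
    using frechet_norm_at_point[OF M x False] by blast
  then obtain d where d: "d > 0"
    "\<And>h. h \<in> S \<Longrightarrow> M h < d \<Longrightarrow> \<bar>M (x + h) - M x - D h\<bar> \<le> e / (4 * \<mu>) * M h"
    using e \<mu> unfolding frechet_deriv_on_def
    by (metis divide_pos_pos mult_pos_pos zero_less_numeral)
  have "(M (x + h))\<^sup>2 \<le> (M x)\<^sup>2 + 2 * \<mu> * D h + e * M h" if h: "h \<in> S" "M h < min d (e / 2)" for h
  proof -
    define t where "t = M (x + h) - \<mu>"
    have "t \<le> D h + e / (4 * \<mu>) * M h" using d(2)[of h] h by (simp add: t_def \<mu>_def abs_le_iff)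
    then have "2 * \<mu> * t \<le> 2 * \<mu> * (D h + e / (4 * \<mu>) * M h)" using \<mu> by simp
    then have 1: "2 * \<mu> * t \<le> 2 * \<mu> * D h + e / 2 * M h" using \<mu> by (simp add: distrib_left)
    have "\<bar>t\<bar> \<le> M h"
      using M.norm_triangle[OF x h(1)] M.norm_diff_ge[OF x, of "- h"] h x by (simp add: t_def \<mu>_def abs_le_iff)
    then have "t\<^sup>2 \<le> (M h)\<^sup>2" by (metis abs_le_square_iff abs_of_nonneg M.norm_nonneg h(1))
    also have "\<dots> \<le> e / 2 * M h"
      using h unfolding power2_eq_square by (intro mult_right_mono) auto
    finally have 2: "t\<^sup>2 \<le> e / 2 * M h" .
    have "(M (x + h))\<^sup>2 = \<mu>\<^sup>2 + 2 * \<mu> * t + t\<^sup>2" by (simp add: t_def power2_eq_square algebra_simps)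
    then show ?thesis using 1 2 by (simp add: \<mu>_def)
  qed
  moreover have "bounded_functional_on S M (\<lambda>h. 2 * \<mu> * D h)"
    using D M.bounded_functional_cmult by (simp add: frechet_deriv_on_def)
  ultimately show ?thesis
    using d(1) e by (intro exI[of _ "\<lambda>h. 2 * \<mu> * D h"] exI[of _ "min d (e / 2)"]) auto
qed

text \<open>
  Ekeland's principle for \<open>K * (M (y - x0))\<^sup>2 - f y\<close> on a small ball around \<open>x0\<close>. The constant \<open>K\<close>
  is so large that the approximate minimum cannot lie on the sphere.
\<close>

lemma (in convex_on_open) almost_frechet_dense:
  assumes mc: "MS.mcomplete" and eqv: "equivalent_norm_on S N M" and M: "frechet_norm_on S M"
    and x0: "x0 \<in> U" and r0: "r0 > 0" and e: "e > 0"
  shows "\<exists>x\<in>almost_frechet_points U f e. N (x - x0) < r0"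
proof -
  interpret M: normed_subspace S M
    using M by unfold_locales (simp add: frechet_norm_on_def)
  obtain c C where c: "c > 0" "C > 0" "\<And>x. x \<in> S \<Longrightarrow> c * N x \<le> M x" "\<And>x. x \<in> S \<Longrightarrow> M x \<le> C * N x"
    using eqv unfolding equivalent_norm_on_def by blast
  obtain R L where R: "R > 0" "L \<ge> 0" "\<And>y. y \<in> S \<Longrightarrow> N (y - x0) < R \<Longrightarrow> y \<in> U"
    "\<And>y z. y \<in> S \<Longrightarrow> z \<in> S \<Longrightarrow> N (y - x0) < R \<Longrightarrow> N (z - x0) < R \<Longrightarrow> \<bar>f y - f z\<bar> \<le> L * N (y - z)"
    using locally_lipschitz[OF x0] by blast
  have x0S: "x0 \<in> S" using x0 U_subset by blast
  define r where "r = min r0 R / 2"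
  have r: "r > 0" "r < r0" "r < R" using r0 R by (auto simp: r_def)
  define B where "B = {y \<in> S. N (y - x0) \<le> r}"
  have BS: "y \<in> S" if "y \<in> B" for y using that by (simp add: B_def)
  have lip: "\<bar>f y - f z\<bar> \<le> L * N (y - z)" if "y \<in> B" "z \<in> B" for y z
    using R(4)[of y z] that r by (auto simp: B_def)
  have x0B: "x0 \<in> B" using x0S r by (simp add: B_def)
  \<comment> \<open>On the sphere \<open>M (x - x0)\<close> is at least \<open>c * r\<close>, so the
    penalty there is at least \<open>(L + 1) * r\<close>, more than the variation
    \<open>L * r\<close> of \<open>f\<close>.\<close>
  define K where "K = (L + 1) / (c\<^sup>2 * r)"
  have K: "K > 0" "K * (c * r)\<^sup>2 > L * r"
  proof -
    show "K > 0" using R c r by (auto simp: K_def intro!: divide_pos_pos)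
    have "K * (c * r)\<^sup>2 = (L + 1) * r"
      using c r by (simp add: K_def power_mult_distrib power2_eq_square)
    then show "K * (c * r)\<^sup>2 > L * r" using r by (simp add: distrib_right)
  qed
  define g where "g y = K * (M (y - x0))\<^sup>2 - f y" for y
  have "\<exists>x\<in>B. g x \<le> g x0 \<and> (\<forall>y\<in>B. g x - e / 2 * N (x - y) \<le> g y)"
  proof (rule ekeland_variational_principle[where B = "- f x0 - L * r"])
    show "0 \<le> N (x - y)" if "x \<in> B" "y \<in> B" for x y using that BS by simp
    show "N (x - z) \<le> N (x - y) + N (y - z)" if "x \<in> B" "y \<in> B" "z \<in> B" for x y z
      using that BS norm_triangle_diff by simp
    show "N (x - y) = N (y - x)" if "x \<in> B" "y \<in> B" for x y using that BS norm_minus_commute by simp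
    show "- f x0 - L * r \<le> g x" if "x \<in> B" for x
    proof -
      have "f x - f x0 \<le> L * N (x - x0)" using lip[OF that x0B] by simp
      also have "\<dots> \<le> L * r" using that R by (intro mult_left_mono) (auto simp: B_def)
      finally have "f x - f x0 \<le> L * r" .
      moreover have "0 \<le> K * (M (x - x0))\<^sup>2" using K by simp
      ultimately show ?thesis unfolding g_def by linarith
    qed
    fix \<sigma> :: "nat \<Rightarrow> 'a"
    assume \<sigma>B: "\<And>k. \<sigma> k \<in> B"
      and cau: "\<And>e. e > 0 \<Longrightarrow> \<exists>k0. \<forall>j\<ge>k0. \<forall>k\<ge>k0. N (\<sigma> j - \<sigma> k) < e"
    have \<sigma>S: "\<sigma> k \<in> S" for k using \<sigma>B BS by blast
    obtain l where l: "l \<in> S" "(\<lambda>k. N (\<sigma> k - l)) \<longlonglongrightarrow> 0"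
      using complete_sequence[OF mc \<sigma>S cau] by blast
    have "(\<lambda>k. N (\<sigma> k - l) + r) \<longlonglongrightarrow> 0 + r" by (intro tendsto_intros l)
    moreover have "N (l - x0) \<le> N (\<sigma> k - l) + r" for k
      using norm_triangle_diff[of l "\<sigma> k" x0] norm_minus_commute[of l "\<sigma> k"] \<sigma>B[of k] l x0S
      by (simp add: B_def)
    ultimately have "N (l - x0) \<le> r"
      using LIMSEQ_le_const[of _ "0 + r"] by auto
    then have lB: "l \<in> B" using l by (simp add: B_def)
    have "(\<lambda>k. f (\<sigma> k) - f l) \<longlonglongrightarrow> 0"
      by (rule Lim_null_comparison[OF _ tendsto_mult_right_zero[OF l(2), of L]])
        (use lip[OF \<sigma>B lB] in simp)
    then have f: "(\<lambda>k. f (\<sigma> k)) \<longlonglongrightarrow> f l" by (simp add: LIM_zero_iff)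
    have "\<bar>M (\<sigma> k - x0) - M (l - x0)\<bar> \<le> C * N (\<sigma> k - l)" for k
      using M.norm_diff_ge[of "\<sigma> k - x0" "l - x0"] M.norm_diff_ge[of "l - x0" "\<sigma> k - x0"]
        M.norm_minus_commute[of l "\<sigma> k"] c(4)[of "\<sigma> k - l"] \<sigma>S l x0S by simp
    then have "(\<lambda>k. M (\<sigma> k - x0) - M (l - x0)) \<longlonglongrightarrow> 0"
      by (intro Lim_null_comparison[OF _ tendsto_mult_right_zero[OF l(2), of C]]) simp
    then have "(\<lambda>k. M (\<sigma> k - x0)) \<longlonglongrightarrow> M (l - x0)" by (simp add: LIM_zero_iff)
    then have "(\<lambda>k. g (\<sigma> k)) \<longlonglongrightarrow> g l"
      unfolding g_def by (intro tendsto_intros f)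
    then show "\<exists>l\<in>B. (\<lambda>k. N (\<sigma> k - l)) \<longlonglongrightarrow> 0 \<and> (\<lambda>k. g (\<sigma> k)) \<longlonglongrightarrow> g l"
      using lB l by blast
  qed (use x0B e in auto)
  then obtain x where x: "x \<in> B" "g x \<le> g x0" "\<And>y. y \<in> B \<Longrightarrow> g x - e / 2 * N (x - y) \<le> g y"
    by blast
  have xS: "x \<in> S" using x BS by blast
  have inner: "N (x - x0) < r"
  proof (rule ccontr)
    assume "\<not> ?thesis"
    then have eq: "N (x - x0) = r" using x by (simp add: B_def)
    have "K * (c * r)\<^sup>2 \<le> K * (M (x - x0))\<^sup>2"
      using c(3)[of "x - x0"] eq xS x0S K c r by (intro mult_left_mono power_mono) auto
    also have "\<dots> \<le> f x - f x0" using x(2) by (simp add: g_def)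
    also have "\<dots> \<le> L * r" using lip[OF x(1) x0B] eq by simp
    finally show False using K by simp
  qed
  \<comment> \<open>The factors \<open>K\<close> and \<open>C\<close> are lost when the square is
    multiplied by \<open>K\<close> and \<open>M\<close> is replaced by \<open>N\<close>;
    \<open>e / 2\<close> remains, and Ekeland's error takes the other half.\<close>
  have "e / (2 * K * C) > 0" using e K c by simp
  then obtain D d where D: "bounded_functional_on S M D" "d > 0"
    "\<And>h. h \<in> S \<Longrightarrow> M h < d \<Longrightarrow>
      (M (x - x0 + h))\<^sup>2 \<le> (M (x - x0))\<^sup>2 + D h + e / (2 * K * C) * M h"
    using frechet_norm_square_upper[OF M, of "x - x0" "e / (2 * K * C)"] xS x0S by auto
  \<comment> \<open>Near-minimality of \<open>K * (M (y - x0))\<^sup>2 - f y\<close> at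
    \<open>x\<close>, read the other way round: \<open>f\<close> grows no faster than the smooth
    square, which lies below its own tangent up to a small error.\<close>
  have "f (x + h) \<le> f x + K * D h + e * N h" if h: "h \<in> S" "N h < min (d / C) (r - N (x - x0))" for h
  proof -
    have "N (x + h - x0) \<le> N (x - x0) + N h"
      using norm_triangle[of "x - x0" h] xS x0S h by (simp add: algebra_simps)
    then have "x + h \<in> B" using h xS by (simp add: B_def)
    then have 1: "g x - e / 2 * N h \<le> g (x + h)"
      using x(3)[of "x + h"] h by simp
    have "M h \<le> C * N h" using c h by simp
    also have "\<dots> < d" using h c by (simp add: field_simps)
    finally have "(M (x - x0 + h))\<^sup>2 \<le> (M (x - x0))\<^sup>2 + D h + e / (2 * K * C) * M h"
      using D h by simp
    also have "e / (2 * K * C) * M h \<le> e / (2 * K * C) * (C * N h)"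
      using c h e K by (intro mult_left_mono) auto
    also have "\<dots> = e / (2 * K) * N h" using c by simp
    finally have "K * (M (x - x0 + h))\<^sup>2 \<le> K * ((M (x - x0))\<^sup>2 + D h + e / (2 * K) * N h)"
      using K by simp
    then have "K * (M (x + h - x0))\<^sup>2 \<le> K * (M (x - x0))\<^sup>2 + K * D h + e / 2 * N h"
      using K by (simp add: algebra_simps)
    then show ?thesis using 1 by (simp add: g_def)
  qed
  moreover have "min (d / C) (r - N (x - x0)) > 0" using D c inner by simp
  moreover have "bounded_functional_on S N D"
  proof -
    obtain k where k: "\<And>h. h \<in> S \<Longrightarrow> \<bar>D h\<bar> \<le> k * M h"
      using D(1) unfolding bounded_functional_on_def by blast
    have "\<bar>D h\<bar> \<le> (\<bar>k\<bar> * C) * N h" if "h \<in> S" for h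
    proof -
      have "\<bar>D h\<bar> \<le> \<bar>k\<bar> * M h"
        using k[OF that] mult_right_mono[OF abs_ge_self[of k] M.norm_nonneg[OF that]] by linarith
      also have "\<dots> \<le> \<bar>k\<bar> * (C * N h)" using c that by (intro mult_left_mono) auto
      finally show ?thesis by (simp add: mult.assoc)
    qed
    then show ?thesis using D(1) by (auto simp: bounded_functional_on_def)
  qed
  moreover have "x \<in> U" using R(3)[OF xS] inner r by simp
  ultimately have "x \<in> almost_frechet_points U f e"
    using bounded_functional_cmult unfolding almost_frechet_points_def by blast
  then show ?thesis using less_trans[OF inner r(2)] by blast
qed

theorem asplund_if_frechet_norm:
  assumes banach: "banach_on S N" and eqv: "equivalent_norm_on S N M" and M: "frechet_norm_on S M"
  shows "asplund_on S N"
  unfolding asplund_on_def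
proof (intro conjI allI impI banach)
  fix U f
  assume "openin (norm_topology S N) U \<and> U \<noteq> {} \<and> convex_on U f
    \<and> continuous_map (subtopology (norm_topology S N) U) euclideanreal f"
  then interpret convex_on_open S N U f
    using banach by unfold_locales (auto simp: banach_on_def)
  have mc: "MS.mcomplete" using banach by (simp add: banach_on_def)
  let ?T = "norm_topology S N"
  let ?X = "subtopology ?T U"
  \<comment> \<open>The interior of the points of tolerance \<open>1 / (n + 1)\<close>. Openness is
    then automatic, and a point in all \<open>W n\<close> is a point of differentiability.\<close>
  define W where "W n = {x \<in> S. \<exists>r>0. \<forall>y\<in>S. N (y - x) < r \<longrightarrow>
      y \<in> almost_frechet_points U f (inverse (real (Suc n)))}" for n
  have W_sub: "x \<in> almost_frechet_points U f (inverse (real (Suc n)))" if "x \<in> W n" for x n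
    using that unfolding W_def by force
  have W_U: "W n \<subseteq> U" for n
    using W_sub by (auto simp: almost_frechet_points_def)
  have "openin ?T (W n)" for n
    unfolding openin_iff
  proof (intro conjI ballI)
    show "W n \<subseteq> S" by (auto simp: W_def)
    fix x assume "x \<in> W n"
    then obtain r where r: "x \<in> S" "r > 0"
      "\<And>y. y \<in> S \<Longrightarrow> N (y - x) < r \<Longrightarrow> y \<in> almost_frechet_points U f (inverse (real (Suc n)))"
      by (auto simp: W_def)
    have "y \<in> W n" if y: "y \<in> S" "N (y - x) < r / 2" for y
    proof -
      have "N (z - x) < r" if "z \<in> S" "N (z - y) < r / 2" for z
        using norm_triangle_diff[of z y x] that y r by simp
      then show ?thesis
        using r y unfolding W_def by (intro CollectI conjI exI[of _ "r / 2"]) auto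
    qed
    then show "\<exists>r>0. \<forall>y\<in>S. N (y - x) < r \<longrightarrow> y \<in> W n"
      using r by (intro exI[of _ "r / 2"]) auto
  qed
  then have W_open: "openin ?X (W n)" for n
    using W_U by (simp add: openU openin_open_subtopology)
  have W_dense: "?X closure_of (W n) = topspace ?X" for n
  proof -
    have "x \<in> ?T closure_of (W n)" if x: "x \<in> U" for x
      unfolding in_closure_of_iff[OF order_trans[OF W_U U_subset]]
    proof (intro conjI allI impI)
      show "x \<in> S" using x U_subset by blast
      fix r :: real assume r: "r > 0"
      \<comment> \<open>The tolerance triples in passing from a point to its neighbourhood.\<close>
      define e where "e = inverse (real (Suc n)) / 3"
      have e: "e > 0" "3 * e = inverse (real (Suc n))" by (auto simp: e_def)
      obtain y where y: "y \<in> almost_frechet_points U f e" "N (y - x) < r"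
        using almost_frechet_dense[OF mc eqv M x r e(1)] by blast
      then have "y \<in> S" using U_subset by (auto simp: almost_frechet_points_def)
      then have "y \<in> W n"
        using almost_frechet_neighbourhood[OF y(1) e(1)] unfolding W_def e(2) by blast
      then show "\<exists>y\<in>W n. N (y - x) < r" using y(2) by blast
    qed
    then show ?thesis
      using W_U[of n] U_subset by (auto simp: closure_of_subtopology Int_absorb1)
  qed
  define G where "G = \<Inter>(range W)"
  have GU: "G \<subseteq> U" using W_U by (auto simp: G_def)
  have "completely_metrizable_space ?X"
    using MS.completely_metrizable_space_mtopology[OF mc] openU
    by (simp add: mtopology completely_metrizable_space_openin)
  then have "?X closure_of G = topspace ?X"
    unfolding G_def by (intro Baire_category) (use W_open W_dense in auto)
  then have "U \<subseteq> ?T closure_of G"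
    using GU U_subset by (auto simp: closure_of_subtopology Int_absorb1)
  moreover have "gdelta_in ?X G"
    unfolding G_def by (rule gdelta_in_Inter) (use W_open open_imp_gdelta_in in auto)
  moreover have "\<exists>D. frechet_deriv_on S N f D x" if "x \<in> G" for x
    using that W_sub by (intro frechet_if_almost_frechet) (auto simp: G_def)
  ultimately show "\<exists>G. gdelta_in ?X G \<and> U \<subseteq> ?T closure_of G \<and> (\<forall>x\<in>G. \<exists>D. frechet_deriv_on S N f D x)"
    by blast
qed

section \<open>The Luxemburg norm\<close>

lemma convex_on_abs_powr:
  assumes p: "p \<ge> 1"
  shows "convex_on UNIV (\<lambda>t::real. \<bar>t\<bar> powr p)"
proof (rule convex_onI)
  fix t x y :: real assume t: "0 < t" "t < 1"
  have pos: "((1 - t) * a + t * b) powr p \<le> (1 - t) * a powr p + t * b powr p"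
    if ab: "0 \<le> a" "0 \<le> b" for a b
  proof -
    \<comment> \<open>This settles the case where one endpoint is 0; it is convexity between 0 and
      \<open>c\<close>.\<close>
    have shrink: "(s * c) powr p \<le> s * c powr p" if "0 < s" "s < 1" "0 \<le> c" for s c :: real
    proof -
      have "s powr p \<le> s powr 1" using that p by (intro powr_mono') auto
      then show ?thesis using that by (simp add: powr_mult mult_right_mono)
    qed
    consider "a = 0" | "b = 0" | "a > 0" "b > 0" using ab by linarith
    then show ?thesis
    proof cases
      case 1 then show ?thesis using shrink[of t b] t ab by simp
    next
      case 2 then show ?thesis using shrink[of "1 - t" a] t ab by simp
    next
      case 3 then show ?thesis using convex_onD[OF powr_convex[OF p], of t a b] t by simp
    qed
  qed
  have "\<bar>(1 - t) *\<^sub>R x + t *\<^sub>R y\<bar> \<le> (1 - t) * \<bar>x\<bar> + t * \<bar>y\<bar>"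
    using t abs_triangle_ineq[of "(1 - t) * x" "t * y"] by (simp add: abs_mult)
  then have "\<bar>(1 - t) *\<^sub>R x + t *\<^sub>R y\<bar> powr p \<le> ((1 - t) * \<bar>x\<bar> + t * \<bar>y\<bar>) powr p"
    using p by (intro powr_mono2) auto
  then show "\<bar>(1 - t) *\<^sub>R x + t *\<^sub>R y\<bar> powr p \<le> (1 - t) * \<bar>x\<bar> powr p + t * \<bar>y\<bar> powr p"
    using pos[of "\<bar>x\<bar>" "\<bar>y\<bar>"] by simp
qed simp

text \<open>Midpoint convexity at \<open>2 * a\<close> and \<open>2 * b\<close>. The factor 2 stays
  inside the power, since no constant outside would serve for unbounded exponents; the heart is
  invariant under such scalings.\<close>

lemma abs_powr_add_le:
  assumes "p \<ge> 1"
  shows "\<bar>a + b\<bar> powr p \<le> \<bar>2 * a\<bar> powr p / 2 + \<bar>2 * b\<bar> powr p / (2::real)"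
  using convex_onD[OF convex_on_abs_powr[OF assms], of "1/2" "2 * a" "2 * b"] by simp

definition modular :: "(nat \<Rightarrow> real) \<Rightarrow> (nat \<Rightarrow> real) \<Rightarrow> real" where
  "modular q x = (\<Sum>n. \<bar>x n\<bar> powr q n)"

lemma heart_summable_scaled:
  assumes "x \<in> nakano_heart q"
  shows "summable (\<lambda>n. \<bar>l * x n\<bar> powr q n)"
proof (cases "l = 0")
  case False
  then have "summable (\<lambda>n. \<bar>\<bar>l\<bar> * x n\<bar> powr q n)"
    using assms by (simp add: nakano_heart_def)
  then show ?thesis by (simp add: abs_mult)
qed simp

lemma heart_summable: "x \<in> nakano_heart q \<Longrightarrow> summable (\<lambda>n. \<bar>x n\<bar> powr q n)"
  using heart_summable_scaled[of x q 1] by simp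

lemma modular_nonneg: "x \<in> nakano_heart q \<Longrightarrow> 0 \<le> modular q x"
  unfolding modular_def by (intro suminf_nonneg heart_summable) auto

lemma modular_0 [simp]: "modular q 0 = 0"
  by (simp add: modular_def)

lemma sum_le_modular:
  "x \<in> nakano_heart q \<Longrightarrow> finite A \<Longrightarrow> (\<Sum>n\<in>A. \<bar>x n\<bar> powr q n) \<le> modular q x"
  unfolding modular_def by (intro sum_le_suminf heart_summable) auto

lemma modular_scale_abs: "modular q (\<bar>c\<bar> *\<^sub>R x) = modular q (c *\<^sub>R x)"
  by (simp add: modular_def abs_mult)

section \<open>The heart as a Banach space\<close>

locale nakano_exponents =
  fixes q :: "nat \<Rightarrow> real"
  assumes exponent_ge_1: "1 \<le> q n"
begin

abbreviation "H \<equiv> nakano_heart q"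
abbreviation "N \<equiv> luxemburg q"

lemma subspace_heart: "subspace H"
proof (rule subspaceI)
  show "0 \<in> H" by (simp add: nakano_heart_def)
  show "x + y \<in> H" if "x \<in> H" "y \<in> H" for x y
    unfolding nakano_heart_def
  proof (intro CollectI allI impI)
    fix l :: real
    have "summable (\<lambda>n. \<bar>(2 * l) * x n\<bar> powr q n / 2 + \<bar>(2 * l) * y n\<bar> powr q n / 2)"
      by (intro summable_add summable_divide heart_summable_scaled that)
    then show "summable (\<lambda>n. \<bar>l * (x + y) n\<bar> powr q n)"
    proof (rule summable_comparison_test'[where N = 0])
      fix n
      show "norm (\<bar>l * (x + y) n\<bar> powr q n)
          \<le> \<bar>(2 * l) * x n\<bar> powr q n / 2 + \<bar>(2 * l) * y n\<bar> powr q n / 2"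
        using abs_powr_add_le[OF exponent_ge_1[of n], of "l * x n" "l * y n"]
        by (simp add: distrib_left mult.assoc)
    qed
  qed
  show "c *\<^sub>R x \<in> H" if "x \<in> H" for c x
    using heart_summable_scaled[OF that] by (simp add: nakano_heart_def flip: mult.assoc)
qed

lemmas heart_0 [simp] = subspace_0[OF subspace_heart]
  and heart_add [simp] = subspace_add[OF subspace_heart]
  and heart_diff [simp] = subspace_diff[OF subspace_heart]
  and heart_scale [simp] = subspace_scale[OF subspace_heart]

lemma modular_mono:
  assumes "x \<in> H" "y \<in> H" "\<And>n. \<bar>x n\<bar> \<le> \<bar>y n\<bar>"
  shows "modular q x \<le> modular q y"
  unfolding modular_def
proof (intro suminf_le heart_summable assms(1,2))
  show "\<bar>x n\<bar> powr q n \<le> \<bar>y n\<bar> powr q n" for n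
    using assms(3)[of n] exponent_ge_1[of n] by (intro powr_mono2) auto
qed

lemma modular_convex:
  assumes "x \<in> H" "y \<in> H" "0 \<le> t" "t \<le> 1"
  shows "modular q ((1 - t) *\<^sub>R x + t *\<^sub>R y) \<le> (1 - t) * modular q x + t * modular q y"
proof -
  have "modular q ((1 - t) *\<^sub>R x + t *\<^sub>R y) \<le> (\<Sum>n. (1 - t) * \<bar>x n\<bar> powr q n + t * \<bar>y n\<bar> powr q n)"
    unfolding modular_def
  proof (intro suminf_le summable_add summable_mult heart_summable heart_add heart_scale assms(1,2))
    show "\<bar>((1 - t) *\<^sub>R x + t *\<^sub>R y) n\<bar> powr q n \<le> (1 - t) * \<bar>x n\<bar> powr q n + t * \<bar>y n\<bar> powr q n" for n
      using convex_onD[OF convex_on_abs_powr[OF exponent_ge_1] assms(3,4)] by simp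
  qed
  also have "\<dots> = (1 - t) * modular q x + t * modular q y"
    unfolding modular_def using heart_summable[OF assms(1)] heart_summable[OF assms(2)]
    by (simp add: suminf_add[symmetric] suminf_mult summable_mult)
  finally show ?thesis .
qed

lemma modular_scale_le:
  assumes "x \<in> H" "0 \<le> t" "t \<le> 1"
  shows "modular q (t *\<^sub>R x) \<le> t * modular q x"
  using modular_convex[OF heart_0 assms] by simp

lemma luxemburg_le:
  assumes "x \<in> H" "r > 0" "modular q ((1 / r) *\<^sub>R x) \<le> 1"
  shows "N x \<le> r"
  unfolding luxemburg_def
  by (rule cInf_lower)
    (use assms heart_summable_scaled[OF assms(1), of "1 / r"] in
      \<open>auto simp: modular_def intro!: bdd_belowI[of _ 0]\<close>)

lemma modular_le_1_if_less:
  assumes x: "x \<in> H" and "N x < r"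
  shows "modular q ((1 / r) *\<^sub>R x) \<le> 1 \<and> r > 0"
proof -
  let ?A = "{r. r > 0 \<and> summable (\<lambda>n. \<bar>x n / r\<bar> powr q n) \<and> (\<Sum>n. \<bar>x n / r\<bar> powr q n) \<le> 1}"
  \<comment> \<open>An explicit admissible radius, so that the infimum is taken over a nonempty set:
    dividing by \<open>s \<ge> 1\<close> shrinks the modular at least by that factor.\<close>
  define s where "s = 1 + modular q x"
  have s: "s \<ge> 1" using modular_nonneg[OF x] by (simp add: s_def)
  have "modular q ((1 / s) *\<^sub>R x) \<le> (1 / s) * modular q x"
    using modular_scale_le[OF x, of "1 / s"] s by simp
  also have "\<dots> \<le> 1" using s by (simp add: s_def)
  finally have "s \<in> ?A"
    using s heart_summable_scaled[OF x, of "1 / s"] by (auto simp: modular_def)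
  then obtain r' where r': "r' \<in> ?A" "r' < r"
    using cInf_lessD[of ?A r] assms(2) unfolding luxemburg_def by blast
  have "modular q ((1 / r) *\<^sub>R x) \<le> modular q ((1 / r') *\<^sub>R x)"
    using r' x by (intro modular_mono) (auto intro!: divide_left_mono)
  also have "(1 / r') *\<^sub>R x = (\<lambda>n. x n / r')" by (simp add: fun_eq_iff)
  also have "modular q (\<lambda>n. x n / r') \<le> 1" using r' unfolding modular_def by blast
  finally have "modular q ((1 / r) *\<^sub>R x) \<le> 1" .
  moreover have "r > 0" using r' by auto
  ultimately show ?thesis by blast
qed

text \<open>The infimum in the norm is attained. Finite partial sums depend continuously on the
  radius, so the bound 1 for all larger radii passes to \<open>r\<close>, and then to the full
  sum.\<close>

lemma modular_le_1:
  assumes x: "x \<in> H" and r: "N x \<le> r" "r > 0"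
  shows "modular q ((1 / r) *\<^sub>R x) \<le> 1"
proof -
  have "(\<Sum>n<m. \<bar>x n / r\<bar> powr q n) \<le> 1" for m
  proof (rule tendsto_upperbound)
    show "((\<lambda>s. \<Sum>n<m. \<bar>x n / s\<bar> powr q n) \<longlongrightarrow> (\<Sum>n<m. \<bar>x n / r\<bar> powr q n)) (at_right r)"
    proof (intro tendsto_sum tendsto_powr' tendsto_intros disjI2 conjI)
      show "0 < q n" for n using exponent_ge_1[of n] by simp
    qed (use r in auto)
    show "\<forall>\<^sub>F s in at_right r. (\<Sum>n<m. \<bar>x n / s\<bar> powr q n) \<le> 1"
      using eventually_at_right_less[of r]
    proof eventually_elim
      case (elim s)
      have "(\<Sum>n<m. \<bar>x n / s\<bar> powr q n) \<le> modular q ((1 / s) *\<^sub>R x)"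
        using sum_le_modular[of "(1 / s) *\<^sub>R x" q "{..<m}"] x by simp
      also have "\<dots> \<le> 1" using modular_le_1_if_less[OF x, of s] elim r by simp
      finally show ?case .
    qed
  qed simp
  then show ?thesis
    using heart_summable_scaled[OF x, of "1 / r"] suminf_le_const[of "\<lambda>n. \<bar>x n / r\<bar> powr q n" 1]
    by (simp add: modular_def)
qed

lemma abs_coordinate_le:
  assumes "x \<in> H"
  shows "\<bar>x n\<bar> \<le> N x"
proof (rule field_le_epsilon)
  fix e :: real assume "e > 0"
  define r where "r = N x + e"
  have r: "modular q ((1 / r) *\<^sub>R x) \<le> 1" "r > 0"
    using modular_le_1_if_less[OF assms, of r] \<open>e > 0\<close> by (auto simp: r_def)
  have "\<bar>x n / r\<bar> powr q n \<le> 1"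
    using sum_le_modular[of "(1 / r) *\<^sub>R x" q "{n}"] assms r by simp
  then have "\<not> \<bar>x n / r\<bar> > 1"
    using gr_one_powr[of "\<bar>x n / r\<bar>" "q n"] exponent_ge_1[of n] by linarith
  then show "\<bar>x n\<bar> \<le> N x + e"
    using r(2) by (simp add: field_simps) (simp add: r_def)
qed

lemma luxemburg_0: "N 0 = 0"
proof (rule antisym)
  show "N 0 \<le> 0"
  proof (rule field_le_epsilon)
    show "N 0 \<le> 0 + e" if "e > 0" for e using luxemburg_le[of 0 e] that by simp
  qed
  show "0 \<le> N 0" using abs_coordinate_le[OF heart_0, of 0] by simp
qed

lemma luxemburg_scale_le:
  assumes x: "x \<in> H"
  shows "N (c *\<^sub>R x) \<le> \<bar>c\<bar> * N x"
proof (cases "c = 0 \<or> x = 0")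
  case True then show ?thesis using luxemburg_0 by auto
next
  case False
  then obtain n where "x n \<noteq> 0" by (auto simp: fun_eq_iff)
  then have pos: "N x > 0" using abs_coordinate_le[OF x, of n] by linarith
  have "modular q (\<bar>1 / (\<bar>c\<bar> * N x) * c\<bar> *\<^sub>R x) = modular q ((1 / N x) *\<^sub>R x)"
    using False pos by (simp add: abs_mult)
  then have "modular q ((1 / (\<bar>c\<bar> * N x)) *\<^sub>R c *\<^sub>R x) \<le> 1"
    using modular_le_1[OF x order_refl pos] unfolding modular_scale_abs by simp
  then show ?thesis
    using False pos x by (intro luxemburg_le) auto
qed

lemma luxemburg_triangle:
  assumes x: "x \<in> H" and y: "y \<in> H"
  shows "N (x + y) \<le> N x + N y"
proof (rule field_le_epsilon)
  fix e :: real assume e: "e > 0"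
  define r s where "r = N x + e / 2" and "s = N y + e / 2"
  have r: "modular q ((1 / r) *\<^sub>R x) \<le> 1" "r > 0" and s: "modular q ((1 / s) *\<^sub>R y) \<le> 1" "s > 0"
    using modular_le_1_if_less[OF x, of r] modular_le_1_if_less[OF y, of s] e by (auto simp: r_def s_def)
  define t where "t = s / (r + s)"
  have t: "0 \<le> t" "t \<le> 1" and eq: "1 - t = r / (r + s)"
    using r s by (auto simp: t_def field_simps)
  have "(1 / (r + s)) *\<^sub>R (x + y) = (1 - t) *\<^sub>R (1 / r) *\<^sub>R x + t *\<^sub>R (1 / s) *\<^sub>R y"
    unfolding eq using r s by (simp add: t_def scaleR_add_right)
  then have "modular q ((1 / (r + s)) *\<^sub>R (x + y))
      \<le> (1 - t) * modular q ((1 / r) *\<^sub>R x) + t * modular q ((1 / s) *\<^sub>R y)"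
    using modular_convex[OF _ _ t, of "(1 / r) *\<^sub>R x" "(1 / s) *\<^sub>R y"] x y by simp
  also have "\<dots> \<le> (1 - t) * 1 + t * 1"
    using t r s by (intro add_mono mult_left_mono) auto
  finally have "N (x + y) \<le> r + s"
    using r s x y by (intro luxemburg_le) auto
  then show "N (x + y) \<le> N x + N y + e" by (simp add: r_def s_def)
qed

lemma normed_heart: "normed_on H N"
  unfolding normed_on_def
proof (intro conjI ballI allI subspace_heart luxemburg_triangle)
  fix x assume x: "x \<in> H"
  show "0 \<le> N x" using abs_coordinate_le[OF x, of 0] by linarith
  show "N x = 0 \<longleftrightarrow> x = 0"
  proof
    assume "N x = 0"
    then have "\<bar>x n\<bar> \<le> 0" for n using abs_coordinate_le[OF x, of n] by simp
    then show "x = 0" by (auto simp: fun_eq_iff)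
  qed (simp add: luxemburg_0)
  fix c
  show "N (c *\<^sub>R x) = \<bar>c\<bar> * N x"
  proof (cases "c = 0")
    case False
    have "N x = N ((1 / c) *\<^sub>R c *\<^sub>R x)" using False by simp
    also have "\<dots> \<le> \<bar>1 / c\<bar> * N (c *\<^sub>R x)" using x by (intro luxemburg_scale_le) simp
    finally have "\<bar>c\<bar> * N x \<le> N (c *\<^sub>R x)"
      using False by (simp add: abs_divide field_simps)
    then show ?thesis using luxemburg_scale_le[OF x, of c] by simp
  qed (simp add: luxemburg_0)
qed

sublocale normed_subspace H N
  by unfold_locales (rule normed_heart)

text \<open>Closedness of the heart in the form that completeness calls for: the approximant
  \<open>y\<close> may depend on the scale \<open>l\<close>, and only finiteness of the modular of
  the scaled difference is asked.\<close>

lemma heartI_approx: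
  assumes "\<And>l. l > 0 \<Longrightarrow> \<exists>y\<in>H. summable (\<lambda>n. \<bar>l * (x n - y n)\<bar> powr q n)"
  shows "x \<in> H"
  unfolding nakano_heart_def
proof (intro CollectI allI impI)
  fix l :: real assume "l > 0"
  then obtain y where y: "y \<in> H" "summable (\<lambda>n. \<bar>(2 * l) * (x n - y n)\<bar> powr q n)"
    using assms[of "2 * l"] by auto
  have "summable (\<lambda>n. \<bar>(2 * l) * (x n - y n)\<bar> powr q n / 2 + \<bar>(2 * l) * y n\<bar> powr q n / 2)"
    by (intro summable_add summable_divide heart_summable_scaled y)
  then show "summable (\<lambda>n. \<bar>l * x n\<bar> powr q n)"
  proof (rule summable_comparison_test'[where N = 0])
    fix n
    show "norm (\<bar>l * x n\<bar> powr q n)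
        \<le> \<bar>(2 * l) * (x n - y n)\<bar> powr q n / 2 + \<bar>(2 * l) * y n\<bar> powr q n / 2"
      using abs_powr_add_le[OF exponent_ge_1[of n], of "l * (x n - y n)" "l * y n"]
      by (simp add: algebra_simps)
  qed
qed

text \<open>Coordinates converge because the norm dominates them. Bounds on partial sums of the
  modular survive the coordinatewise limit, uniformly in the length of the sum; this gives both
  membership of the limit in the heart and convergence in norm.\<close>

lemma banach_heart: "banach_on H N"
  unfolding banach_on_def MS.mcomplete_def
proof (intro conjI normed_heart allI impI)
  fix \<sigma> assume "MS.MCauchy \<sigma>"
  then have \<sigma>: "\<sigma> k \<in> H" and cau: "\<And>e. e > 0 \<Longrightarrow> \<exists>k0. \<forall>j\<ge>k0. \<forall>k\<ge>k0. N (\<sigma> j - \<sigma> k) < e" for k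
    unfolding MS.MCauchy_def by (auto simp: subset_iff) (metis norm_dist rangeI)
  have "Cauchy (\<lambda>k. \<sigma> k n)" for n
  proof (rule CauchyI)
    fix e :: real assume "e > 0"
    then obtain k0 where k0: "\<forall>j\<ge>k0. \<forall>k\<ge>k0. N (\<sigma> j - \<sigma> k) < e" using cau by blast
    have "\<bar>\<sigma> j n - \<sigma> k n\<bar> < e" if "j \<ge> k0" "k \<ge> k0" for j k
      using abs_coordinate_le[of "\<sigma> j - \<sigma> k" n] \<sigma> k0 that by fastforce
    then show "\<exists>k0. \<forall>j\<ge>k0. \<forall>k\<ge>k0. norm (\<sigma> j n - \<sigma> k n) < e" by auto
  qed
  then have "\<exists>l. \<forall>n. (\<lambda>k. \<sigma> k n) \<longlonglongrightarrow> l n"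
    by (intro choice allI) (simp add: Cauchy_convergent_iff convergent_def)
  then obtain l where l: "\<And>n. (\<lambda>k. \<sigma> k n) \<longlonglongrightarrow> l n" by blast
  have partial: "\<exists>k0. \<forall>j\<ge>k0. \<forall>m. (\<Sum>n<m. \<bar>(1 / e) * (l n - \<sigma> j n)\<bar> powr q n) \<le> 1" if e: "e > 0" for e
  proof -
    obtain k0 where k0: "\<forall>j\<ge>k0. \<forall>k\<ge>k0. N (\<sigma> j - \<sigma> k) < e" using cau[OF e] by blast
    have "(\<Sum>n<m. \<bar>(1 / e) * (l n - \<sigma> j n)\<bar> powr q n) \<le> 1" if j: "j \<ge> k0" for j m
    proof (rule LIMSEQ_le_const2)
      show "(\<lambda>k. \<Sum>n<m. \<bar>(1 / e) * (\<sigma> k n - \<sigma> j n)\<bar> powr q n)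
          \<longlonglongrightarrow> (\<Sum>n<m. \<bar>(1 / e) * (l n - \<sigma> j n)\<bar> powr q n)"
      proof (intro tendsto_sum tendsto_powr' tendsto_intros l disjI2 conjI)
        show "0 < q n" for n using exponent_ge_1[of n] by simp
      qed auto
      have "(\<Sum>n<m. \<bar>(1 / e) * (\<sigma> k n - \<sigma> j n)\<bar> powr q n) \<le> 1" if "k \<ge> k0" for k
      proof -
        have "(\<Sum>n<m. \<bar>((1 / e) *\<^sub>R (\<sigma> k - \<sigma> j)) n\<bar> powr q n) \<le> modular q ((1 / e) *\<^sub>R (\<sigma> k - \<sigma> j))"
          by (intro sum_le_modular heart_scale heart_diff \<sigma>) auto
        also have "\<dots> \<le> 1"
          using k0 j that \<sigma> by (intro modular_le_1_if_less[THEN conjunct1] heart_diff) auto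
        finally show ?thesis by simp
      qed
      then show "\<exists>k0. \<forall>k\<ge>k0. (\<Sum>n<m. \<bar>(1 / e) * (\<sigma> k n - \<sigma> j n)\<bar> powr q n) \<le> 1" by blast
    qed
    then show ?thesis by blast
  qed
  have lH: "l \<in> H"
  proof (rule heartI_approx)
    fix c :: real assume "c > 0"
    then obtain k0 where "\<And>m. (\<Sum>n<m. \<bar>c * (l n - \<sigma> k0 n)\<bar> powr q n) \<le> 1"
      using partial[of "1 / c"] by auto
    then have "summable (\<lambda>n. \<bar>c * (l n - \<sigma> k0 n)\<bar> powr q n)"
      by (intro summableI_nonneg_bounded[where x = 1]) auto
    then show "\<exists>y\<in>H. summable (\<lambda>n. \<bar>c * (l n - y n)\<bar> powr q n)" using \<sigma> by blast
  qed
  have "(\<lambda>k. norm_dist H N (\<sigma> k) l) \<longlonglongrightarrow> 0"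
  proof (rule LIMSEQ_I)
    fix e :: real assume "e > 0"
    then obtain k0 where k0: "\<And>j m. j \<ge> k0 \<Longrightarrow> (\<Sum>n<m. \<bar>(1 / (e/2)) * (l n - \<sigma> j n)\<bar> powr q n) \<le> 1"
      using partial[of "e / 2"] by auto
    have "N (l - \<sigma> j) \<le> e / 2" if "j \<ge> k0" for j
    proof (rule luxemburg_le)
      have "summable (\<lambda>n. \<bar>((1 / (e / 2)) *\<^sub>R (l - \<sigma> j)) n\<bar> powr q n)"
        by (intro heart_summable heart_scale heart_diff lH \<sigma>)
      then show "modular q ((1 / (e / 2)) *\<^sub>R (l - \<sigma> j)) \<le> 1"
        unfolding modular_def by (rule suminf_le_const) (use k0[OF that] in simp)
    qed (use lH \<sigma> \<open>e > 0\<close> in auto)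
    then have "norm (norm_dist H N (\<sigma> j) l - 0) < e" if "j \<ge> k0" for j
      using that lH \<sigma> norm_minus_commute[OF lH \<sigma>, of j] \<open>e > 0\<close> by (force simp: norm_dist)
    then show "\<exists>k0. \<forall>k\<ge>k0. norm (norm_dist H N (\<sigma> k) l - 0) < e" by blast
  qed
  then show "\<exists>x. limitin MS.mtopology \<sigma> x sequentially"
    using lH \<sigma> by (intro exI[of _ l]) (simp add: MS.limitin_metric_dist_null)
qed

end

section \<open>Differentiability of the modular\<close>

text \<open>At 0 the difference quotient has absolute value
  \<open>\<bar>y\<bar> powr (p - 1)\<close>, which tends to 0 because \<open>p > 1\<close>. Writing
  \<open>deriv\<close> avoids a formula with signs; all later bounds on it come from
  convexity.\<close>

lemma abs_powr_has_derivative: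
  assumes p: "p > 1"
  shows "((\<lambda>t::real. \<bar>t\<bar> powr p) has_real_derivative deriv (\<lambda>t. \<bar>t\<bar> powr p) x) (at x)"
proof -
  have "\<exists>D. ((\<lambda>t. \<bar>t\<bar> powr p) has_real_derivative D) (at x)"
  proof -
    consider "x > 0" | "x < 0" | "x = 0" by linarith
    then show ?thesis
    proof cases
      case 1
      then have "((\<lambda>t. t powr p) has_real_derivative p * x powr (p - 1)) (at x)"
        by (rule has_real_derivative_powr)
      then have "((\<lambda>t. \<bar>t\<bar> powr p) has_real_derivative p * x powr (p - 1)) (at x)"
        by (rule has_field_derivative_transform_within_open[where S = "{0<..}"]) (use 1 in auto)
      then show ?thesis by blast
    next
      case 2
      then have "((\<lambda>t. (- t) powr p) has_real_derivative p * (- x) powr (p - 1) * (- 1)) (at x)"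
        by (auto intro!: derivative_eq_intros)
      then have "((\<lambda>t. \<bar>t\<bar> powr p) has_real_derivative p * (- x) powr (p - 1) * (- 1)) (at x)"
        by (rule has_field_derivative_transform_within_open[where S = "{..<0}"]) (use 2 in auto)
      then show ?thesis by blast
    next
      case 3
      have "((\<lambda>y::real. \<bar>y\<bar> powr (p - 1)) \<longlongrightarrow> \<bar>0\<bar> powr (p - 1)) (at 0)"
        using p by (intro tendsto_powr' tendsto_intros) auto
      then have lim: "((\<lambda>y::real. \<bar>y\<bar> powr (p - 1)) \<longlongrightarrow> 0) (at 0)" by simp
      have "((\<lambda>y::real. (\<bar>y\<bar> powr p - \<bar>0\<bar> powr p) / (y - 0)) \<longlongrightarrow> 0) (at 0)"
        by (rule Lim_null_comparison[OF _ lim]) (auto simp: abs_divide powr_diff intro!: always_eventually)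
      then show ?thesis using 3 by (auto simp: has_field_derivative_iff)
    qed
  qed
  then show ?thesis by (metis DERIV_imp_deriv)
qed

lemma abs_powr_tangent:
  assumes "p > 1"
  shows "\<bar>a\<bar> powr p + deriv (\<lambda>t. \<bar>t\<bar> powr p) a * u \<le> \<bar>a + u::real\<bar> powr p"
  using convex_on_imp_above_tangent[of UNIV "\<lambda>t. \<bar>t\<bar> powr p" a "a + u"]
    convex_on_abs_powr[of p] abs_powr_has_derivative[OF assms] assms by fastforce

text \<open>The Bregman distance of the power function from \<open>a\<close> to
  \<open>a + u\<close>. In \<open>u\<close> it is convex, nonnegative, and zero at 0.\<close>

definition abs_powr_remainder :: "real \<Rightarrow> real \<Rightarrow> real \<Rightarrow> real" where
  "abs_powr_remainder p a u = \<bar>a + u\<bar> powr p - \<bar>a\<bar> powr p - deriv (\<lambda>t. \<bar>t\<bar> powr p) a * u"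

lemma abs_powr_remainder_nonneg: "p > 1 \<Longrightarrow> 0 \<le> abs_powr_remainder p a u"
  using abs_powr_tangent[of p a u] by (simp add: abs_powr_remainder_def)

text \<open>Adding the remainder for \<open>- u\<close>, which is nonnegative, cancels the
  derivative.\<close>

lemma abs_powr_remainder_le:
  assumes "p > 1"
  shows "abs_powr_remainder p a u \<le> \<bar>2 * a\<bar> powr p + \<bar>2 * u\<bar> powr p"
proof -
  have "abs_powr_remainder p a u + abs_powr_remainder p a (- u)
      \<le> \<bar>a + u\<bar> powr p + \<bar>a - u\<bar> powr p"
    by (simp add: abs_powr_remainder_def)
  also have "\<dots> \<le> \<bar>2 * a\<bar> powr p + \<bar>2 * u\<bar> powr p"
    using abs_powr_add_le[of p a u] abs_powr_add_le[of p a "- u"] assms by simp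
  finally show ?thesis using abs_powr_remainder_nonneg[OF assms, of a "- u"] by linarith
qed

lemma abs_powr_remainder_scale:
  assumes "p > 1" "0 \<le> t" "t \<le> 1"
  shows "abs_powr_remainder p a (t * u) \<le> t * abs_powr_remainder p a u"
  using convex_on_ray[OF convex_on_abs_powr[of p], of a u t] assms
  by (simp add: abs_powr_remainder_def algebra_simps)

text \<open>The tangent at \<open>a\<close> lies below the function, so the value at
  \<open>a + v\<close> bounds the derivative in direction \<open>v\<close>; both signs of
  \<open>u\<close> give the absolute value.\<close>

lemma abs_powr_deriv_le:
  assumes "p > 1"
  shows "\<bar>deriv (\<lambda>t. \<bar>t\<bar> powr p) a * u\<bar> \<le> \<bar>2 * a\<bar> powr p + \<bar>2 * u :: real\<bar> powr p"
proof -
  have le: "deriv (\<lambda>t. \<bar>t\<bar> powr p) a * v \<le> \<bar>2 * a\<bar> powr p + \<bar>2 * v\<bar> powr p" for v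
  proof -
    have "deriv (\<lambda>t. \<bar>t\<bar> powr p) a * v \<le> \<bar>a + v\<bar> powr p"
      using abs_powr_tangent[OF assms, of a v] powr_ge_zero[of "\<bar>a\<bar>" p] by linarith
    also have "\<dots> \<le> \<bar>2 * a\<bar> powr p / 2 + \<bar>2 * v\<bar> powr p / 2"
      using assms by (intro abs_powr_add_le) simp
    also have "\<dots> \<le> \<bar>2 * a\<bar> powr p + \<bar>2 * v\<bar> powr p"
      by (intro add_mono) auto
    finally show ?thesis .
  qed
  show ?thesis using le[of u] le[of "- u"] by (simp add: abs_le_iff)
qed

text \<open>Phrased with a filter so that finitely many coordinates can share one radius.\<close>

lemma abs_powr_remainder_small:
  assumes "p > 1" "e > 0"
  shows "\<forall>\<^sub>F d in at_right 0. \<forall>u. \<bar>u\<bar> < d \<longrightarrow> abs_powr_remainder p a u \<le> e * \<bar>u\<bar>"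
proof -
  let ?D = "deriv (\<lambda>t. \<bar>t\<bar> powr p) a"
  have "((\<lambda>t. \<bar>t\<bar> powr p) has_derivative (\<lambda>u. ?D * u)) (at a)"
    using abs_powr_has_derivative[OF assms(1), of a] by (simp add: has_field_derivative_def)
  then obtain d where d: "d > 0"
    "\<And>y. \<bar>y - a\<bar> < d \<Longrightarrow> \<bar>\<bar>y\<bar> powr p - \<bar>a\<bar> powr p - ?D * (y - a)\<bar> \<le> e * \<bar>y - a\<bar>"
    using assms(2) unfolding has_derivative_at_alt by auto
  have "abs_powr_remainder p a u \<le> e * \<bar>u\<bar>" if "\<bar>u\<bar> < d" for u
    using d(2)[of "a + u"] that by (simp add: abs_powr_remainder_def)
  then show ?thesis
    using d(1) unfolding eventually_at_right_field by (meson less_trans)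
qed

definition modular_deriv :: "(nat \<Rightarrow> real) \<Rightarrow> (nat \<Rightarrow> real) \<Rightarrow> (nat \<Rightarrow> real) \<Rightarrow> real" where
  "modular_deriv q x h = (\<Sum>n. deriv (\<lambda>t. \<bar>t\<bar> powr q n) (x n) * h n)"

locale nakano_exponents_gt = nakano_exponents +
  fixes s :: real
  assumes s_gt_1: "1 < s" and s_le: "s \<le> q n"
begin

lemma exponent_gt_1: "1 < q n"
  using s_gt_1 s_le[of n] by linarith

lemma modular_deriv_summable:
  assumes "x \<in> H" "h \<in> H"
  shows "summable (\<lambda>n. \<bar>deriv (\<lambda>t. \<bar>t\<bar> powr q n) (x n) * h n\<bar>)"
  by (rule summable_comparison_test'[where N = 0,
        OF summable_add[OF heart_summable_scaled[OF assms(1), of 2] heart_summable_scaled[OF assms(2), of 2]]])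
    (use abs_powr_deriv_le[OF exponent_gt_1] in simp)

lemmas modular_deriv_summable' = summable_rabs_cancel[OF modular_deriv_summable]

lemma abs_modular_deriv_le:
  assumes "x \<in> H" "h \<in> H"
  shows "\<bar>modular_deriv q x h\<bar> \<le> modular q (2 *\<^sub>R x) + modular q (2 *\<^sub>R h)"
proof -
  have "\<bar>modular_deriv q x h\<bar> \<le> (\<Sum>n. \<bar>deriv (\<lambda>t. \<bar>t\<bar> powr q n) (x n) * h n\<bar>)"
    unfolding modular_deriv_def by (rule summable_rabs[OF modular_deriv_summable[OF assms]])
  also have "\<dots> \<le> (\<Sum>n. \<bar>2 * x n\<bar> powr q n + \<bar>2 * h n\<bar> powr q n)"
    by (intro suminf_le modular_deriv_summable assms summable_add heart_summable_scaled
        abs_powr_deriv_le exponent_gt_1)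
  also have "\<dots> = modular q (2 *\<^sub>R x) + modular q (2 *\<^sub>R h)"
    using suminf_add[OF heart_summable_scaled[OF assms(1), of 2] heart_summable_scaled[OF assms(2), of 2]]
    by (simp add: modular_def)
  finally show ?thesis .
qed

lemma bounded_modular_deriv:
  assumes x: "x \<in> H"
  shows "bounded_functional_on H N (modular_deriv q x)"
proof -
  have scale: "modular_deriv q x (c *\<^sub>R h) = c * modular_deriv q x h" if "h \<in> H" for c h
    unfolding modular_deriv_def using suminf_mult[OF modular_deriv_summable'[OF x that], of c]
    by (simp add: mult.left_commute)
  have add: "modular_deriv q x (h + k) = modular_deriv q x h + modular_deriv q x k"
    if "h \<in> H" "k \<in> H" for h k
    unfolding modular_deriv_def
    using suminf_add[OF modular_deriv_summable'[OF x that(1)] modular_deriv_summable'[OF x that(2)]]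
    by (simp add: distrib_left)
  define K where "K = modular q (2 *\<^sub>R x) + 1"
  have K: "K \<ge> 1" using modular_nonneg[of "2 *\<^sub>R x"] x by (simp add: K_def)
  have "\<bar>modular_deriv q x h\<bar> \<le> (2 * K) * N h" if h: "h \<in> H" for h
  proof (cases "h = 0")
    case True
    then show ?thesis using scale[OF h, of 0] by simp
  next
    case False
    then have pos: "N h > 0" using norm_eq_0[OF h] norm_nonneg[OF h] by (simp add: less_le)
    \<comment> \<open>The factor 2 makes \<open>2 *\<^sub>R k\<close> a point of norm 1, so that its
      modular, which appears in the bound on the derivative, is at most 1.\<close>
    define k where "k = (1 / (2 * N h)) *\<^sub>R h"
    have k: "k \<in> H" "h = (2 * N h) *\<^sub>R k" using h pos by (auto simp: k_def)
    have "modular q (2 *\<^sub>R k) \<le> 1"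
      using modular_le_1[OF h order_refl pos] by (simp add: k_def)
    then have "\<bar>modular_deriv q x k\<bar> \<le> K"
      using abs_modular_deriv_le[OF x k(1)] by (simp add: K_def)
    then have "2 * N h * \<bar>modular_deriv q x k\<bar> \<le> 2 * N h * K" using pos by simp
    moreover have "modular_deriv q x h = 2 * N h * modular_deriv q x k"
      by (subst k(2)) (rule scale[OF k(1)])
    ultimately show ?thesis using pos by (simp add: abs_mult mult_ac)
  qed
  then show ?thesis
    unfolding bounded_functional_on_def using scale add by blast
qed

lemma modular_expansion:
  assumes "x \<in> H" "h \<in> H"
  shows "(\<lambda>n. abs_powr_remainder (q n) (x n) (h n)) sums
           (modular q (x + h) - modular q x - modular_deriv q x h)"
proof -
  have "(\<lambda>n. \<bar>(x + h) n\<bar> powr q n - \<bar>x n\<bar> powr q n - deriv (\<lambda>t. \<bar>t\<bar> powr q n) (x n) * h n) sums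
      (modular q (x + h) - modular q x - modular_deriv q x h)"
    unfolding modular_def modular_deriv_def
    by (intro sums_diff summable_sums heart_summable heart_add modular_deriv_summable' assms)
  then show ?thesis by (simp add: abs_powr_remainder_def)
qed

lemma modular_tangent:
  assumes "x \<in> H" "h \<in> H"
  shows "modular q x + modular_deriv q x h \<le> modular q (x + h)"
  using sums_le[OF _ sums_zero modular_expansion[OF assms]] abs_powr_remainder_nonneg[OF exponent_gt_1]
  by simp

text \<open>
  The exponents may be unbounded. For small \<open>u\<close> the bound \<open>s > 1\<close> makes the modular of \<open>2 u\<close> small
  compared with \<open>N u\<close>, and since the remainder is convex in \<open>h\<close> and vanishes at \<open>0\<close>, its tail is controlled
  for all shorter multiples of \<open>u\<close> as well.
\<close>

lemma modular_remainder_small: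
  assumes x: "x \<in> H" and e: "e > 0"
  shows "\<exists>d>0. \<forall>h\<in>H. N h < d \<longrightarrow> modular q (x + h) - modular q x - modular_deriv q x h \<le> e * N h"
proof -
  let ?r = "\<lambda>n u. abs_powr_remainder (q n) (x n) u"
  have r0: "0 \<le> ?r n u" for n u using abs_powr_remainder_nonneg[OF exponent_gt_1] .
  have "((\<lambda>t. 2 powr s * t powr (s - 1)) \<longlongrightarrow> 2 powr s * 0 powr (s - 1)) (at_right 0)"
    using s_gt_1 by (intro tendsto_intros tendsto_powr' disjI2 conjI) (auto simp: eventually_at_filter)
  then have "\<forall>\<^sub>F t in at_right 0. 2 powr s * t powr (s - 1) < e / 4"
    using e by (intro order_tendstoD(2)) auto
  then have "\<forall>\<^sub>F t in at_right 0. 2 powr s * t powr (s - 1) < e / 4 \<and> 0 < t \<and> t < 1/2"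
    using eventually_at_right_real[of 0 "1/2 :: real", simplified] by eventually_elim simp
  then obtain t where t: "2 powr s * t powr (s - 1) < e / 4" "0 < t" "t < 1/2"
    using eventually_happens trivial_limit_at_right_real by blast
  have t2: "(2 * t) powr s \<le> e * t / 4"
  proof -
    have "(2 * t) powr s = 2 powr s * t powr (s - 1) * t"
      using t by (simp add: powr_mult powr_diff)
    also have "\<dots> \<le> e / 4 * t" using t by (intro mult_right_mono) auto
    finally show ?thesis by simp
  qed
  have small: "modular q (2 *\<^sub>R u) \<le> e * t / 4" if u: "u \<in> H" "N u \<le> t" for u
  proof -
    have "modular q (2 *\<^sub>R u) \<le> (\<Sum>n. (2 * t) powr s * \<bar>((1 / t) *\<^sub>R u) n\<bar> powr q n)"
      unfolding modular_def
    proof (intro suminf_le summable_mult heart_summable heart_scale u)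
      fix n
      have "\<bar>(2 *\<^sub>R u) n\<bar> = (2 * t) * \<bar>((1 / t) *\<^sub>R u) n\<bar>"
        using t by (simp add: abs_mult)
      then have "\<bar>(2 *\<^sub>R u) n\<bar> powr q n = (2 * t) powr q n * \<bar>((1 / t) *\<^sub>R u) n\<bar> powr q n"
        using t by (simp only: powr_mult)
      also have "\<dots> \<le> (2 * t) powr s * \<bar>((1 / t) *\<^sub>R u) n\<bar> powr q n"
        using t s_le[of n] by (intro mult_right_mono powr_mono') auto
      finally show "\<bar>(2 *\<^sub>R u) n\<bar> powr q n \<le> (2 * t) powr s * \<bar>((1 / t) *\<^sub>R u) n\<bar> powr q n" .
    qed
    also have "\<dots> = (2 * t) powr s * modular q ((1 / t) *\<^sub>R u)"
      unfolding modular_def by (intro suminf_mult heart_summable heart_scale u)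
    also have "\<dots> \<le> (2 * t) powr s * 1"
      using modular_le_1[OF u t(2)] by (intro mult_left_mono) auto
    finally show ?thesis using t2 by simp
  qed
  \<comment> \<open>The order of choices matters: \<open>t\<close> is fixed first, then the tail
    index \<open>m\<close> for the scale \<open>t\<close>, and only then the radius
    \<open>d\<close>, so \<open>m\<close> does not depend on \<open>h\<close>.\<close>
  obtain m where m: "(\<Sum>n. \<bar>2 * x (n + m)\<bar> powr q (n + m)) \<le> e * t / 4"
  proof -
    obtain m where "norm (\<Sum>n. \<bar>2 * x (n + m)\<bar> powr q (n + m)) < e * t / 4"
      using suminf_exist_split[OF _ heart_summable_scaled[OF x, of 2], of "e * t / 4"] e t by auto
    then show thesis using that[of m] by simp
  qed
  \<comment> \<open>Half of \<open>e\<close> is spread over the \<open>m\<close> head coordinates;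
    the added 1 keeps the quotient meaningful for \<open>m = 0\<close>.\<close>
  define e' where "e' = e / (2 * (real m + 1))"
  have e': "e' > 0" "real m * e' \<le> e / 2" using e by (auto simp: e'_def field_simps)
  have "\<forall>\<^sub>F d in at_right 0. \<forall>n\<in>{..<m}. \<forall>u. \<bar>u\<bar> < d \<longrightarrow> ?r n u \<le> e' * \<bar>u\<bar>"
    by (intro eventually_ball_finite ballI abs_powr_remainder_small exponent_gt_1 e') simp
  then have "\<forall>\<^sub>F d in at_right 0. (\<forall>n\<in>{..<m}. \<forall>u. \<bar>u\<bar> < d \<longrightarrow> ?r n u \<le> e' * \<bar>u\<bar>) \<and> 0 < d \<and> d < t"
    using eventually_at_right_real[OF t(2)] by eventually_elim simp
  from eventually_happens[OF this]
  obtain d where d: "\<And>n u. n < m \<Longrightarrow> \<bar>u\<bar> < d \<Longrightarrow> ?r n u \<le> e' * \<bar>u\<bar>" "0 < d" "d < t"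
    by auto
  have "modular q (x + h) - modular q x - modular_deriv q x h \<le> e * N h" if h: "h \<in> H" "N h < d" for h
  proof (cases "h = 0")
    case True
    then show ?thesis by (simp add: modular_deriv_def)
  next
    case False
    then have pos: "N h > 0" using norm_eq_0[OF h(1)] norm_nonneg[OF h(1)] by (simp add: less_le)
    \<comment> \<open>\<open>h\<close> is \<open>\<tau>\<close> times a vector \<open>u\<close> of
      norm \<open>t\<close>. The tail remainder of \<open>u\<close> is at most
      \<open>e * t / 2\<close>, and convexity multiplies it by \<open>\<tau>\<close>, which gives
      \<open>e / 2 * N h\<close>.\<close>
    define \<tau> where "\<tau> = N h / t"
    define u where "u = (1 / \<tau>) *\<^sub>R h"
    have \<tau>: "0 < \<tau>" "\<tau> \<le> 1" using pos h d t by (auto simp: \<tau>_def)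
    have u: "u \<in> H" "\<And>n. h n = \<tau> * u n" using h \<tau> by (auto simp: u_def)
    have Nu: "N u \<le> t" using h \<tau> pos t by (simp add: u_def norm_scale) (simp add: \<tau>_def)
    have sr: "summable (\<lambda>n. ?r n (h n))"
      using modular_expansion[OF x h(1)] by (rule sums_summable)
    have "(\<Sum>n<m. ?r n (h n)) \<le> (\<Sum>n<m. e' * N h)"
    proof (rule sum_mono)
      fix n assume "n \<in> {..<m}"
      moreover have "\<bar>h n\<bar> \<le> N h" by (rule abs_coordinate_le[OF h(1)])
      ultimately have "?r n (h n) \<le> e' * \<bar>h n\<bar>" using d(1)[of n "h n"] h by simp
      also have "\<dots> \<le> e' * N h" using \<open>\<bar>h n\<bar> \<le> N h\<close> e' by simp
      finally show "?r n (h n) \<le> e' * N h" .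
    qed
    also have "\<dots> \<le> e / 2 * N h"
      using mult_right_mono[OF e'(2), of "N h"] pos by (simp add: mult.assoc)
    finally have head: "(\<Sum>n<m. ?r n (h n)) \<le> e / 2 * N h" .
    have s2: "summable (\<lambda>n. \<bar>2 * x (n + m)\<bar> powr q (n + m))" "summable (\<lambda>n. \<bar>2 * u (n + m)\<bar> powr q (n + m))"
      using summable_ignore_initial_segment[OF heart_summable_scaled[OF x, of 2], of m]
        summable_ignore_initial_segment[OF heart_summable_scaled[OF u(1), of 2], of m] by auto
    have "(\<Sum>n. ?r (n + m) (h (n + m)))
        \<le> (\<Sum>n. \<tau> * (\<bar>2 * x (n + m)\<bar> powr q (n + m) + \<bar>2 * u (n + m)\<bar> powr q (n + m)))"
    proof (intro suminf_le summable_mult summable_add s2)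
      show "summable (\<lambda>n. ?r (n + m) (h (n + m)))"
        using summable_ignore_initial_segment[OF sr, of m] .
      fix n
      let ?k = "n + m"
      have "?r ?k (h ?k) \<le> \<tau> * ?r ?k (u ?k)"
        unfolding u(2) using \<tau> by (intro abs_powr_remainder_scale exponent_gt_1) auto
      also have "\<dots> \<le> \<tau> * (\<bar>2 * x ?k\<bar> powr q ?k + \<bar>2 * u ?k\<bar> powr q ?k)"
        using \<tau> by (intro mult_left_mono abs_powr_remainder_le exponent_gt_1) auto
      finally show "?r ?k (h ?k) \<le> \<tau> * (\<bar>2 * x ?k\<bar> powr q ?k + \<bar>2 * u ?k\<bar> powr q ?k)" .
    qed
    also have "\<dots> = \<tau> * ((\<Sum>n. \<bar>2 * x (n + m)\<bar> powr q (n + m)) + (\<Sum>n. \<bar>2 * u (n + m)\<bar> powr q (n + m)))"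
      by (simp only: suminf_mult[OF summable_add[OF s2]] suminf_add[OF s2])
    also have "(\<Sum>n. \<bar>2 * u (n + m)\<bar> powr q (n + m)) \<le> modular q (2 *\<^sub>R u)"
      using suminf_split_initial_segment[OF heart_summable_scaled[OF u(1), of 2], of m]
        sum_nonneg[of "{..<m}" "\<lambda>n. \<bar>2 * u n\<bar> powr q n"]
      by (simp add: modular_def)
    also have "\<dots> \<le> e * t / 4" by (rule small[OF u(1) Nu])
    also have "(\<Sum>n. \<bar>2 * x (n + m)\<bar> powr q (n + m)) \<le> e * t / 4" by (rule m)
    finally have "(\<Sum>n. ?r (n + m) (h (n + m))) \<le> \<tau> * (e * t / 4 + e * t / 4)" using \<tau> by simp
    also have "\<dots> = e / 2 * N h" using t by (simp add: \<tau>_def)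
    finally have tail: "(\<Sum>n. ?r (n + m) (h (n + m))) \<le> e / 2 * N h" .
    have "modular q (x + h) - modular q x - modular_deriv q x h = (\<Sum>n. ?r n (h n))"
      using modular_expansion[OF x h(1)] by (rule sums_unique)
    also have "\<dots> = (\<Sum>n. ?r (n + m) (h (n + m))) + (\<Sum>n<m. ?r n (h n))"
      by (rule suminf_split_initial_segment[OF sr])
    finally show ?thesis using head tail by linarith
  qed
  then show ?thesis using d(2) by blast
qed

section \<open>The norm as the gauge of a differentiable modular\<close>

text \<open>If the modular of \<open>x\<close> were below 1, its differentiability would leave room
  to stretch \<open>x\<close> by some factor \<open>1 + t\<close> within the unit ball, forcing
  \<open>N x\<close> below 1.\<close>

lemma modular_eq_1:
  assumes x: "x \<in> H" and "N x = 1"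
  shows "modular q x = 1"
proof (rule antisym)
  show "modular q x \<le> 1" using modular_le_1[OF x, of 1] assms by simp
  show "1 \<le> modular q x"
  proof (rule ccontr)
    assume less: "\<not> ?thesis"
    obtain d where d: "d > 0"
      "\<And>h. h \<in> H \<Longrightarrow> N h < d \<Longrightarrow> modular q (x + h) - modular q x - modular_deriv q x h \<le> 1 * N h"
      using modular_remainder_small[OF x, of 1] by auto
    define c where "c = \<bar>modular_deriv q x x\<bar> + 1"
    define t where "t = min (d / 2) ((1 - modular q x) / c)"
    have c: "c > 0" by (simp add: c_def)
    have "t \<le> (1 - modular q x) / c" by (simp add: t_def)
    then have "t * c \<le> 1 - modular q x" using c by (simp add: pos_le_divide_eq)
    moreover have "0 < t" "t < d" using d less c by (auto simp: t_def)
    ultimately have t: "0 < t" "t < d" "t * c \<le> 1 - modular q x" by blast+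
    have "modular q (x + t *\<^sub>R x) \<le> modular q x + modular_deriv q x (t *\<^sub>R x) + t"
      using d(2)[of "t *\<^sub>R x"] t x assms by (simp add: norm_scale)
    also have "modular_deriv q x (t *\<^sub>R x) = t * modular_deriv q x x"
      using bounded_modular_deriv[OF x] x by (simp add: bounded_functional_on_def)
    also have "modular q x + t * modular_deriv q x x + t \<le> modular q x + t * c"
      using t by (simp add: c_def distrib_left)
    also have "\<dots> \<le> 1" using t by simp
    finally have "modular q (x + t *\<^sub>R x) \<le> 1" .
    moreover have "(1 / (1 / (1 + t))) *\<^sub>R x = x + t *\<^sub>R x"
      by (auto simp: fun_eq_iff algebra_simps)
    ultimately have "modular q ((1 / (1 / (1 + t))) *\<^sub>R x) \<le> 1" by (simp only:)
    then have "N x \<le> 1 / (1 + t)" using x t by (intro luxemburg_le) auto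
    then show False using assms t by (simp add: field_simps)
  qed
qed

text \<open>On the unit sphere the modular equals 1, so implicit differentiation predicts the
  derivative \<open>F h / F x\<close>, which is \<open>L h\<close>. The upper estimate places
  \<open>x + h\<close>, divided by \<open>1 + L h + e * N h\<close>, in the unit ball; the lower one
  uses the hyperplane given by \<open>F\<close> that supports the ball at \<open>x\<close>.\<close>

theorem frechet_norm_luxemburg: "frechet_norm_on H N"
  unfolding frechet_norm_on_def
proof (intro conjI normed_heart ballI impI)
  fix x assume x: "x \<in> H" and Nx: "N x = 1"
  have mx: "modular q x = 1" by (rule modular_eq_1[OF x Nx])
  define F where "F = modular_deriv q x"
  have F: "bounded_functional_on H N F" unfolding F_def by (rule bounded_modular_deriv[OF x])
  have F_add: "F (h + k) = F h + F k" and F_scale: "F (a *\<^sub>R h) = a * F h"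
    if "h \<in> H" "k \<in> H" for h k a
    using F that by (auto simp: bounded_functional_on_def)
  have F_diff: "F (h - k) = F h - F k" if "h \<in> H" "k \<in> H" for h k
    using F_add[of "h - k" k] that by simp
  obtain K where K: "\<And>h. h \<in> H \<Longrightarrow> \<bar>F h\<bar> \<le> K * N h"
    using F unfolding bounded_functional_on_def by blast
  define c where "c = F x"
  \<comment> \<open>The tangent inequality in direction \<open>- x\<close>: the modular falls from 1
    to 0, so its derivative in direction \<open>x\<close> is at least 1.\<close>
  have c: "c \<ge> 1"
    using modular_tangent[OF x, of "- x"] x mx F_scale[OF x x, of "-1"] by (simp add: c_def F_def)
  have K1: "K \<ge> 1" using K[OF x] c Nx by (simp add: c_def)
  define L where "L h = (1 / c) * F h" for h
  have L: "\<bar>L h\<bar> \<le> K * N h" if "h \<in> H" for h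
  proof -
    have "\<bar>L h\<bar> = \<bar>F h\<bar> / c" using c by (simp add: L_def abs_mult)
    also have "\<dots> \<le> \<bar>F h\<bar>" using c mult_right_mono[of 1 c "\<bar>F h\<bar>"] by (simp add: field_simps)
    finally show ?thesis using K[OF that] by linarith
  qed
  have "frechet_deriv_on H N N L x"
    unfolding frechet_deriv_on_def
  proof (intro conjI allI impI)
    show "bounded_functional_on H N L"
      unfolding L_def by (rule bounded_functional_cmult[OF F])
    fix e :: real assume e: "e > 0"
    \<comment> \<open>Since \<open>N k\<close> is at most
      \<open>(1 + K + e) * N h / (1 + t)\<close>, the remainder of the modular is at most
      \<open>e * N h / (1 + t)\<close>. The summand \<open>e * N h\<close> of \<open>t\<close>
      lowers \<open>F k\<close> by at least this much, because \<open>c \<ge> 1\<close>.\<close>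
    define \<eta> where "\<eta> = e / (1 + K + e)"
    have \<eta>: "\<eta> > 0" "\<eta> * (1 + K + e) = e" using e K1 by (auto simp: \<eta>_def)
    obtain d where d: "d > 0"
      "\<And>k. k \<in> H \<Longrightarrow> N k < d \<Longrightarrow> modular q (x + k) - modular q x - F k \<le> \<eta> * N k"
      using modular_remainder_small[OF x \<eta>(1)] unfolding F_def by blast
    \<comment> \<open>Small enough to ensure \<open>1 + t > 1 / 2\<close> and
      \<open>N k < d\<close>.\<close>
    define \<delta> where "\<delta> = min 1 d / (2 * (1 + K + e))"
    have "\<bar>N (x + h) - N x - L h\<bar> \<le> e * N h" if h: "h \<in> H" "N h < \<delta>" for h
    proof -
      define \<beta> where "\<beta> = 1 + K + e"
      have \<beta>: "\<beta> > 0" using K1 e by (simp add: \<beta>_def)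
      have small: "2 * (\<beta> * N h) < 1" "2 * (\<beta> * N h) < d"
      proof -
        have "N h < min 1 d / (2 * \<beta>)" using h by (simp only: \<delta>_def \<beta>_def)
        then have "N h * (2 * \<beta>) < min 1 d" using \<beta> by (simp add: pos_less_divide_eq)
        then show "2 * (\<beta> * N h) < 1" "2 * (\<beta> * N h) < d" by (simp_all add: mult_ac)
      qed
      have Nh: "0 \<le> N h" using h by simp
      define t where "t = L h + e * N h"
      have t: "\<bar>t\<bar> \<le> (K + e) * N h"
      proof -
        have "0 \<le> e * N h" using Nh e by simp
        then show ?thesis
          using L[OF h(1)] unfolding t_def distrib_right abs_le_iff by linarith
      qed
      have "(K + e) * N h \<le> \<beta> * N h" using Nh by (intro mult_right_mono) (auto simp: \<beta>_def)
      then have t1: "1 / 2 < 1 + t" using t small by linarith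
      \<comment> \<open>Chosen so that \<open>x + k\<close> is \<open>x + h\<close> divided by
        \<open>1 + t\<close>.\<close>
      define k where "k = (1 / (1 + t)) *\<^sub>R (h - t *\<^sub>R x)"
      have k: "k \<in> H" using h x by (simp add: k_def)
      have "N (h - t *\<^sub>R x) \<le> N h + \<bar>t\<bar>"
        using norm_diff_le[of h "t *\<^sub>R x"] h x Nx by (simp add: norm_scale)
      also have "\<dots> \<le> \<beta> * N h" using t by (simp add: \<beta>_def distrib_right)
      finally have "N (h - t *\<^sub>R x) \<le> \<beta> * N h" .
      then have Nk: "N k \<le> \<beta> * N h / (1 + t)"
        using t1 h x by (simp add: k_def norm_scale divide_right_mono)
      also have "\<dots> \<le> \<beta> * N h / (1 / 2)"
        using t1 \<beta> Nh by (intro divide_left_mono) auto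
      finally have "N k < d" using small by simp
      then have "modular q (x + k) \<le> 1 + F k + \<eta> * N k" using d(2)[OF k] mx by simp
      also have "F k = - (e * c * N h / (1 + t))"
      proof -
        have "F k = (1 / (1 + t)) * (F h - t * c)"
          unfolding k_def c_def using h x
          by (subst F_scale, simp, simp, subst F_diff, simp, simp, subst F_scale[OF x x]) simp
        moreover have "t * c = F h + e * c * N h"
          using c by (simp add: t_def L_def field_simps)
        ultimately show ?thesis by simp
      qed
      also have "1 + - (e * c * N h / (1 + t)) + \<eta> * N k
          \<le> 1 + - (e * c * N h / (1 + t)) + \<eta> * (\<beta> * N h / (1 + t))"
        using Nk \<eta> by (intro add_left_mono mult_left_mono) auto
      also have "\<eta> * (\<beta> * N h / (1 + t)) = e * N h / (1 + t)"
        using \<eta>(2) by (simp add: \<beta>_def mult.assoc[symmetric])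
      also have "e * N h / (1 + t) \<le> e * c * N h / (1 + t)"
        using t1 e c Nh by (intro divide_right_mono mult_right_mono) auto
      finally have "modular q (x + k) \<le> 1" by linarith
      moreover have "x + k = (1 / (1 + t)) *\<^sub>R (x + h)"
      proof -
        have "(1 / (1 + t)) *\<^sub>R (1 + t) *\<^sub>R x = x"
          using t1 by simp
        then have "x = (1 / (1 + t)) *\<^sub>R (x + t *\<^sub>R x)"
          by (simp only: scaleR_add_left scaleR_one)
        then have "x + k = (1 / (1 + t)) *\<^sub>R ((x + t *\<^sub>R x) + (h - t *\<^sub>R x))"
          unfolding k_def scaleR_add_right by simp
        then show ?thesis by simp
      qed
      ultimately have upper: "N (x + h) \<le> 1 + t"
        using h x t1 by (intro luxemburg_le) auto
      \<comment> \<open>The normalised point \<open>y\<close> has modular at most 1, the value at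
        \<open>x\<close>, so the tangent at \<open>x\<close> gives
        \<open>F (y - x) \<le> 0\<close>.\<close>
      have lower: "1 + L h \<le> N (x + h)"
      proof -
        define \<nu> where "\<nu> = N (x + h)"
        have "N h \<le> \<beta> * N h" using Nh K1 e mult_right_mono[of 1 \<beta> "N h"] by (simp add: \<beta>_def)
        then have "N h < 1" using small Nh by linarith
        then have \<nu>: "\<nu> > 0"
          using norm_diff_ge[of x "- h"] x h Nx by (simp add: \<nu>_def)
        define y where "y = (1 / \<nu>) *\<^sub>R (x + h)"
        have y: "y \<in> H" using x h by (simp add: y_def)
        have "modular q y \<le> 1"
          unfolding y_def using modular_le_1[of "x + h" \<nu>] x h \<nu> by (simp add: \<nu>_def)
        then have "F (y - x) \<le> 0"
          using modular_tangent[OF x, of "y - x"] x y mx by (simp add: F_def)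
        then have "F y \<le> c" using F_diff[OF y x] by (simp add: c_def)
        moreover have "F y = (1 / \<nu>) * (c + F h)"
          using x h F_scale[of "x + h"] F_add[of x h] by (simp add: y_def c_def)
        ultimately have "c + F h \<le> \<nu> * c" using \<nu> by (simp add: field_simps)
        then show ?thesis using c by (simp add: L_def field_simps \<nu>_def)
      qed
      have "0 \<le> e * N h" using Nh e by simp
      then show ?thesis using upper lower Nx unfolding t_def abs_le_iff by linarith
    qed
    moreover have "\<delta> > 0" using d K1 e by (simp add: \<delta>_def)
    ultimately show "\<exists>d>0. \<forall>h\<in>H. N h < d \<longrightarrow> \<bar>N (x + h) - N x - L h\<bar> \<le> e * N h" by blast
  qed
  then show "\<exists>D. frechet_deriv_on H N N D x" by blast
qed

end

section \<open>Changing finitely many exponents\<close>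

lemma heart_finite_change:
  assumes "finite {n. q n \<noteq> q' n}"
  shows "nakano_heart q = nakano_heart q'"
proof -
  have "\<forall>\<^sub>F n in sequentially. q n = q' n"
    using assms by (simp add: eventually_cofinite flip: cofinite_eq_sequentially)
  then have "summable (\<lambda>n. \<bar>l * x n\<bar> powr q n) = summable (\<lambda>n. \<bar>l * x n\<bar> powr q' n)" for l :: real and x
    by (intro summable_cong) (auto elim: eventually_mono)
  then show ?thesis by (simp add: nakano_heart_def)
qed

text \<open>Coordinates of a normalised vector have absolute value at most 1, so larger exponents
  decrease the modular. Conversely, each changed coordinate adds at most 1 to the modular for
  \<open>q\<close>, which is thus at most \<open>c\<close>; by convexity, dividing the vector by
  \<open>c\<close> brings it back below 1.\<close>

lemma equivalent_luxemburg_finite_change: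
  assumes q: "\<And>n. 1 \<le> q n" "\<And>n. q n \<le> q' n" and fin: "finite {n. q n \<noteq> q' n}"
  shows "equivalent_norm_on (nakano_heart q) (luxemburg q) (luxemburg q')"
proof -
  interpret Q: nakano_exponents q by unfold_locales (rule q)
  interpret Q': nakano_exponents q' by unfold_locales (rule order_trans[OF q])
  have H: "nakano_heart q' = nakano_heart q" by (rule heart_finite_change[OF fin, symmetric])
  define F where "F = {n. q n \<noteq> q' n}"
  define c where "c = real (card F) + 1"
  have c: "c \<ge> 1" by (simp add: c_def)
  have "(1 / c) * luxemburg q x \<le> luxemburg q' x \<and> luxemburg q' x \<le> 1 * luxemburg q x"
    if x: "x \<in> nakano_heart q" for x
  proof (cases "x = 0")
    case True
    then show ?thesis using Q.luxemburg_0 Q'.luxemburg_0 by simp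
  next
    case False
    then have pos: "luxemburg q x > 0" "luxemburg q' x > 0"
      using Q.norm_eq_0[OF x] Q.norm_nonneg[OF x] Q'.norm_eq_0[of x] Q'.norm_nonneg[of x] x
      by (auto simp: H less_le)
    define y where "y = (1 / luxemburg q x) *\<^sub>R x"
    have y: "y \<in> nakano_heart q" "\<bar>y n\<bar> \<le> 1" for n
      using Q.abs_coordinate_le[OF x, of n] x pos by (auto simp: y_def field_simps)
    have "modular q' y \<le> modular q y"
      unfolding modular_def
    proof (intro suminf_le heart_summable)
      show "\<bar>y n\<bar> powr q' n \<le> \<bar>y n\<bar> powr q n" for n
        using q(2)[of n] y(2)[of n] by (intro powr_mono') auto
    qed (use y H in auto)
    also have "\<dots> \<le> 1" unfolding y_def by (rule Q.modular_le_1[OF x order_refl pos(1)])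
    finally have 1: "luxemburg q' x \<le> luxemburg q x"
      using x pos unfolding y_def by (intro Q'.luxemburg_le) (auto simp: H)
    define z where "z = (1 / luxemburg q' x) *\<^sub>R x"
    have z: "z \<in> nakano_heart q" "\<bar>z n\<bar> \<le> 1" for n
      using Q'.abs_coordinate_le[of x n] x pos by (auto simp: z_def H field_simps)
    have ind: "(\<lambda>n. indicat_real F n) sums real (card F)"
      using sums_If_finite_set[of F "\<lambda>n. 1 :: real"] fin by (simp add: F_def indicator_def of_bool_def)
    have "modular q z \<le> (\<Sum>n. \<bar>z n\<bar> powr q' n + indicat_real F n)"
      unfolding modular_def
    proof (intro suminf_le summable_add heart_summable)
      show "\<bar>z n\<bar> powr q n \<le> \<bar>z n\<bar> powr q' n + indicat_real F n" for n
        using powr_mono2[of "q n" "\<bar>z n\<bar>" 1] q(1)[of n] z(2)[of n]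
        by (auto simp: F_def indicator_def intro: add_increasing)
      show "summable (indicat_real F)" using ind by (rule sums_summable)
    qed (use z H in auto)
    also have "\<dots> = modular q' z + real (card F)"
      using suminf_add[OF heart_summable[of z q'] sums_summable[OF ind]] z H sums_unique[OF ind]
      by (simp add: modular_def)
    also have "modular q' z \<le> 1"
      unfolding z_def by (rule Q'.modular_le_1[OF _ order_refl pos(2)]) (simp add: x H)
    finally have "(1 / c) * modular q z \<le> 1" using c by (simp add: c_def field_simps)
    moreover have "modular q ((1 / c) *\<^sub>R z) \<le> (1 / c) * modular q z"
      using c by (intro Q.modular_scale_le z(1)) auto
    ultimately have "modular q ((1 / c) *\<^sub>R z) \<le> 1" by (rule order_trans[rotated])
    moreover have "(1 / c) *\<^sub>R z = (1 / (c * luxemburg q' x)) *\<^sub>R x" by (simp add: z_def)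
    ultimately have "luxemburg q x \<le> c * luxemburg q' x"
      using x pos c by (intro Q.luxemburg_le) auto
    then show ?thesis using 1 c by (simp add: field_simps)
  qed
  moreover have "normed_on (nakano_heart q) (luxemburg q')"
    using Q'.normed_heart by (simp add: H)
  moreover have "1 / c > 0" using c by simp
  ultimately show ?thesis
    unfolding equivalent_norm_on_def using zero_less_one by blast
qed

section \<open>Bump functions\<close>

text \<open>Second-order expansion of the reciprocal at \<open>\<beta>\<close>. The linear terms
  enter only through \<open>u + v\<close>; the quadratic ones are \<open>O(t\<^sup>2)\<close>, hence
  \<open>O(t powr s)\<close> because \<open>s \<le> 2\<close> and \<open>t \<le> 1\<close>. Thus
  \<open>1 / b\<close> inherits the bound on second differences from \<open>b\<close>.\<close>

lemma sum_inverse_perturbed_le: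
  fixes \<beta> u v t K s :: real
  assumes \<beta>: "\<beta> > 0" and uv: "\<bar>u\<bar> \<le> K * t" "\<bar>v\<bar> \<le> K * t" "K * t \<le> \<beta> / 2"
    and sum: "\<bar>u + v\<bar> \<le> K * t powr s" and t: "0 < t" "t \<le> 1" and s: "s \<le> 2"
  shows "1 / (\<beta> + u) + 1 / (\<beta> + v) - 2 / \<beta> \<le> (K / \<beta>\<^sup>2 + 4 * K\<^sup>2 / \<beta> ^ 3) * t powr s"
proof -
  define X where "X = K\<^sup>2 * t powr s / \<beta> ^ 3"
  have one: "1 / (\<beta> + w) \<le> 1 / \<beta> - w / \<beta>\<^sup>2 + 2 * X" if w: "\<bar>w\<bar> \<le> K * t" for w
  proof -
    have bw: "\<beta> + w \<ge> \<beta> / 2" using w uv(3) by linarith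
    then have bw0: "\<beta> + w > 0" using \<beta> by linarith
    have "1 / (\<beta> + w) = 1 / \<beta> - w / \<beta>\<^sup>2 + w\<^sup>2 / (\<beta>\<^sup>2 * (\<beta> + w))"
      using \<beta> bw0 by (simp add: divide_simps) (simp add: power2_eq_square algebra_simps)
    also have "w\<^sup>2 / (\<beta>\<^sup>2 * (\<beta> + w)) \<le> w\<^sup>2 / (\<beta>\<^sup>2 * (\<beta> / 2))"
      using bw bw0 \<beta> by (intro divide_left_mono mult_left_mono mult_pos_pos) auto
    also have "\<dots> = 2 * w\<^sup>2 / \<beta> ^ 3"
      using \<beta> by (simp add: power2_eq_square power3_eq_cube)
    also have "\<dots> \<le> 2 * (K\<^sup>2 * t powr s) / \<beta> ^ 3"
    proof -
      have "w\<^sup>2 \<le> (K * t)\<^sup>2"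
        using power_mono[of "\<bar>w\<bar>" "K * t" 2] w by simp
      also have "\<dots> = K\<^sup>2 * t powr 2" using t by (simp add: power_mult_distrib)
      also have "\<dots> \<le> K\<^sup>2 * t powr s"
        using t s by (intro mult_left_mono powr_mono') auto
      finally show ?thesis using \<beta> by (intro divide_right_mono) auto
    qed
    finally show ?thesis by (simp add: X_def)
  qed
  have "- (u + v) \<le> K * t powr s" using sum by linarith
  from divide_right_mono[OF this zero_le_power2[of \<beta>]]
  have "- (u / \<beta>\<^sup>2) - v / \<beta>\<^sup>2 \<le> K * t powr s / \<beta>\<^sup>2"
    by (simp add: add_divide_distrib diff_divide_distrib)
  then have "1 / (\<beta> + u) + 1 / (\<beta> + v) - 2 * (1 / \<beta>) \<le> K * t powr s / \<beta>\<^sup>2 + 4 * X"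
    using one[OF uv(1)] one[OF uv(2)] by linarith
  then show ?thesis by (simp add: distrib_right X_def)
qed

text \<open>
  The distance in which each coordinate is measured along the path through \<open>0\<close>. In it, the modular
  is Lipschitz, and moving \<open>x\<close> by \<open>t\<close> in a coordinate with \<open>x n\<close> almost \<open>0\<close> costs
  only about \<open>t powr q n\<close>, no more than the modular gains.
\<close>

definition detour_term :: "real \<Rightarrow> real \<Rightarrow> real \<Rightarrow> real" where
  "detour_term p a b = (if a = b then 0 else \<bar>a\<bar> powr p + \<bar>b\<bar> powr p)"

definition detour_dist :: "(nat \<Rightarrow> real) \<Rightarrow> (nat \<Rightarrow> real) \<Rightarrow> (nat \<Rightarrow> real) \<Rightarrow> real" where
  "detour_dist q x y = (\<Sum>n. detour_term (q n) (x n) (y n))"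

section \<open>The detour distance for bounded exponents\<close>

locale nakano_exponents_bounded = nakano_exponents +
  fixes B :: real
  assumes exponent_le: "q n \<le> B"
begin

abbreviation "\<Delta> \<equiv> detour_dist q"

lemma detour_summable:
  assumes "x \<in> H" "y \<in> H"
  shows "summable (\<lambda>n. detour_term (q n) (x n) (y n))"
  by (rule summable_comparison_test'[where N = 0,
        OF summable_add[OF heart_summable[OF assms(1)] heart_summable[OF assms(2)]]])
    (auto simp: detour_term_def)

lemma detour_nonneg: "x \<in> H \<Longrightarrow> y \<in> H \<Longrightarrow> 0 \<le> \<Delta> x y"
  unfolding detour_dist_def by (intro suminf_nonneg detour_summable) (auto simp: detour_term_def)

lemma detour_refl: "\<Delta> x x = 0"
  by (simp add: detour_dist_def detour_term_def)

lemma detour_commute: "\<Delta> x y = \<Delta> y x"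
  unfolding detour_dist_def detour_term_def by (intro suminf_cong) auto

lemma detour_triangle:
  assumes "x \<in> H" "y \<in> H" "z \<in> H"
  shows "\<Delta> x z \<le> \<Delta> x y + \<Delta> y z"
proof -
  have "\<Delta> x z \<le> (\<Sum>n. detour_term (q n) (x n) (y n) + detour_term (q n) (y n) (z n))"
    unfolding detour_dist_def
    by (intro suminf_le summable_add detour_summable assms) (auto simp: detour_term_def)
  also have "\<dots> = \<Delta> x y + \<Delta> y z"
    unfolding detour_dist_def by (intro suminf_add[symmetric] detour_summable assms)
  finally show ?thesis .
qed

lemma abs_modular_diff_le_detour:
  assumes "x \<in> H" "y \<in> H"
  shows "\<bar>modular q x - modular q y\<bar> \<le> \<Delta> x y"
proof -
  have one: "modular q x - modular q y \<le> \<Delta> x y" if "x \<in> H" "y \<in> H" for x y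
  proof -
    have "modular q x \<le> (\<Sum>n. \<bar>y n\<bar> powr q n + detour_term (q n) (x n) (y n))"
      unfolding modular_def
      by (intro suminf_le summable_add detour_summable heart_summable that) (auto simp: detour_term_def)
    also have "\<dots> = modular q y + \<Delta> x y"
      unfolding detour_dist_def modular_def
      by (intro suminf_add[symmetric] detour_summable heart_summable that)
    finally show ?thesis by simp
  qed
  show ?thesis using one[OF assms] one[OF assms(2,1)] detour_commute[of x y] by (simp add: abs_le_iff)
qed

text \<open>This is what makes detour-Cauchy sequences norm-Cauchy.\<close>

lemma modular_diff_le_detour:
  assumes "x \<in> H" "y \<in> H"
  shows "modular q (x - y) \<le> 2 powr B * \<Delta> x y"
proof -
  have "modular q (x - y) \<le> (\<Sum>n. 2 powr B * detour_term (q n) (x n) (y n))"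
    unfolding modular_def
  proof (intro suminf_le summable_mult detour_summable heart_summable heart_diff assms)
    fix n
    have two: "\<bar>2 * a\<bar> powr q n \<le> 2 powr B * \<bar>a\<bar> powr q n" for a :: real
      using exponent_le[of n] by (simp add: abs_mult powr_mult mult_right_mono powr_mono)
    have "\<bar>x n - y n\<bar> powr q n \<le> \<bar>2 * x n\<bar> powr q n / 2 + \<bar>2 * y n\<bar> powr q n / 2"
      using abs_powr_add_le[OF exponent_ge_1[of n], of "x n" "- y n"] by simp
    also have "\<dots> \<le> \<bar>2 * x n\<bar> powr q n + \<bar>2 * y n\<bar> powr q n"
      by (intro add_mono) auto
    also have "\<dots> \<le> 2 powr B * (\<bar>x n\<bar> powr q n + \<bar>y n\<bar> powr q n)"
      using two[of "x n"] two[of "y n"] by (simp only: distrib_left)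
    finally show "\<bar>(x - y) n\<bar> powr q n \<le> 2 powr B * detour_term (q n) (x n) (y n)"
      by (auto simp: detour_term_def)
  qed
  also have "\<dots> = 2 powr B * \<Delta> x y"
    unfolding detour_dist_def by (intro suminf_mult detour_summable assms)
  finally show ?thesis .
qed

lemma luxemburg_le_if_modular_le:
  assumes x: "x \<in> H" and r: "0 < r" "r \<le> 1" and le: "modular q x \<le> r powr B"
  shows "N x \<le> r"
proof (rule luxemburg_le[OF x r(1)])
  have "modular q ((1 / r) *\<^sub>R x) \<le> (\<Sum>n. (1 / r) powr B * \<bar>x n\<bar> powr q n)"
    unfolding modular_def
  proof (intro suminf_le summable_mult heart_summable heart_scale x)
    fix n
    have "\<bar>((1 / r) *\<^sub>R x) n\<bar> = (1 / r) * \<bar>x n\<bar>" using r by (simp add: abs_mult)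
    then have "\<bar>((1 / r) *\<^sub>R x) n\<bar> powr q n = (1 / r) powr q n * \<bar>x n\<bar> powr q n"
      by (simp only: powr_mult)
    also have "\<dots> \<le> (1 / r) powr B * \<bar>x n\<bar> powr q n"
      using r exponent_le[of n] by (intro mult_right_mono powr_mono) auto
    finally show "\<bar>((1 / r) *\<^sub>R x) n\<bar> powr q n \<le> (1 / r) powr B * \<bar>x n\<bar> powr q n" .
  qed
  also have "\<dots> = (1 / r) powr B * modular q x"
    unfolding modular_def by (intro suminf_mult heart_summable x)
  also have "\<dots> \<le> (1 / r) powr B * r powr B" using le by (intro mult_left_mono) auto
  also have "\<dots> = 1" using r by (simp flip: powr_mult)
  finally show "modular q ((1 / r) *\<^sub>R x) \<le> 1" .
qed

lemma modular_le_if_luxemburg_le: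
  assumes x: "x \<in> H" and R: "N x \<le> R" "R \<ge> 1"
  shows "modular q x \<le> R powr B"
proof -
  have "modular q x \<le> (\<Sum>n. R powr B * \<bar>((1 / R) *\<^sub>R x) n\<bar> powr q n)"
    unfolding modular_def
  proof (intro suminf_le summable_mult heart_summable heart_scale x)
    fix n
    have "\<bar>x n\<bar> = R * \<bar>((1 / R) *\<^sub>R x) n\<bar>" using R by (simp add: abs_mult)
    then have "\<bar>x n\<bar> powr q n = R powr q n * \<bar>((1 / R) *\<^sub>R x) n\<bar> powr q n"
      by (metis powr_mult)
    also have "\<dots> \<le> R powr B * \<bar>((1 / R) *\<^sub>R x) n\<bar> powr q n"
      using R exponent_le[of n] by (intro mult_right_mono powr_mono) auto
    finally show "\<bar>x n\<bar> powr q n \<le> R powr B * \<bar>((1 / R) *\<^sub>R x) n\<bar> powr q n" .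
  qed
  also have "\<dots> = R powr B * modular q ((1 / R) *\<^sub>R x)"
    unfolding modular_def by (intro suminf_mult heart_summable heart_scale x)
  also have "\<dots> \<le> R powr B * 1"
    using R by (intro mult_left_mono modular_le_1[OF x]) auto
  finally show ?thesis by simp
qed

text \<open>Norm completeness provides the candidate limit. Both kinds of convergence are recorded
  because the modular is Lipschitz for the detour distance while \<open>b\<close> is continuous for
  the norm.\<close>

lemma detour_complete:
  assumes \<sigma>: "\<And>k::nat. \<sigma> k \<in> H"
    and cau: "\<And>e. e > 0 \<Longrightarrow> \<exists>k0. \<forall>j\<ge>k0. \<forall>k\<ge>k0. \<Delta> (\<sigma> j) (\<sigma> k) < e"
  shows "\<exists>l\<in>H. (\<lambda>k. \<Delta> (\<sigma> k) l) \<longlonglongrightarrow> 0 \<and> (\<lambda>k. N (\<sigma> k - l)) \<longlonglongrightarrow> 0"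
proof -
  have "\<exists>k0. \<forall>j\<ge>k0. \<forall>k\<ge>k0. N (\<sigma> j - \<sigma> k) < e" if e: "e > 0" for e
  proof -
    define r where "r = min 1 (e / 2)"
    have r: "0 < r" "r \<le> 1" "r < e" using e by (auto simp: r_def)
    then have "(r / 2) powr B > 0" by simp
    then obtain k0 where k0: "\<forall>j\<ge>k0. \<forall>k\<ge>k0. \<Delta> (\<sigma> j) (\<sigma> k) < (r / 2) powr B"
      using cau by blast
    have "N (\<sigma> j - \<sigma> k) < e" if "j \<ge> k0" "k \<ge> k0" for j k
    proof -
      have "modular q (\<sigma> j - \<sigma> k) \<le> 2 powr B * \<Delta> (\<sigma> j) (\<sigma> k)"
        by (rule modular_diff_le_detour[OF \<sigma> \<sigma>])
      also have "\<dots> \<le> 2 powr B * (r / 2) powr B"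
        using k0 that by (intro mult_left_mono) (auto intro: less_imp_le)
      also have "\<dots> = r powr B" by (simp flip: powr_mult)
      finally have "N (\<sigma> j - \<sigma> k) \<le> r"
        using \<sigma> r by (intro luxemburg_le_if_modular_le) auto
      then show ?thesis using r by simp
    qed
    then show ?thesis by blast
  qed
  then obtain l where l: "l \<in> H" "(\<lambda>k. N (\<sigma> k - l)) \<longlonglongrightarrow> 0"
    using complete_sequence[of \<sigma>] banach_heart \<sigma> unfolding banach_on_def by blast
  have coord: "(\<lambda>k. \<sigma> k n) \<longlonglongrightarrow> l n" for n
  proof -
    have "(\<lambda>k. \<sigma> k n - l n) \<longlonglongrightarrow> 0"
      by (rule Lim_null_comparison[OF _ l(2)]) (use abs_coordinate_le[OF heart_diff[OF \<sigma> l(1)]] in auto)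
    then show ?thesis by (simp add: LIM_zero_iff)
  qed
  have "(\<lambda>k. \<Delta> (\<sigma> k) l) \<longlonglongrightarrow> 0"
  proof (rule LIMSEQ_I)
    fix e :: real assume "e > 0"
    then obtain k0 where k0: "\<forall>j\<ge>k0. \<forall>k\<ge>k0. \<Delta> (\<sigma> j) (\<sigma> k) < e / 2"
      using cau[of "e / 2"] by auto
    have "\<Delta> (\<sigma> k) l \<le> e / 2" if k: "k \<ge> k0" for k
      unfolding detour_dist_def
    proof (rule suminf_le_const[OF detour_summable[OF \<sigma> l(1)]])
      fix m
      \<comment> \<open>\<open>detour_term\<close> jumps at the diagonal, but downwards only.
        Coordinates with \<open>\<sigma> k n = l n\<close> contribute nothing to the limit and are
        dropped; in the others \<open>\<sigma> j n\<close> eventually differs from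
        \<open>\<sigma> k n\<close>, so the term converges.\<close>
      let ?u = "\<lambda>j. \<Sum>n<m. if \<sigma> k n = l n then 0 else \<bar>\<sigma> k n\<bar> powr q n + \<bar>\<sigma> j n\<bar> powr q n"
      have lim: "?u \<longlonglongrightarrow> (\<Sum>n<m. if \<sigma> k n = l n then 0 else \<bar>\<sigma> k n\<bar> powr q n + \<bar>l n\<bar> powr q n)"
      proof (rule tendsto_sum)
        fix n
        have "0 < q n" using exponent_ge_1[of n] by simp
        then have "(\<lambda>j. \<bar>\<sigma> j n\<bar> powr q n) \<longlonglongrightarrow> \<bar>l n\<bar> powr q n"
          by (intro tendsto_powr' tendsto_intros coord) auto
        then show "(\<lambda>j. if \<sigma> k n = l n then 0 else \<bar>\<sigma> k n\<bar> powr q n + \<bar>\<sigma> j n\<bar> powr q n)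
            \<longlonglongrightarrow> (if \<sigma> k n = l n then 0 else \<bar>\<sigma> k n\<bar> powr q n + \<bar>l n\<bar> powr q n)"
          by (cases "\<sigma> k n = l n") (auto intro: tendsto_add)
      qed
      have "\<forall>\<^sub>F j in sequentially. \<sigma> k n \<noteq> l n \<longrightarrow> \<sigma> j n \<noteq> \<sigma> k n" for n
        using tendsto_imp_eventually_ne[OF coord[of n], of "\<sigma> k n"]
        by (cases "\<sigma> k n = l n") auto
      then have "\<forall>\<^sub>F j in sequentially. \<forall>n\<in>{..<m}. \<sigma> k n \<noteq> l n \<longrightarrow> \<sigma> j n \<noteq> \<sigma> k n"
        by (intro eventually_ball_finite) auto
      then have "\<forall>\<^sub>F j in sequentially. ?u j \<le> e / 2"
        using eventually_ge_at_top[of k0]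
      proof eventually_elim
        case (elim j)
        have "?u j \<le> (\<Sum>n<m. detour_term (q n) (\<sigma> k n) (\<sigma> j n))"
          using elim(1) by (intro sum_mono) (auto simp: detour_term_def)
        also have "\<dots> \<le> \<Delta> (\<sigma> k) (\<sigma> j)"
          unfolding detour_dist_def
          by (intro sum_le_suminf detour_summable \<sigma>) (auto simp: detour_term_def)
        also have "\<dots> \<le> e / 2" using k0 k elim(2) by (auto intro: less_imp_le)
        finally show ?case .
      qed
      then show "(\<Sum>n<m. detour_term (q n) (\<sigma> k n) (l n)) \<le> e / 2"
        unfolding detour_term_def by (intro tendsto_upperbound[OF lim]) auto
    qed
    then have "norm (\<Delta> (\<sigma> k) l - 0) < e" if "k \<ge> k0" for k
      using that detour_nonneg[OF \<sigma> l(1)] \<open>e > 0\<close> by fastforce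
    then show "\<exists>k0. \<forall>k\<ge>k0. norm (\<Delta> (\<sigma> k) l - 0) < e" by blast
  qed
  then show ?thesis using l by blast
qed

lemma single_coordinate:
  fixes m :: nat
  assumes x: "x \<in> H" and t: "t \<noteq> 0"
  defines "h \<equiv> (\<lambda>n. if n = m then t else 0)"
  shows "h \<in> H" "N h \<le> \<bar>t\<bar>"
    "modular q (x + h) = modular q x + \<bar>x m + t\<bar> powr q m - \<bar>x m\<bar> powr q m"
    "\<Delta> x (x + h) = \<bar>x m\<bar> powr q m + \<bar>x m + t\<bar> powr q m"
proof -
  have single: "(\<lambda>n. \<bar>c * h n\<bar> powr q n) sums \<bar>c * t\<bar> powr q m" for c
  proof -
    have "(\<lambda>n. if n = m then \<bar>c * t\<bar> powr q n else 0) sums \<bar>c * t\<bar> powr q m"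
      by (rule sums_single)
    moreover have "(\<lambda>n. if n = m then \<bar>c * t\<bar> powr q n else 0) = (\<lambda>n. \<bar>c * h n\<bar> powr q n)"
      by (auto simp: h_def fun_eq_iff)
    ultimately show ?thesis by simp
  qed
  show h: "h \<in> H" using single sums_summable by (auto simp: nakano_heart_def)
  have "modular q ((1 / \<bar>t\<bar>) *\<^sub>R h) = \<bar>(1 / \<bar>t\<bar>) * t\<bar> powr q m"
    using single[of "1 / \<bar>t\<bar>"] by (simp only: modular_def sums_iff scaleR_fun_apply real_scaleR_def)
  then show "N h \<le> \<bar>t\<bar>" using t h by (intro luxemburg_le) (auto simp: abs_mult)
  have "(\<lambda>n. \<bar>(x + h) n\<bar> powr q n - \<bar>x n\<bar> powr q n) sums (modular q (x + h) - modular q x)"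
    unfolding modular_def by (intro sums_diff summable_sums heart_summable heart_add x h)
  moreover have "(\<lambda>n. \<bar>(x + h) n\<bar> powr q n - \<bar>x n\<bar> powr q n)
      = (\<lambda>n. if n = m then \<bar>x n + t\<bar> powr q n - \<bar>x n\<bar> powr q n else 0)"
    by (auto simp: h_def fun_eq_iff)
  ultimately have "(\<lambda>n. if n = m then \<bar>x n + t\<bar> powr q n - \<bar>x n\<bar> powr q n else 0)
      sums (modular q (x + h) - modular q x)" by (simp only:)
  from sums_unique2[OF this sums_single]
  show "modular q (x + h) = modular q x + \<bar>x m + t\<bar> powr q m - \<bar>x m\<bar> powr q m" by simp
  have "(\<lambda>n. detour_term (q n) (x n) ((x + h) n))
      = (\<lambda>n. if n = m then \<bar>x n\<bar> powr q n + \<bar>x n + t\<bar> powr q n else 0)"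
    using t by (auto simp: h_def fun_eq_iff detour_term_def)
  then show "\<Delta> x (x + h) = \<bar>x m\<bar> powr q m + \<bar>x m + t\<bar> powr q m"
    unfolding detour_dist_def
    using sums_single[of m "\<lambda>n. \<bar>x n\<bar> powr q n + \<bar>x n + t\<bar> powr q n"] by (simp add: sums_iff)
qed


text \<open>Extracts what the variational argument needs from smoothness. The functional cancels
  between \<open>h\<close> and \<open>- h\<close>, so the second difference keeps the order
  \<open>s\<close>.\<close>

lemma local_bounds:
  assumes D: "bounded_functional_on H N D" and d: "d > 0"
    and est: "\<And>h. h \<in> H \<Longrightarrow> N h < d \<Longrightarrow> \<bar>b (x + h) - b x - D h\<bar> \<le> C * N h powr s" and s: "s \<ge> 1"
  obtains K \<delta> where "K \<ge> 0" "\<delta> > 0" "\<delta> \<le> 1"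
    "\<And>h. h \<in> H \<Longrightarrow> N h < \<delta> \<Longrightarrow> \<bar>b (x + h) - b x\<bar> \<le> K * N h"
    "\<And>h. h \<in> H \<Longrightarrow> N h < \<delta> \<Longrightarrow> \<bar>b (x + h) + b (x - h) - 2 * b x\<bar> \<le> K * N h powr s"
proof -
  obtain k where k: "\<And>h. h \<in> H \<Longrightarrow> \<bar>D h\<bar> \<le> k * N h"
    using D unfolding bounded_functional_on_def by blast
  define K where "K = \<bar>k\<bar> + 2 * \<bar>C\<bar>"
  have est': "\<bar>b (x + h) - b x - D h\<bar> \<le> \<bar>C\<bar> * N h powr s" if "h \<in> H" "N h < d" for h
    using est[OF that] mult_right_mono[OF abs_ge_self[of C] powr_ge_zero[of "N h" s]] by linarith
  have "\<bar>b (x + h) - b x\<bar> \<le> K * N h" if h: "h \<in> H" "N h < min d 1" for h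
  proof -
    have "N h powr s \<le> N h powr 1" using h s by (intro powr_mono') auto
    then have "\<bar>C\<bar> * N h powr s \<le> \<bar>C\<bar> * N h" using h by (intro mult_left_mono) auto
    moreover have "k * N h \<le> \<bar>k\<bar> * N h" using h by (intro mult_right_mono) auto
    moreover have "0 \<le> \<bar>C\<bar> * N h" using h by simp
    ultimately show ?thesis
      using est'[of h] k[of h] h unfolding K_def distrib_right by linarith
  qed
  moreover have "\<bar>b (x + h) + b (x - h) - 2 * b x\<bar> \<le> K * N h powr s" if h: "h \<in> H" "N h < min d 1" for h
  proof -
    have "D (- h) = - D h"
      using D h(1) unfolding bounded_functional_on_def by (metis mult_minus1 scaleR_minus1_left)
    then have "\<bar>b (x - h) - b x + D h\<bar> \<le> \<bar>C\<bar> * N h powr s"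
      using est'[of "- h"] h by simp
    moreover have "0 \<le> \<bar>k\<bar> * N h powr s" by simp
    moreover have "\<bar>b (x + h) - b x - D h\<bar> \<le> \<bar>C\<bar> * N h powr s" using est'[of h] h by simp
    ultimately show ?thesis unfolding K_def distrib_right by linarith
  qed
  moreover have "K \<ge> 0" "min d 1 > 0" "min d 1 \<le> 1" using d by (auto simp: K_def)
  ultimately show thesis by (intro that[of K "min d 1"])
qed

text \<open>
  At an Ekeland point \<open>x\<close> of \<open>1 / b - \<kappa> * modular q\<close>, the smoothness of \<open>1 / b\<close> bounds the second difference
  by \<open>O(t powr s)\<close>, while the second difference of the modular in a coordinate with exponent
  below \<open>r < s\<close> is at least of order \<open>t powr r\<close>.
\<close>

lemma no_smooth_bump_at_0:
  assumes freq: "\<exists>\<^sub>F n in sequentially. q n < r" and r: "r < s" and s: "1 \<le> s" "s \<le> 2"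
    and b0: "b 0 > 0" and supp: "\<And>x. x \<in> H \<Longrightarrow> b x \<noteq> 0 \<Longrightarrow> N x \<le> R"
    and smooth: "\<And>x. x \<in> H \<Longrightarrow> \<exists>D C d. bounded_functional_on H N D \<and> d > 0 \<and>
      (\<forall>h\<in>H. N h < d \<longrightarrow> \<bar>b (x + h) - b x - D h\<bar> \<le> C * N h powr s)"
  shows False
proof -
  have loc: "\<exists>K \<delta>. K \<ge> 0 \<and> \<delta> > 0 \<and> \<delta> \<le> 1 \<and>
    (\<forall>h\<in>H. N h < \<delta> \<longrightarrow> \<bar>b (x + h) - b x\<bar> \<le> K * N h) \<and>
    (\<forall>h\<in>H. N h < \<delta> \<longrightarrow> \<bar>b (x + h) + b (x - h) - 2 * b x\<bar> \<le> K * N h powr s)" if x: "x \<in> H" for x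
  proof -
    obtain D C d where "bounded_functional_on H N D" "d > 0"
      "\<And>h. h \<in> H \<Longrightarrow> N h < d \<Longrightarrow> \<bar>b (x + h) - b x - D h\<bar> \<le> C * N h powr s"
      using smooth[OF x] by blast
    from local_bounds[OF this s(1)] show ?thesis by metis
  qed
  have cont: "(\<lambda>k. b (\<sigma> k)) \<longlonglongrightarrow> b l"
    if \<sigma>: "\<And>k. \<sigma> k \<in> H" and l: "l \<in> H" "(\<lambda>k. N (\<sigma> k - l)) \<longlonglongrightarrow> 0" for \<sigma> l
  proof -
    obtain K \<delta> where K: "\<delta> > 0" "\<And>h. h \<in> H \<Longrightarrow> N h < \<delta> \<Longrightarrow> \<bar>b (l + h) - b l\<bar> \<le> K * N h"
      using loc[OF l(1)] by blast
    have "\<forall>\<^sub>F k in sequentially. N (\<sigma> k - l) < \<delta>" using order_tendstoD(2)[OF l(2) K(1)] .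
    then have "\<forall>\<^sub>F k in sequentially. norm (b (\<sigma> k) - b l) \<le> K * N (\<sigma> k - l)"
    proof eventually_elim
      case (elim k)
      then show ?case using K(2)[of "\<sigma> k - l"] \<sigma> l by simp
    qed
    then have "(\<lambda>k. b (\<sigma> k) - b l) \<longlonglongrightarrow> 0"
      by (rule Lim_null_comparison) (rule tendsto_mult_right_zero[OF l(2)])
    then show ?thesis by (simp add: LIM_zero_iff)
  qed
  define P where "P = max 1 R powr B"
  have P: "P > 0" by (simp add: P_def)
  \<comment> \<open>\<open>P\<close> bounds the modular on the support of \<open>b\<close>, so the
    weighted modular never exceeds half of \<open>1 / b 0\<close>.\<close>
  define \<kappa> where "\<kappa> = 1 / (2 * b 0 * P)"
  have \<kappa>: "\<kappa> > 0" using b0 P by (simp add: \<kappa>_def)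
  \<comment> \<open>\<open>1 / b\<close> is bounded and continuous here. The threshold lies strictly
    below the value \<open>2 / 3 * b 0\<close> that the choice of \<open>\<kappa>\<close> guarantees
    at the Ekeland point; the gap \<open>b 0 / 6\<close> leaves room for steps in all
    directions.\<close>
  define A where "A = {x \<in> H. b 0 / 2 \<le> b x}"
  have AH: "x \<in> H" if "x \<in> A" for x using that by (simp add: A_def)
  have Apos: "b x > 0" if "x \<in> A" for x using that b0 by (simp add: A_def)
  have \<kappa>P: "\<kappa> * modular q x \<le> 1 / (2 * b 0)" if "x \<in> A" for x
  proof -
    have "modular q x \<le> P"
      unfolding P_def using supp[OF AH[OF that]] Apos[OF that]
      by (intro modular_le_if_luxemburg_le AH[OF that]) auto
    then have "\<kappa> * modular q x \<le> \<kappa> * P" using \<kappa> by simp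
    then show ?thesis using P by (simp add: \<kappa>_def)
  qed
  define g where "g x = 1 / b x - \<kappa> * modular q x" for x
  \<comment> \<open>The Ekeland constant is half the weight of the modular, so a step from an almost
    vanishing coordinate keeps half of its gain.\<close>
  have "\<exists>x\<in>A. g x \<le> g 0 \<and> (\<forall>y\<in>A. g x - \<kappa> / 2 * \<Delta> x y \<le> g y)"
  proof (rule ekeland_variational_principle[where B = "- (1 / (2 * b 0))"])
    show "0 \<le> \<Delta> x y" if "x \<in> A" "y \<in> A" for x y using that AH detour_nonneg by blast
    show "\<Delta> x z \<le> \<Delta> x y + \<Delta> y z" if "x \<in> A" "y \<in> A" "z \<in> A" for x y z
      using that AH detour_triangle by blast
    show "- (1 / (2 * b 0)) \<le> g x" if "x \<in> A" for x
    proof -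
      have "0 \<le> 1 / b x" using Apos[OF that] by simp
      then show ?thesis using \<kappa>P[OF that] unfolding g_def by linarith
    qed
    fix \<sigma> :: "nat \<Rightarrow> nat \<Rightarrow> real"
    assume \<sigma>A: "\<And>k. \<sigma> k \<in> A"
      and cau: "\<And>e. e > 0 \<Longrightarrow> \<exists>k0. \<forall>j\<ge>k0. \<forall>k\<ge>k0. \<Delta> (\<sigma> j) (\<sigma> k) < e"
    have \<sigma>: "\<sigma> k \<in> H" for k using \<sigma>A AH by blast
    obtain l where l: "l \<in> H" "(\<lambda>k. \<Delta> (\<sigma> k) l) \<longlonglongrightarrow> 0" "(\<lambda>k. N (\<sigma> k - l)) \<longlonglongrightarrow> 0"
      using detour_complete[OF \<sigma> cau] by blast
    have bl: "(\<lambda>k. b (\<sigma> k)) \<longlonglongrightarrow> b l" by (rule cont[OF \<sigma> l(1,3)])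
    then have "b 0 / 2 \<le> b l"
      using \<sigma>A by (intro LIMSEQ_le_const) (auto simp: A_def)
    then have lA: "l \<in> A" using l by (simp add: A_def)
    have "(\<lambda>k. modular q (\<sigma> k) - modular q l) \<longlonglongrightarrow> 0"
      by (rule Lim_null_comparison[OF _ l(2)]) (use abs_modular_diff_le_detour[OF \<sigma> l(1)] in simp)
    then have "(\<lambda>k. modular q (\<sigma> k)) \<longlonglongrightarrow> modular q l" by (simp add: LIM_zero_iff)
    then have "(\<lambda>k. g (\<sigma> k)) \<longlonglongrightarrow> g l"
      unfolding g_def using Apos[OF lA] by (intro tendsto_intros bl) auto
    then show "\<exists>l\<in>A. (\<lambda>k. \<Delta> (\<sigma> k) l) \<longlonglongrightarrow> 0 \<and> (\<lambda>k. g (\<sigma> k)) \<longlonglongrightarrow> g l"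
      using lA l by blast
  qed (use b0 \<kappa> detour_refl detour_commute in \<open>auto simp: A_def\<close>)
  then obtain x where x: "x \<in> A" "g x \<le> g 0" "\<And>y. y \<in> A \<Longrightarrow> g x - \<kappa> / 2 * \<Delta> x y \<le> g y"
    by blast
  have xH: "x \<in> H" using AH x by blast
  define \<beta> where "\<beta> = b x"
  have \<beta>: "\<beta> > 0" using Apos x by (simp add: \<beta>_def)
  have "1 / \<beta> \<le> 1 / b 0 + 1 / (2 * b 0)" using x(2) \<kappa>P[OF x(1)] by (simp add: g_def \<beta>_def)
  then have \<beta>_ge: "2 / 3 * b 0 \<le> \<beta>" using b0 \<beta> by (simp add: field_simps)
  obtain K \<delta> where K: "K \<ge> 0" "\<delta> > 0" "\<delta> \<le> 1"
    "\<And>h. h \<in> H \<Longrightarrow> N h < \<delta> \<Longrightarrow> \<bar>b (x + h) - b x\<bar> \<le> K * N h"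
    "\<And>h. h \<in> H \<Longrightarrow> N h < \<delta> \<Longrightarrow> \<bar>b (x + h) + b (x - h) - 2 * b x\<bar> \<le> K * N h powr s"
    using loc[OF xH] by blast
  define M where "M = K / \<beta>\<^sup>2 + 4 * K\<^sup>2 / \<beta> ^ 3"
  have M: "M \<ge> 0" using K(1) \<beta> by (simp add: M_def)
  have key: "\<kappa> / 2 * t powr r \<le> M * t powr s" if t: "0 < t" "t < \<delta>" "K * t \<le> b 0 / 6" for t
  proof -
    have "\<forall>\<^sub>F n in sequentially. \<bar>x n\<bar> powr q n < t powr r / 6"
      using summable_LIMSEQ_zero[OF heart_summable[OF xH]] t by (intro order_tendstoD(2)) auto
    \<comment> \<open>\<open>m\<close> depends on \<open>t\<close>. The sixth makes the error
      \<open>3 * \<kappa> * \<bar>x m\<bar> powr q m\<close> below at most half of the gain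
      \<open>\<kappa> * t powr r\<close>.\<close>
    then obtain m where m: "q m < r" "\<bar>x m\<bar> powr q m < t powr r / 6"
      using frequently_ex[OF frequently_eventually_conj[OF freq]] by blast
    define h where "h = (\<lambda>n. if n = m then t else 0)"
    have minus_h: "- h = (\<lambda>n. if n = m then - t else 0)" by (auto simp: h_def fun_eq_iff)
    note plus = single_coordinate[OF xH, of t m, folded h_def]
    note minus = single_coordinate[OF xH, of "- t" m, folded minus_h]
    have h: "h \<in> H" "N h \<le> t" using plus(1,2) t by auto
    have Nh: "N h < \<delta>" "N (- h) < \<delta>" using h t by auto
    have KN: "K * N h \<le> K * t" using h K by (simp add: mult_left_mono)
    define u v where "u = b (x + h) - b x" and "v = b (x - h) - b x"
    have uv: "\<bar>u\<bar> \<le> K * t" "\<bar>v\<bar> \<le> K * t"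
      using K(4)[OF h(1) Nh(1)] K(4)[of "- h"] h Nh KN by (auto simp: u_def v_def)
    have "\<bar>u + v\<bar> \<le> K * N h powr s" using K(5)[OF h(1) Nh(1)] by (simp add: u_def v_def)
    also have "\<dots> \<le> K * t powr s" using h s K by (intro mult_left_mono powr_mono2) auto
    finally have sum: "\<bar>u + v\<bar> \<le> K * t powr s" .
    have yA: "x + h \<in> A" "x - h \<in> A"
      using uv \<beta>_ge t h xH unfolding A_def u_def v_def \<beta>_def[symmetric] by (auto simp: abs_le_iff)
    have rec: "1 / b (x + h) + 1 / b (x - h) - 2 / \<beta> \<le> M * t powr s"
    proof -
      have "K * t \<le> \<beta> / 2" using t(3) \<beta>_ge b0 by linarith
      moreover have "t \<le> 1" using t K(3) by linarith
      ultimately show ?thesis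
        using sum_inverse_perturbed_le[OF \<beta> uv _ sum t(1) _ s(2)] by (simp add: M_def u_def v_def \<beta>_def)
    qed
    define a p where "a = x m" and "p = q m"
    have p: "p \<ge> 1" "p < r" using exponent_ge_1 m by (auto simp: p_def)
    have e1: "g x - \<kappa> / 2 * (\<bar>a\<bar> powr p + \<bar>a + t\<bar> powr p) \<le> g (x + h)"
      using x(3)[OF yA(1)] plus(4) t by (simp add: a_def p_def)
    have e2: "g x - \<kappa> / 2 * (\<bar>a\<bar> powr p + \<bar>a - t\<bar> powr p) \<le> g (x - h)"
      using x(3)[OF yA(2)] minus(4) t by (simp add: a_def p_def)
    have g1: "g (x + h) = 1 / b (x + h) - \<kappa> * (modular q x + \<bar>a + t\<bar> powr p - \<bar>a\<bar> powr p)"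
      using plus(3) t by (simp add: g_def a_def p_def)
    have g2: "g (x - h) = 1 / b (x - h) - \<kappa> * (modular q x + \<bar>a - t\<bar> powr p - \<bar>a\<bar> powr p)"
      using minus(3) t by (simp add: g_def a_def p_def)
    have gx: "g x = 1 / \<beta> - \<kappa> * modular q x" by (simp add: g_def \<beta>_def)
    \<comment> \<open>Sum of the Ekeland inequalities for \<open>h\<close> and \<open>- h\<close>.
      The modular contributes \<open>- 2 * \<bar>a\<bar> powr p\<close> with weight
      \<open>\<kappa>\<close>, the distance one more such power, hence the 3; half of the remaining
      powers is spent on the distance.\<close>
    have "\<kappa> / 2 * (\<bar>a + t\<bar> powr p + \<bar>a - t\<bar> powr p) - 3 * \<kappa> * \<bar>a\<bar> powr p
        \<le> 1 / b (x + h) + 1 / b (x - h) - 2 / \<beta>"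
      using e1 e2 unfolding g1 g2 gx by (simp add: algebra_simps)
    then have "\<kappa> / 2 * (\<bar>a + t\<bar> powr p + \<bar>a - t\<bar> powr p) - 3 * \<kappa> * \<bar>a\<bar> powr p \<le> M * t powr s"
      using rec by linarith
    moreover have "2 * t powr p \<le> \<bar>a + t\<bar> powr p + \<bar>a - t\<bar> powr p"
      using abs_powr_add_le[OF p(1), of "(a + t) / 2" "(t - a) / 2"] t
      by (simp add: abs_minus_commute add_divide_distrib diff_divide_distrib)
    then have "\<kappa> / 2 * (2 * t powr p) \<le> \<kappa> / 2 * (\<bar>a + t\<bar> powr p + \<bar>a - t\<bar> powr p)"
      using \<kappa> by (intro mult_left_mono) auto
    moreover have "\<kappa> * t powr r \<le> \<kappa> * t powr p"
      using t K(3) p \<kappa> by (intro mult_left_mono powr_mono') auto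
    moreover have "\<kappa> * \<bar>a\<bar> powr p \<le> \<kappa> * (t powr r / 6)"
      using m \<kappa> by (intro mult_left_mono) (auto simp: a_def p_def)
    ultimately show ?thesis by simp
  qed
  have "((\<lambda>t. M * t powr (s - r)) \<longlongrightarrow> M * 0 powr (s - r)) (at_right 0)"
    using r by (intro tendsto_intros tendsto_powr' disjI2 conjI) (auto simp: eventually_at_filter)
  then have "\<forall>\<^sub>F t in at_right 0. M * t powr (s - r) < \<kappa> / 2"
    using \<kappa> by (intro order_tendstoD(2)) auto
  moreover have "((\<lambda>t. K * t) \<longlongrightarrow> K * 0) (at_right 0)" by (intro tendsto_intros)
  then have "\<forall>\<^sub>F t in at_right 0. K * t < b 0 / 6"
    using b0 by (intro order_tendstoD(2)) auto
  ultimately have "\<forall>\<^sub>F t in at_right 0. M * t powr (s - r) < \<kappa> / 2 \<and> K * t < b 0 / 6 \<and> 0 < t \<and> t < \<delta>"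
    using eventually_at_right_real[OF K(2)] by eventually_elim simp
  from eventually_happens[OF this]
  obtain t where t: "M * t powr (s - r) < \<kappa> / 2" "K * t < b 0 / 6" "0 < t" "t < \<delta>" by auto
  have "M * t powr s = (M * t powr (s - r)) * t powr r"
    using t by (simp flip: powr_add)
  also have "\<dots> < \<kappa> / 2 * t powr r" using t by (intro mult_strict_right_mono) auto
  finally show False using key[of t] t by simp
qed

text \<open>Translation and a change of sign put a positive value of the bump at 0, where the
  modular vanishes and Ekeland's principle starts.\<close>

lemma no_smooth_bump:
  assumes freq: "\<exists>\<^sub>F n in sequentially. q n < r" and r: "r < s" and s: "1 \<le> s" "s \<le> 2"
    and bump: "bump_on H N b"
    and smooth: "\<And>x. x \<in> H \<Longrightarrow> \<exists>D C d. bounded_functional_on H N D \<and> d > 0 \<and>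
      (\<forall>h\<in>H. N h < d \<longrightarrow> \<bar>b (x + h) - b x - D h\<bar> \<le> C * N h powr s)"
  shows False
proof -
  obtain x0 R where x0: "x0 \<in> H" "b x0 \<noteq> 0" and R: "\<And>x. x \<in> H \<Longrightarrow> b x \<noteq> 0 \<Longrightarrow> N x \<le> R"
    using bump unfolding bump_on_def by blast
  define c where "c x = sgn (b x0) * b (x0 + x)" for x
  have "c 0 > 0" using x0 by (simp add: c_def sgn_mult_self_eq[symmetric] sgn_if)
  moreover have "N x \<le> R + N x0" if "x \<in> H" "c x \<noteq> 0" for x
    using R[of "x0 + x"] norm_diff_le[of "x0 + x" x0] x0 that by (auto simp: c_def)
  moreover have "\<exists>D C d. bounded_functional_on H N D \<and> d > 0 \<and>
      (\<forall>h\<in>H. N h < d \<longrightarrow> \<bar>c (x + h) - c x - D h\<bar> \<le> C * N h powr s)" if x: "x \<in> H" for x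
  proof -
    obtain D C d where D: "bounded_functional_on H N D" "d > 0"
      "\<And>h. h \<in> H \<Longrightarrow> N h < d \<Longrightarrow> \<bar>b (x0 + x + h) - b (x0 + x) - D h\<bar> \<le> C * N h powr s"
      using smooth[of "x0 + x"] x x0 by auto
    have "\<bar>c (x + h) - c x - sgn (b x0) * D h\<bar> = \<bar>b (x0 + x + h) - b (x0 + x) - D h\<bar>" for h
    proof -
      have "c (x + h) - c x - sgn (b x0) * D h = sgn (b x0) * (b (x0 + x + h) - b (x0 + x) - D h)"
        by (simp add: c_def algebra_simps)
      then show ?thesis using x0(2) by (simp add: abs_mult abs_sgn_eq)
    qed
    then show ?thesis
      using D bounded_functional_cmult[OF D(1), of "sgn (b x0)"] by metis
  qed
  ultimately show False by (rule no_smooth_bump_at_0[OF freq r s])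
qed

end

section \<open>Choice of the exponents and conclusion\<close>

theorem corollary21:
  fixes q :: "nat \<Rightarrow> real" and p :: ereal
  assumes "\<And>n. q n \<ge> 1"
    and "liminf (\<lambda>n. ereal (q n)) = p"
    and "p > 1"
  shows "(\<exists>M. equivalent_norm_on (nakano_heart q) (luxemburg q) M \<and> frechet_norm_on (nakano_heart q) M)
    \<and> asplund_on (nakano_heart q) (luxemburg q)
    \<and> (limsup (\<lambda>n. ereal (q n)) < \<infinity> \<longrightarrow>
        (\<exists>M. equivalent_norm_on (nakano q) (luxemburg q) M \<and> frechet_norm_on (nakano q) M)
        \<and> asplund_on (nakano q) (luxemburg q))
    \<and> (limsup (\<lambda>n. ereal (q n)) < \<infinity> \<and> p < 2 \<longrightarrow>
        (\<forall>\<epsilon>>0. \<not> (\<exists>b b'. bump_on (nakano q) (luxemburg q) b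
           \<and> (\<forall>x\<in>nakano q. frechet_deriv_on (nakano q) (luxemburg q) b (b' x) x)
           \<and> (\<forall>x\<in>nakano q. \<exists>C. \<exists>d>0. \<forall>h\<in>nakano q. luxemburg q h < d \<longrightarrow>
                \<bar>b (x + h) - b x - b' x h\<bar> \<le> C * luxemburg q h powr (real_of_ereal p + \<epsilon>)))))"
proof -
  interpret Q: nakano_exponents q by unfold_locales (rule assms(1))
  \<comment> \<open>\<open>p\<close> may be infinite; a value strictly between 1 and
    \<open>p\<close> is still real.\<close>
  obtain c where c: "1 < c" "c < p" using dense[OF assms(3)] by blast
  then obtain s where s: "c = ereal s" "1 < s" by (cases c) (auto simp: one_ereal_def)
  define q' where "q' n = max (q n) s" for n
  have "\<forall>\<^sub>F n in sequentially. ereal s < ereal (q n)"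
    using less_LiminfD[of "ereal s" sequentially "\<lambda>n. ereal (q n)"] c(2) s(1) assms(2) by simp
  then have "\<forall>\<^sub>F n in sequentially. q n = q' n" by eventually_elim (simp add: q'_def)
  then have fin: "finite {n. q n \<noteq> q' n}"
    by (simp add: eventually_cofinite flip: cofinite_eq_sequentially)
  interpret Q': nakano_exponents_gt q' s
    by unfold_locales (use assms(1) s in \<open>auto simp: q'_def intro: max.coboundedI1\<close>)
  have H: "nakano_heart q' = nakano_heart q" using heart_finite_change[OF fin] by simp
  have equiv: "equivalent_norm_on (nakano_heart q) (luxemburg q) (luxemburg q')"
    by (rule equivalent_luxemburg_finite_change[OF assms(1) _ fin]) (simp add: q'_def)
  have frechet: "frechet_norm_on (nakano_heart q) (luxemburg q')"
    using Q'.frechet_norm_luxemburg by (simp add: H)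
  have asplund: "asplund_on (nakano_heart q) (luxemburg q)"
    by (rule asplund_if_frechet_norm[OF Q.banach_heart equiv frechet])
  have heart: "nakano_heart q = nakano q" if "limsup (\<lambda>n. ereal (q n)) < \<infinity>"
    by (rule nakano_heart_eq[OF assms(1) that])
  have no_bump: False
    if sup: "limsup (\<lambda>n. ereal (q n)) < \<infinity>" and p2: "p < 2" and \<epsilon>: "\<epsilon> > 0"
      and bump: "bump_on (nakano q) (luxemburg q) b"
      and deriv: "\<And>x. x \<in> nakano q \<Longrightarrow> frechet_deriv_on (nakano q) (luxemburg q) b (b' x) x"
      and est: "\<And>x. x \<in> nakano q \<Longrightarrow> \<exists>C. \<exists>d>0. \<forall>h\<in>nakano q. luxemburg q h < d \<longrightarrow>
        \<bar>b (x + h) - b x - b' x h\<bar> \<le> C * luxemburg q h powr (real_of_ereal p + \<epsilon>)"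
    for \<epsilon> b b'
  proof -
    have H: "nakano q = nakano_heart q" using heart[OF sup] by simp
    obtain p' where p': "p = ereal p'" "1 < p'" "p' < 2"
      using assms(3) p2 by (cases p) (auto simp: one_ereal_def)
    obtain B where B: "\<And>n. q n \<le> B"
    proof -
      obtain c where "limsup (\<lambda>n. ereal (q n)) < c" "c < \<infinity>" using sup dense by blast
      then obtain B0 where "limsup (\<lambda>n. ereal (q n)) < ereal B0" by (cases c) auto
      then have "\<forall>\<^sub>F n in sequentially. q n < B0" by (auto dest: Limsup_lessD)
      then obtain n0 where n0: "\<And>n. n \<ge> n0 \<Longrightarrow> q n < B0" by (auto simp: eventually_sequentially)
      have "q n \<le> Max (insert B0 (q ` {..<n0}))" for n
        using n0[of n] by (cases "n < n0") (auto intro: Max_ge_iff[THEN iffD2])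
      then show thesis using that by blast
    qed
    interpret QB: nakano_exponents_bounded q B by unfold_locales (rule B)
    \<comment> \<open>Near 0 an estimate of higher order implies one of lower order, so the order
      may be cut down to 2, as the expansion of the reciprocal demands. Since \<open>p' < 2\<close>,
      room remains for \<open>r\<close> strictly between \<open>p'\<close> and
      \<open>\<sigma>\<close>.\<close>
    define \<sigma> where "\<sigma> = min (p' + \<epsilon>) 2"
    define r where "r = (p' + \<sigma>) / 2"
    have r: "p' < r" "r < \<sigma>" "1 \<le> \<sigma>" "\<sigma> \<le> 2" "\<sigma> \<le> p' + \<epsilon>" using p' \<epsilon> by (auto simp: r_def \<sigma>_def)
    have "\<exists>\<^sub>F n in sequentially. q n < r"
    proof (rule ccontr)
      assume "\<not> ?thesis"
      then have "\<forall>\<^sub>F n in sequentially. ereal r \<le> ereal (q n)" by (simp add: not_frequently not_less)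
      then have "ereal r \<le> p" unfolding assms(2)[symmetric] by (rule Liminf_bounded)
      then show False using r p' by simp
    qed
    then show False
    proof (rule QB.no_smooth_bump[OF _ r(2,3,4) bump[unfolded H]])
      fix x assume x: "x \<in> nakano_heart q"
      obtain C d where d: "d > 0" "\<And>h. h \<in> nakano_heart q \<Longrightarrow> luxemburg q h < d \<Longrightarrow>
          \<bar>b (x + h) - b x - b' x h\<bar> \<le> C * luxemburg q h powr (p' + \<epsilon>)"
        using est[of x] x by (auto simp: H p'(1))
      have "\<bar>b (x + h) - b x - b' x h\<bar> \<le> \<bar>C\<bar> * luxemburg q h powr \<sigma>"
        if h: "h \<in> nakano_heart q" "luxemburg q h < min d 1" for h
      proof -
        have "\<bar>b (x + h) - b x - b' x h\<bar> \<le> C * luxemburg q h powr (p' + \<epsilon>)"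
          using d(2) h by simp
        also have "\<dots> \<le> \<bar>C\<bar> * luxemburg q h powr \<sigma>"
          using h r by (intro mult_mono powr_mono') auto
        finally show ?thesis .
      qed
      moreover have "bounded_functional_on (nakano_heart q) (luxemburg q) (b' x)"
        using deriv[of x] x by (simp add: H frechet_deriv_on_def)
      moreover have "min d 1 > 0" using d by simp
      ultimately show "\<exists>D C d. bounded_functional_on (nakano_heart q) (luxemburg q) D \<and> d > 0 \<and>
          (\<forall>h\<in>nakano_heart q. luxemburg q h < d \<longrightarrow>
            \<bar>b (x + h) - b x - D h\<bar> \<le> C * luxemburg q h powr \<sigma>)"
        by blast
    qed
  qed
  have "\<forall>\<epsilon>>0. \<not> (\<exists>b b'. bump_on (nakano q) (luxemburg q) b
      \<and> (\<forall>x\<in>nakano q. frechet_deriv_on (nakano q) (luxemburg q) b (b' x) x)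
      \<and> (\<forall>x\<in>nakano q. \<exists>C. \<exists>d>0. \<forall>h\<in>nakano q. luxemburg q h < d \<longrightarrow>
          \<bar>b (x + h) - b x - b' x h\<bar> \<le> C * luxemburg q h powr (real_of_ereal p + \<epsilon>)))"
    if "limsup (\<lambda>n. ereal (q n)) < \<infinity>" "p < 2"
    using no_bump[OF that] by blast
  moreover have heart_case: "\<exists>M. equivalent_norm_on (nakano_heart q) (luxemburg q) M \<and> frechet_norm_on (nakano_heart q) M"
    using equiv frechet by blast
  moreover have "(\<exists>M. equivalent_norm_on (nakano q) (luxemburg q) M \<and> frechet_norm_on (nakano q) M)
      \<and> asplund_on (nakano q) (luxemburg q)" if "limsup (\<lambda>n. ereal (q n)) < \<infinity>"
    using heart_case asplund unfolding heart[OF that] by blast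
  ultimately show ?thesis
    using asplund by blast
qed

end
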